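(* Let $\mathcal{A},\mathcal{B}$ be (strict) tensor categories over a field $k$ and let $\mathcal{U}:\mathcal{A}\to\mathcal{B}$ be a $k$-linear, exact, faithful monoidal functor which has a left adjoint. Let $V,W\in\mathcal{A}$ and let $$0\to K\xrightarrow{\,j\,}P\xrightarrow{\,\pi\,}\mathbf{1}\to0,\qquad 0\to L\xrightarrow{\,i\,}Q\xrightarrow{\,p\,}V\to0$$ be allowable short exact sequences in $\mathcal{A}$ where $P,Q$ are relatively projective objects. Let $M_n=W\otimes L^\vee\otimes(K^\vee)^{\otimes(n-2)}$ for $n\ge2$ and $M_1=W\otimes V^\vee$. Then for all $n\ge1$, $$\dim\mathrm{Ext}^n_{\mathcal{A},\mathcal{B}}(V,W)=\dim\mathrm{Hom}_{\mathcal{A}}(K,M_n)-\dim\mathrm{Hom}_{\mathcal{A}}(P,M_n)+\dim\mathrm{Hom}_{\mathcal{A}}(\mathbf{1},M_n).$$ In particular, with the convention $(K^\vee)^{\otimes0}=\mathbf{1}$, $$\dim\mathrm{Ext}^n_{\mathcal{A},\mathcal{B}}(\mathbf{1},\mathbf{1})=\dim\mathrm{Hom}_{\mathcal{A}}\bigl(K,(K^\vee)^{\otimes(n-1)}\bigr)-\dim\mathrm{Hom}_{\mathcal{A}}\bigl(P,(K^\vee)^{\otimes(n-1)}\bigr)+\dim\mathrm{Hom}_{\mathcal{A}}\bigl(\mathbf{1},(K^\vee)^{\otimes(n-1)}\bigr).$$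
   Context: A tensor category over $k$ is a $k$-linear abelian rigid monoidal category with $k$-bilinear tensor product whose unit $\mathbf{1}$ is simple with $\mathrm{End}(\mathbf{1})\cong k$. The dual $X^\vee$ comes with $\mathrm{ev}_X:X^\vee\otimes X\to\mathbf{1}$ and $\mathrm{coev}_X:\mathbf{1}\to X\otimes X^\vee$ satisfying the zig-zag identities. A morphism $f:X\to Y$ in $\mathcal{A}$ is allowable if there is $s\in\mathrm{Hom}_{\mathcal{B}}(\mathcal{U}(Y),\mathcal{U}(X))$ with $\mathcal{U}(f)s\,\mathcal{U}(f)=\mathcal{U}(f)$. An exact sequence is allowable if all its morphisms are. An object $P$ is relatively projective if every morphism $P\to Y$ lifts along every allowable epimorphism $X\to Y$. A relatively projective resolution of $V$ is an allowable exact sequence $\cdots\to P_1\to P_0\to V\to0$ with all $P_i$ relatively projective. $\mathrm{Ext}^n_{\mathcal{A},\mathcal{B}}(V,W)$ is the $n$-th cohomology of $0\to\mathrm{Hom}_{\mathcal{A}}(P_0,W)\to\mathrm{Hom}_{\mathcal{A}}(P_1,W)\to\cdots$, independent of the resolution. *)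

theory Defs
  imports
    "Jordan_Normal_Form.Missing_VectorSpace"
    "HOL-Algebra.AbelCoset"
    "HOL-Library.Extended_Real"
begin

section \<open>Dimensions and quotients of vector spaces\<close>

text \<open>The dimension is extended-real valued because Hom-spaces of a tensor category need not be
  finite-dimensional: \<^const>\<open>vectorspace.dim\<close> is only meaningful together with
  \<^const>\<open>vectorspace.fin_dim\<close>.\<close>

definition vdim :: "('k, 'r) ring_scheme \<Rightarrow> ('k, 'v, 's) module_scheme \<Rightarrow> ereal" where
  "vdim k V = (if vectorspace.fin_dim k V then ereal (real (vectorspace.dim k V)) else \<infinity>)"

text \<open>Cosets with the operations induced by representatives, extending the quotient group
  \<^const>\<open>A_FactGroup\<close> by scalar multiplication.\<close>

definition quotient_module :: "('k, 'v, 's) module_scheme \<Rightarrow> 'v set \<Rightarrow> ('k, 'v set) module" where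
  "quotient_module V S =
     \<lparr>carrier = a_rcosets\<^bsub>V\<^esub> S, mult = undefined, one = undefined, zero = S, add = set_add V,
      smult = (\<lambda>c X. \<Union>x\<in>X. S +>\<^bsub>V\<^esub> (c \<odot>\<^bsub>V\<^esub> x))\<rparr>"


section \<open>Linear and abelian categories\<close>

text \<open>A category with object set \<open>Obj\<close> whose Hom-sets are the carriers of the modules \<open>Hom X Y\<close>.
  \<open>g \<cdot> f\<close> is \<open>g\<close> after \<open>f\<close>; it is a total function that is only meaningful on composable
  morphisms. Hom-sets are not required to be pairwise disjoint, so the source and target
  of a morphism are always given explicitly.\<close>

record ('k, 'o, 'm) lin_cat =
  Obj :: "'o set"
  Hom :: "'o \<Rightarrow> 'o \<Rightarrow> ('k, 'm) module"
  Id :: "'o \<Rightarrow> 'm"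
  Comp :: "'m \<Rightarrow> 'm \<Rightarrow> 'm" (infixl "\<cdot>\<index>" 75)

abbreviation hom_set :: "('k, 'o, 'm, 'z) lin_cat_scheme \<Rightarrow> 'o \<Rightarrow> 'o \<Rightarrow> 'm set" where
  "hom_set C X Y \<equiv> carrier (Hom C X Y)"

abbreviation zero_mor :: "('k, 'o, 'm, 'z) lin_cat_scheme \<Rightarrow> 'o \<Rightarrow> 'o \<Rightarrow> 'm" where
  "zero_mor C X Y \<equiv> \<zero>\<^bsub>Hom C X Y\<^esub>"

locale linear_category =
  fixes k :: "('k, 'r) ring_scheme" and C :: "('k, 'o, 'm, 'z) lin_cat_scheme" (structure)
  assumes base_field: "field k"
    and Hom_vectorspace: "\<lbrakk>X \<in> Obj C; Y \<in> Obj C\<rbrakk> \<Longrightarrow> vectorspace k (Hom C X Y)"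
    and Id_in_hom: "X \<in> Obj C \<Longrightarrow> Id C X \<in> hom_set C X X"
    and Comp_linear_right:
      "\<lbrakk>X \<in> Obj C; Y \<in> Obj C; Z \<in> Obj C; g \<in> hom_set C Y Z\<rbrakk>
        \<Longrightarrow> (\<lambda>f. g \<cdot> f) \<in> LinearCombinations.module_hom k (Hom C X Y) (Hom C X Z)"
    and Comp_linear_left:
      "\<lbrakk>X \<in> Obj C; Y \<in> Obj C; Z \<in> Obj C; f \<in> hom_set C X Y\<rbrakk>
        \<Longrightarrow> (\<lambda>g. g \<cdot> f) \<in> LinearCombinations.module_hom k (Hom C Y Z) (Hom C X Z)"
    and Comp_assoc:
      "\<lbrakk>X \<in> Obj C; Y \<in> Obj C; Z \<in> Obj C; T \<in> Obj C;
        f \<in> hom_set C X Y; g \<in> hom_set C Y Z; h \<in> hom_set C Z T\<rbrakk>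
        \<Longrightarrow> (h \<cdot> g) \<cdot> f = h \<cdot> (g \<cdot> f)"
    and Id_left: "\<lbrakk>X \<in> Obj C; Y \<in> Obj C; f \<in> hom_set C X Y\<rbrakk> \<Longrightarrow> Id C Y \<cdot> f = f"
    and Id_right: "\<lbrakk>X \<in> Obj C; Y \<in> Obj C; f \<in> hom_set C X Y\<rbrakk> \<Longrightarrow> f \<cdot> Id C X = f"

definition is_mono :: "('k, 'o, 'm, 'z) lin_cat_scheme \<Rightarrow> 'o \<Rightarrow> 'o \<Rightarrow> 'm \<Rightarrow> bool" where
  "is_mono C X Y f \<longleftrightarrow> f \<in> hom_set C X Y \<and>
     (\<forall>T\<in>Obj C. \<forall>g\<in>hom_set C T X. \<forall>h\<in>hom_set C T X. f \<cdot>\<^bsub>C\<^esub> g = f \<cdot>\<^bsub>C\<^esub> h \<longrightarrow> g = h)"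

definition is_epi :: "('k, 'o, 'm, 'z) lin_cat_scheme \<Rightarrow> 'o \<Rightarrow> 'o \<Rightarrow> 'm \<Rightarrow> bool" where
  "is_epi C X Y f \<longleftrightarrow> f \<in> hom_set C X Y \<and>
     (\<forall>T\<in>Obj C. \<forall>g\<in>hom_set C Y T. \<forall>h\<in>hom_set C Y T. g \<cdot>\<^bsub>C\<^esub> f = h \<cdot>\<^bsub>C\<^esub> f \<longrightarrow> g = h)"

definition is_iso :: "('k, 'o, 'm, 'z) lin_cat_scheme \<Rightarrow> 'o \<Rightarrow> 'o \<Rightarrow> 'm \<Rightarrow> bool" where
  "is_iso C X Y f \<longleftrightarrow> f \<in> hom_set C X Y \<and>
     (\<exists>g\<in>hom_set C Y X. g \<cdot>\<^bsub>C\<^esub> f = Id C X \<and> f \<cdot>\<^bsub>C\<^esub> g = Id C Y)"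

definition is_zero_object :: "('k, 'o, 'm, 'z) lin_cat_scheme \<Rightarrow> 'o \<Rightarrow> bool" where
  "is_zero_object C Z \<longleftrightarrow> Z \<in> Obj C \<and>
     (\<forall>X\<in>Obj C. (\<exists>!f. f \<in> hom_set C X Z) \<and> (\<exists>!f. f \<in> hom_set C Z X))"

definition is_biproduct ::
  "('k, 'o, 'm, 'z) lin_cat_scheme \<Rightarrow> 'o \<Rightarrow> 'o \<Rightarrow> 'o \<Rightarrow> 'm \<Rightarrow> 'm \<Rightarrow> 'm \<Rightarrow> 'm \<Rightarrow> bool" where
  "is_biproduct C X Y S i\<^sub>1 i\<^sub>2 p\<^sub>1 p\<^sub>2 \<longleftrightarrow> S \<in> Obj C \<and>
     i\<^sub>1 \<in> hom_set C X S \<and> i\<^sub>2 \<in> hom_set C Y S \<and> p\<^sub>1 \<in> hom_set C S X \<and> p\<^sub>2 \<in> hom_set C S Y \<and>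
     p\<^sub>1 \<cdot>\<^bsub>C\<^esub> i\<^sub>1 = Id C X \<and> p\<^sub>2 \<cdot>\<^bsub>C\<^esub> i\<^sub>2 = Id C Y \<and>
     p\<^sub>1 \<cdot>\<^bsub>C\<^esub> i\<^sub>2 = zero_mor C Y X \<and> p\<^sub>2 \<cdot>\<^bsub>C\<^esub> i\<^sub>1 = zero_mor C X Y \<and>
     (i\<^sub>1 \<cdot>\<^bsub>C\<^esub> p\<^sub>1) \<oplus>\<^bsub>Hom C S S\<^esub> (i\<^sub>2 \<cdot>\<^bsub>C\<^esub> p\<^sub>2) = Id C S"

text \<open>\<open>m : N \<rightarrow> X\<close> is a kernel, respectively \<open>c : Y \<rightarrow> Q\<close> a cokernel, of \<open>f : X \<rightarrow> Y\<close>.\<close>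

definition is_kernel ::
  "('k, 'o, 'm, 'z) lin_cat_scheme \<Rightarrow> 'o \<Rightarrow> 'o \<Rightarrow> 'm \<Rightarrow> 'o \<Rightarrow> 'm \<Rightarrow> bool" where
  "is_kernel C X Y f N m \<longleftrightarrow> N \<in> Obj C \<and> m \<in> hom_set C N X \<and> f \<cdot>\<^bsub>C\<^esub> m = zero_mor C N Y \<and>
     (\<forall>T\<in>Obj C. \<forall>t\<in>hom_set C T X. f \<cdot>\<^bsub>C\<^esub> t = zero_mor C T Y \<longrightarrow>
        (\<exists>!u. u \<in> hom_set C T N \<and> m \<cdot>\<^bsub>C\<^esub> u = t))"

definition is_cokernel ::
  "('k, 'o, 'm, 'z) lin_cat_scheme \<Rightarrow> 'o \<Rightarrow> 'o \<Rightarrow> 'm \<Rightarrow> 'o \<Rightarrow> 'm \<Rightarrow> bool" where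
  "is_cokernel C X Y f Q c \<longleftrightarrow> Q \<in> Obj C \<and> c \<in> hom_set C Y Q \<and> c \<cdot>\<^bsub>C\<^esub> f = zero_mor C X Q \<and>
     (\<forall>T\<in>Obj C. \<forall>t\<in>hom_set C Y T. t \<cdot>\<^bsub>C\<^esub> f = zero_mor C X T \<longrightarrow>
        (\<exists>!u. u \<in> hom_set C Q T \<and> u \<cdot>\<^bsub>C\<^esub> c = t))"

definition is_image ::
  "('k, 'o, 'm, 'z) lin_cat_scheme \<Rightarrow> 'o \<Rightarrow> 'o \<Rightarrow> 'm \<Rightarrow> 'o \<Rightarrow> 'm \<Rightarrow> bool" where
  "is_image C X Y f I m \<longleftrightarrow> (\<exists>Q c. is_cokernel C X Y f Q c \<and> is_kernel C Y Q c I m)"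

locale abelian_category = linear_category k C
  for k :: "('k, 'r) ring_scheme" and C :: "('k, 'o, 'm, 'z) lin_cat_scheme" (structure) +
  assumes zero_object_exists: "\<exists>Z. is_zero_object C Z"
    and biproduct_exists:
      "\<lbrakk>X \<in> Obj C; Y \<in> Obj C\<rbrakk> \<Longrightarrow> \<exists>S i\<^sub>1 i\<^sub>2 p\<^sub>1 p\<^sub>2. is_biproduct C X Y S i\<^sub>1 i\<^sub>2 p\<^sub>1 p\<^sub>2"
    and kernel_exists:
      "\<lbrakk>X \<in> Obj C; Y \<in> Obj C; f \<in> hom_set C X Y\<rbrakk> \<Longrightarrow> \<exists>N m. is_kernel C X Y f N m"
    and cokernel_exists:
      "\<lbrakk>X \<in> Obj C; Y \<in> Obj C; f \<in> hom_set C X Y\<rbrakk> \<Longrightarrow> \<exists>Q c. is_cokernel C X Y f Q c"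
    and mono_is_kernel:
      "\<lbrakk>X \<in> Obj C; Y \<in> Obj C; is_mono C X Y f\<rbrakk>
        \<Longrightarrow> \<exists>Z\<in>Obj C. \<exists>g\<in>hom_set C Y Z. is_kernel C Y Z g X f"
    and epi_is_cokernel:
      "\<lbrakk>X \<in> Obj C; Y \<in> Obj C; is_epi C X Y f\<rbrakk>
        \<Longrightarrow> \<exists>Z\<in>Obj C. \<exists>g\<in>hom_set C Z X. is_cokernel C Z X g Y f"

text \<open>Exactness of \<open>X \<rightarrow> Y \<rightarrow> Z\<close> at \<open>Y\<close>: the image of \<open>f\<close> is the kernel of \<open>g\<close>, as subobjects
  of \<open>Y\<close>.\<close>

definition exact_at ::
  "('k, 'o, 'm, 'z) lin_cat_scheme \<Rightarrow> 'o \<Rightarrow> 'o \<Rightarrow> 'o \<Rightarrow> 'm \<Rightarrow> 'm \<Rightarrow> bool" where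
  "exact_at C X Y Z f g \<longleftrightarrow> f \<in> hom_set C X Y \<and> g \<in> hom_set C Y Z \<and>
     (\<exists>I m. is_image C X Y f I m \<and> is_kernel C Y Z g I m)"

definition short_exact ::
  "('k, 'o, 'm, 'z) lin_cat_scheme \<Rightarrow> 'o \<Rightarrow> 'o \<Rightarrow> 'o \<Rightarrow> 'm \<Rightarrow> 'm \<Rightarrow> bool" where
  "short_exact C X Y Z f g \<longleftrightarrow> X \<in> Obj C \<and> Y \<in> Obj C \<and> Z \<in> Obj C \<and>
     is_mono C X Y f \<and> exact_at C X Y Z f g \<and> is_epi C Y Z g"


section \<open>Strict tensor categories\<close>

text \<open>\<open>Dual X\<close> is the (left) dual of \<open>X\<close>, with \<open>Ev X : Dual X \<otimes> X \<rightarrow> 1\<close> and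
  \<open>Coev X : 1 \<rightarrow> X \<otimes> Dual X\<close>.\<close>

record ('k, 'o, 'm) tensor_cat = "('k, 'o, 'm) lin_cat" +
  Unit :: 'o
  TensO :: "'o \<Rightarrow> 'o \<Rightarrow> 'o" (infixl "\<otimes>\<^sub>o\<index>" 80)
  TensM :: "'m \<Rightarrow> 'm \<Rightarrow> 'm" (infixl "\<otimes>\<^sub>m\<index>" 80)
  Dual :: "'o \<Rightarrow> 'o"
  Ev :: "'o \<Rightarrow> 'm"
  Coev :: "'o \<Rightarrow> 'm"

text \<open>\<open>Y\<close> is a left dual of \<open>X\<close> (equivalently \<open>X\<close> is a right dual of \<open>Y\<close>). By strictness the
  zig-zag composites go from \<open>X = 1 \<otimes> X\<close> to \<open>X \<otimes> 1 = X\<close> and from \<open>Y = Y \<otimes> 1\<close> to \<open>1 \<otimes> Y = Y\<close>.\<close>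

definition is_left_dual ::
  "('k, 'o, 'm, 'z) tensor_cat_scheme \<Rightarrow> 'o \<Rightarrow> 'o \<Rightarrow> 'm \<Rightarrow> 'm \<Rightarrow> bool" where
  "is_left_dual C X Y e c \<longleftrightarrow> X \<in> Obj C \<and> Y \<in> Obj C \<and>
     e \<in> hom_set C (Y \<otimes>\<^sub>o\<^bsub>C\<^esub> X) (Unit C) \<and> c \<in> hom_set C (Unit C) (X \<otimes>\<^sub>o\<^bsub>C\<^esub> Y) \<and>
     (Id C X \<otimes>\<^sub>m\<^bsub>C\<^esub> e) \<cdot>\<^bsub>C\<^esub> (c \<otimes>\<^sub>m\<^bsub>C\<^esub> Id C X) = Id C X \<and>
     (e \<otimes>\<^sub>m\<^bsub>C\<^esub> Id C Y) \<cdot>\<^bsub>C\<^esub> (Id C Y \<otimes>\<^sub>m\<^bsub>C\<^esub> c) = Id C Y"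

locale tensor_category = abelian_category k C
  for k :: "('k, 'r) ring_scheme" and C :: "('k, 'o, 'm, 'z) tensor_cat_scheme" (structure) +
  assumes Unit_obj: "Unit C \<in> Obj C"
    and TensO_obj: "\<lbrakk>X \<in> Obj C; Y \<in> Obj C\<rbrakk> \<Longrightarrow> X \<otimes>\<^sub>o Y \<in> Obj C"
    and TensM_linear_right:
      "\<lbrakk>X \<in> Obj C; X' \<in> Obj C; Y \<in> Obj C; Y' \<in> Obj C; f \<in> hom_set C X X'\<rbrakk>
        \<Longrightarrow> (\<lambda>g. f \<otimes>\<^sub>m g) \<in> LinearCombinations.module_hom k (Hom C Y Y') (Hom C (X \<otimes>\<^sub>o Y) (X' \<otimes>\<^sub>o Y'))"
    and TensM_linear_left:
      "\<lbrakk>X \<in> Obj C; X' \<in> Obj C; Y \<in> Obj C; Y' \<in> Obj C; g \<in> hom_set C Y Y'\<rbrakk>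
        \<Longrightarrow> (\<lambda>f. f \<otimes>\<^sub>m g) \<in> LinearCombinations.module_hom k (Hom C X X') (Hom C (X \<otimes>\<^sub>o Y) (X' \<otimes>\<^sub>o Y'))"
    and TensM_Id: "\<lbrakk>X \<in> Obj C; Y \<in> Obj C\<rbrakk> \<Longrightarrow> Id C X \<otimes>\<^sub>m Id C Y = Id C (X \<otimes>\<^sub>o Y)"
    and TensM_Comp:
      "\<lbrakk>X \<in> Obj C; X' \<in> Obj C; X'' \<in> Obj C; Y \<in> Obj C; Y' \<in> Obj C; Y'' \<in> Obj C;
        f \<in> hom_set C X X'; f' \<in> hom_set C X' X''; g \<in> hom_set C Y Y'; g' \<in> hom_set C Y' Y''\<rbrakk>
        \<Longrightarrow> (f' \<cdot> f) \<otimes>\<^sub>m (g' \<cdot> g) = (f' \<otimes>\<^sub>m g') \<cdot> (f \<otimes>\<^sub>m g)"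
    and TensO_assoc:
      "\<lbrakk>X \<in> Obj C; Y \<in> Obj C; Z \<in> Obj C\<rbrakk> \<Longrightarrow> (X \<otimes>\<^sub>o Y) \<otimes>\<^sub>o Z = X \<otimes>\<^sub>o (Y \<otimes>\<^sub>o Z)"
    and TensM_assoc:
      "\<lbrakk>X \<in> Obj C; X' \<in> Obj C; Y \<in> Obj C; Y' \<in> Obj C; Z \<in> Obj C; Z' \<in> Obj C;
        f \<in> hom_set C X X'; g \<in> hom_set C Y Y'; h \<in> hom_set C Z Z'\<rbrakk>
        \<Longrightarrow> (f \<otimes>\<^sub>m g) \<otimes>\<^sub>m h = f \<otimes>\<^sub>m (g \<otimes>\<^sub>m h)"
    and TensO_Unit: "X \<in> Obj C \<Longrightarrow> Unit C \<otimes>\<^sub>o X = X" "X \<in> Obj C \<Longrightarrow> X \<otimes>\<^sub>o Unit C = X"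
    and TensM_Unit:
      "\<lbrakk>X \<in> Obj C; Y \<in> Obj C; f \<in> hom_set C X Y\<rbrakk> \<Longrightarrow> Id C (Unit C) \<otimes>\<^sub>m f = f"
      "\<lbrakk>X \<in> Obj C; Y \<in> Obj C; f \<in> hom_set C X Y\<rbrakk> \<Longrightarrow> f \<otimes>\<^sub>m Id C (Unit C) = f"
    and Dual_left_dual: "X \<in> Obj C \<Longrightarrow> is_left_dual C X (Dual C X) (Ev C X) (Coev C X)"
    and right_dual_exists: "X \<in> Obj C \<Longrightarrow> \<exists>Y e c. is_left_dual C Y X e c"
    and Unit_nonzero: "\<not> is_zero_object C (Unit C)"
    and Unit_simple:
      "\<lbrakk>X \<in> Obj C; is_mono C X (Unit C) m\<rbrakk> \<Longrightarrow> is_zero_object C X \<or> is_iso C X (Unit C) m"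
    and End_Unit:
      "bij_betw (\<lambda>a. a \<odot>\<^bsub>Hom C (Unit C) (Unit C)\<^esub> Id C (Unit C)) (carrier k)
        (hom_set C (Unit C) (Unit C))"

primrec tensor_power :: "('k, 'o, 'm, 'z) tensor_cat_scheme \<Rightarrow> 'o \<Rightarrow> nat \<Rightarrow> 'o" where
  "tensor_power C X 0 = Unit C"
| "tensor_power C X (Suc n) = tensor_power C X n \<otimes>\<^sub>o\<^bsub>C\<^esub> X"


section \<open>Functors\<close>

record ('o, 'm, 'p, 'q) cat_functor =
  FObj :: "'o \<Rightarrow> 'p"
  FMor :: "'m \<Rightarrow> 'q"

text \<open>A monoidal functor carries \<open>FTens X Y : F X \<otimes> F Y \<rightarrow> F (X \<otimes> Y)\<close> and \<open>FUnit : 1 \<rightarrow> F 1\<close>.\<close>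

record ('o, 'm, 'p, 'q) mon_functor = "('o, 'm, 'p, 'q) cat_functor" +
  FTens :: "'o \<Rightarrow> 'o \<Rightarrow> 'q"
  FUnit :: 'q

definition is_functor ::
  "('k, 'o, 'm, 'z) lin_cat_scheme \<Rightarrow> ('l, 'p, 'q, 'y) lin_cat_scheme \<Rightarrow>
   ('o, 'm, 'p, 'q, 'x) cat_functor_scheme \<Rightarrow> bool" where
  "is_functor A B F \<longleftrightarrow>
     (\<forall>X\<in>Obj A. FObj F X \<in> Obj B) \<and>
     (\<forall>X\<in>Obj A. \<forall>Y\<in>Obj A. \<forall>f\<in>hom_set A X Y. FMor F f \<in> hom_set B (FObj F X) (FObj F Y)) \<and>
     (\<forall>X\<in>Obj A. FMor F (Id A X) = Id B (FObj F X)) \<and>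
     (\<forall>X\<in>Obj A. \<forall>Y\<in>Obj A. \<forall>Z\<in>Obj A. \<forall>f\<in>hom_set A X Y. \<forall>g\<in>hom_set A Y Z.
        FMor F (g \<cdot>\<^bsub>A\<^esub> f) = FMor F g \<cdot>\<^bsub>B\<^esub> FMor F f)"

definition linear_functor ::
  "('k, 'r) ring_scheme \<Rightarrow> ('k, 'o, 'm, 'z) lin_cat_scheme \<Rightarrow> ('k, 'p, 'q, 'y) lin_cat_scheme \<Rightarrow>
   ('o, 'm, 'p, 'q, 'x) cat_functor_scheme \<Rightarrow> bool" where
  "linear_functor k A B F \<longleftrightarrow> is_functor A B F \<and>
     (\<forall>X\<in>Obj A. \<forall>Y\<in>Obj A.
        FMor F \<in> LinearCombinations.module_hom k (Hom A X Y) (Hom B (FObj F X) (FObj F Y)))"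

definition exact_functor ::
  "('k, 'o, 'm, 'z) lin_cat_scheme \<Rightarrow> ('l, 'p, 'q, 'y) lin_cat_scheme \<Rightarrow>
   ('o, 'm, 'p, 'q, 'x) cat_functor_scheme \<Rightarrow> bool" where
  "exact_functor A B F \<longleftrightarrow> is_functor A B F \<and>
     (\<forall>X Y Z f g. short_exact A X Y Z f g \<longrightarrow>
        short_exact B (FObj F X) (FObj F Y) (FObj F Z) (FMor F f) (FMor F g))"

definition faithful_functor ::
  "('k, 'o, 'm, 'z) lin_cat_scheme \<Rightarrow> ('l, 'p, 'q, 'y) lin_cat_scheme \<Rightarrow>
   ('o, 'm, 'p, 'q, 'x) cat_functor_scheme \<Rightarrow> bool" where
  "faithful_functor A B F \<longleftrightarrow> is_functor A B F \<and>
     (\<forall>X\<in>Obj A. \<forall>Y\<in>Obj A. inj_on (FMor F) (hom_set A X Y))"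

text \<open>Strong monoidal functors between strict categories: the structure morphisms are
  isomorphisms, natural and coherent (the associators and unitors being identities).\<close>

definition monoidal_functor ::
  "('k, 'o, 'm, 'z) tensor_cat_scheme \<Rightarrow> ('l, 'p, 'q, 'y) tensor_cat_scheme \<Rightarrow>
   ('o, 'm, 'p, 'q, 'x) mon_functor_scheme \<Rightarrow> bool" where
  "monoidal_functor A B F \<longleftrightarrow> is_functor A B F \<and>
     is_iso B (Unit B) (FObj F (Unit A)) (FUnit F) \<and>
     (\<forall>X\<in>Obj A. \<forall>Y\<in>Obj A.
        is_iso B (FObj F X \<otimes>\<^sub>o\<^bsub>B\<^esub> FObj F Y) (FObj F (X \<otimes>\<^sub>o\<^bsub>A\<^esub> Y)) (FTens F X Y)) \<and>
     (\<forall>X\<in>Obj A. \<forall>X'\<in>Obj A. \<forall>Y\<in>Obj A. \<forall>Y'\<in>Obj A. \<forall>f\<in>hom_set A X X'. \<forall>g\<in>hom_set A Y Y'.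
        FMor F (f \<otimes>\<^sub>m\<^bsub>A\<^esub> g) \<cdot>\<^bsub>B\<^esub> FTens F X Y = FTens F X' Y' \<cdot>\<^bsub>B\<^esub> (FMor F f \<otimes>\<^sub>m\<^bsub>B\<^esub> FMor F g)) \<and>
     (\<forall>X\<in>Obj A. \<forall>Y\<in>Obj A. \<forall>Z\<in>Obj A.
        FTens F (X \<otimes>\<^sub>o\<^bsub>A\<^esub> Y) Z \<cdot>\<^bsub>B\<^esub> (FTens F X Y \<otimes>\<^sub>m\<^bsub>B\<^esub> Id B (FObj F Z)) =
        FTens F X (Y \<otimes>\<^sub>o\<^bsub>A\<^esub> Z) \<cdot>\<^bsub>B\<^esub> (Id B (FObj F X) \<otimes>\<^sub>m\<^bsub>B\<^esub> FTens F Y Z)) \<and>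
     (\<forall>X\<in>Obj A.
        FTens F (Unit A) X \<cdot>\<^bsub>B\<^esub> (FUnit F \<otimes>\<^sub>m\<^bsub>B\<^esub> Id B (FObj F X)) = Id B (FObj F X) \<and>
        FTens F X (Unit A) \<cdot>\<^bsub>B\<^esub> (Id B (FObj F X) \<otimes>\<^sub>m\<^bsub>B\<^esub> FUnit F) = Id B (FObj F X))"

text \<open>A functor \<open>F : B \<rightarrow> A\<close> is left adjoint to \<open>U : A \<rightarrow> B\<close> via bijections
  \<open>\<Phi> X Y : Hom (F X) Y \<rightarrow> Hom X (U Y)\<close> natural in \<open>X\<close> and \<open>Y\<close>.\<close>

definition is_adjunction ::
  "('k, 'o, 'm, 'z) lin_cat_scheme \<Rightarrow> ('l, 'p, 'q, 'y) lin_cat_scheme \<Rightarrow>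
   ('p, 'q, 'o, 'm, 'w) cat_functor_scheme \<Rightarrow> ('o, 'm, 'p, 'q, 'x) cat_functor_scheme \<Rightarrow>
   ('p \<Rightarrow> 'o \<Rightarrow> 'm \<Rightarrow> 'q) \<Rightarrow> bool" where
  "is_adjunction A B F U \<Phi> \<longleftrightarrow> is_functor B A F \<and> is_functor A B U \<and>
     (\<forall>X\<in>Obj B. \<forall>Y\<in>Obj A.
        bij_betw (\<Phi> X Y) (hom_set A (FObj F X) Y) (hom_set B X (FObj U Y))) \<and>
     (\<forall>X\<in>Obj B. \<forall>Y\<in>Obj A. \<forall>Y'\<in>Obj A. \<forall>f\<in>hom_set A (FObj F X) Y. \<forall>g\<in>hom_set A Y Y'.
        \<Phi> X Y' (g \<cdot>\<^bsub>A\<^esub> f) = FMor U g \<cdot>\<^bsub>B\<^esub> \<Phi> X Y f) \<and>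
     (\<forall>X\<in>Obj B. \<forall>X'\<in>Obj B. \<forall>Y\<in>Obj A. \<forall>f\<in>hom_set A (FObj F X) Y. \<forall>h\<in>hom_set B X' X.
        \<Phi> X' Y (f \<cdot>\<^bsub>A\<^esub> FMor F h) = \<Phi> X Y f \<cdot>\<^bsub>B\<^esub> h)"

definition has_left_adjoint ::
  "('k, 'o, 'm, 'z) lin_cat_scheme \<Rightarrow> ('l, 'p, 'q, 'y) lin_cat_scheme \<Rightarrow>
   ('o, 'm, 'p, 'q, 'x) cat_functor_scheme \<Rightarrow> bool" where
  "has_left_adjoint A B U \<longleftrightarrow>
     (\<exists>(F :: ('p, 'q, 'o, 'm) cat_functor) \<Phi>. is_adjunction A B F U \<Phi>)"


section \<open>Relative homological algebra\<close>

definition allowable ::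
  "('k, 'o, 'm, 'z) lin_cat_scheme \<Rightarrow> ('l, 'p, 'q, 'y) lin_cat_scheme \<Rightarrow>
   ('o, 'm, 'p, 'q, 'x) cat_functor_scheme \<Rightarrow> 'o \<Rightarrow> 'o \<Rightarrow> 'm \<Rightarrow> bool" where
  "allowable A B U X Y f \<longleftrightarrow> f \<in> hom_set A X Y \<and>
     (\<exists>s\<in>hom_set B (FObj U Y) (FObj U X). FMor U f \<cdot>\<^bsub>B\<^esub> s \<cdot>\<^bsub>B\<^esub> FMor U f = FMor U f)"

text \<open>The outer morphisms \<open>0 \<rightarrow> X\<close> and \<open>Z \<rightarrow> 0\<close> of an exact sequence are always allowable, with
  \<open>s = 0\<close>.\<close>

definition allowable_short_exact ::
  "('k, 'o, 'm, 'z) lin_cat_scheme \<Rightarrow> ('l, 'p, 'q, 'y) lin_cat_scheme \<Rightarrow>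
   ('o, 'm, 'p, 'q, 'x) cat_functor_scheme \<Rightarrow> 'o \<Rightarrow> 'o \<Rightarrow> 'o \<Rightarrow> 'm \<Rightarrow> 'm \<Rightarrow> bool" where
  "allowable_short_exact A B U X Y Z f g \<longleftrightarrow>
     short_exact A X Y Z f g \<and> allowable A B U X Y f \<and> allowable A B U Y Z g"

definition relatively_projective ::
  "('k, 'o, 'm, 'z) lin_cat_scheme \<Rightarrow> ('l, 'p, 'q, 'y) lin_cat_scheme \<Rightarrow>
   ('o, 'm, 'p, 'q, 'x) cat_functor_scheme \<Rightarrow> 'o \<Rightarrow> bool" where
  "relatively_projective A B U P \<longleftrightarrow> P \<in> Obj A \<and>
     (\<forall>X\<in>Obj A. \<forall>Y\<in>Obj A. \<forall>f g. is_epi A X Y f \<and> allowable A B U X Y f \<and> g \<in> hom_set A P Y \<longrightarrow>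
        (\<exists>h\<in>hom_set A P X. f \<cdot>\<^bsub>A\<^esub> h = g))"

text \<open>The resolution \<open>\<dots> \<rightarrow> R 1 \<rightarrow> R 0 \<rightarrow> V \<rightarrow> 0\<close> with differentials \<open>d n : R (n + 1) \<rightarrow> R n\<close> and
  augmentation \<open>e : R 0 \<rightarrow> V\<close>.\<close>

definition rel_proj_resolution ::
  "('k, 'o, 'm, 'z) lin_cat_scheme \<Rightarrow> ('l, 'p, 'q, 'y) lin_cat_scheme \<Rightarrow>
   ('o, 'm, 'p, 'q, 'x) cat_functor_scheme \<Rightarrow> 'o \<Rightarrow> (nat \<Rightarrow> 'o) \<times> (nat \<Rightarrow> 'm) \<times> 'm \<Rightarrow> bool" where
  "rel_proj_resolution A B U V = (\<lambda>(R, d, e).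
     (\<forall>n. relatively_projective A B U (R n)) \<and>
     (\<forall>n. allowable A B U (R (Suc n)) (R n) (d n)) \<and> allowable A B U (R 0) V e \<and>
     is_epi A (R 0) V e \<and> exact_at A (R 1) (R 0) V (d 0) e \<and>
     (\<forall>n. exact_at A (R (Suc (Suc n))) (R (Suc n)) (R n) (d (Suc n)) (d n)))"

text \<open>Cocycles and coboundaries of \<open>0 \<rightarrow> Hom (R 0) W \<rightarrow> Hom (R 1) W \<rightarrow> \<dots>\<close>.\<close>

definition cocycles ::
  "('k, 'o, 'm, 'z) lin_cat_scheme \<Rightarrow> (nat \<Rightarrow> 'o) \<Rightarrow> (nat \<Rightarrow> 'm) \<Rightarrow> 'o \<Rightarrow> nat \<Rightarrow> 'm set" where
  "cocycles A R d W n = {f \<in> hom_set A (R n) W. f \<cdot>\<^bsub>A\<^esub> d n = zero_mor A (R (Suc n)) W}"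

primrec coboundaries ::
  "('k, 'o, 'm, 'z) lin_cat_scheme \<Rightarrow> (nat \<Rightarrow> 'o) \<Rightarrow> (nat \<Rightarrow> 'm) \<Rightarrow> 'o \<Rightarrow> nat \<Rightarrow> 'm set" where
  "coboundaries A R d W 0 = {zero_mor A (R 0) W}"
| "coboundaries A R d W (Suc n) = (\<lambda>f. f \<cdot>\<^bsub>A\<^esub> d n) ` hom_set A (R n) W"

definition cohomology ::
  "('k, 'o, 'm, 'z) lin_cat_scheme \<Rightarrow> (nat \<Rightarrow> 'o) \<Rightarrow> (nat \<Rightarrow> 'm) \<Rightarrow> 'o \<Rightarrow> nat \<Rightarrow> ('k, 'm set) module"
  where
  "cohomology A R d W n =
     quotient_module ((Hom A (R n) W)\<lparr>carrier := cocycles A R d W n\<rparr>) (coboundaries A R d W n)"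

text \<open>Computed from an arbitrary relatively projective resolution of \<open>V\<close>; one exists when \<open>U\<close> is
  exact and faithful and has a left adjoint, and up to isomorphism the choice does not matter.\<close>

definition rel_Ext ::
  "('k, 'o, 'm, 'z) lin_cat_scheme \<Rightarrow> ('l, 'p, 'q, 'y) lin_cat_scheme \<Rightarrow>
   ('o, 'm, 'p, 'q, 'x) cat_functor_scheme \<Rightarrow> nat \<Rightarrow> 'o \<Rightarrow> 'o \<Rightarrow> ('k, 'm set) module" where
  "rel_Ext A B U n V W =
     (case SOME r. rel_proj_resolution A B U V r of (R, d, e) \<Rightarrow> cohomology A R d W n)"

end

theory Submission
  imports Defs
begin

text \<open>The presentation \<open>0 \<rightarrow> K \<rightarrow> P \<rightarrow> 1 \<rightarrow> 0\<close> of the unit object resolves everything. Tensoring it with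
  an object \<open>X\<close> gives an allowable short exact sequence \<open>0 \<rightarrow> K \<otimes> X \<rightarrow> P \<otimes> X \<rightarrow> X \<rightarrow> 0\<close>: by rigidity
  \<open>- \<otimes> X\<close> has adjoints on both sides, hence preserves kernels and epimorphisms, and allowability
  survives because the functor \<open>U\<close> is monoidal. Moreover \<open>P \<otimes> X\<close> is relatively projective, since
  lifting problems for it transpose to lifting problems for \<open>P\<close> (\<open>rel_presentation_TensM\<close>). So after
  the first step \<open>0 \<rightarrow> L \<rightarrow> Q \<rightarrow> V \<rightarrow> 0\<close> the higher syzygies of \<open>V\<close> can be taken to be
  \<open>K \<otimes> \<dots> \<otimes> K \<otimes> L\<close>.

  By dimension shifting, \<open>Ext\<^sup>n(V, W)\<close> for \<open>n \<ge> 1\<close> is the cokernel of the restriction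
  \<open>Hom(P', W) \<rightarrow> Hom(K', W)\<close> for any presentation \<open>0 \<rightarrow> K' \<rightarrow> P' \<rightarrow> X \<rightarrow> 0\<close> of the \<open>(n - 1)\<close>-st syzygy
  \<open>X\<close> (\<open>vdim_rel_Ext\<close>). The presentation with \<open>K' = K \<otimes> X\<close> and \<open>P' = P \<otimes> X\<close> and the adjunction
  \<open>Hom(T \<otimes> X, W) = Hom(T, W \<otimes> X\<^sup>\<or>)\<close> turn this into the cokernel of \<open>Hom(P, M\<^sub>n) \<rightarrow> Hom(K, M\<^sub>n)\<close>
  (\<open>vdim_rel_Ext_restriction_cokernel\<close>). The kernel of that map is \<open>Hom(1, M\<^sub>n)\<close>, and counting
  dimensions gives the formula (\<open>vdim_restriction_cokernel\<close>).

  Ext is defined by an arbitrarily chosen resolution, so dimension shifting has to compare its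
  syzygies with the explicit ones. They agree up to stable equivalence, that is, up to endomorphisms
  that factor through relatively projective objects: a stable equivalence of two objects lifts to
  their presentations and restricts to one of the kernels (\<open>syzygy_comparison\<close>), and the cokernels of
  the restriction maps are invariant under it (\<open>restriction_cokernel_invariant\<close>). The explicit chain
  of presentations also provides the existence of a resolution.

  Hom-spaces may be infinite-dimensional. Dimension counts are therefore kept in the additive form of
  \<open>vdim_cokernel\<close>, which is valid for all dimensions.\<close>

section \<open>Dimensions of vector spaces and quotients\<close>

abbreviation linear_hom ::
  "('k, 'r) ring_scheme \<Rightarrow> ('k, 'v, 's) module_scheme \<Rightarrow> ('k, 'w, 't) module_scheme \<Rightarrow> ('v \<Rightarrow> 'w) set"
  where "linear_hom \<equiv> LinearCombinations.module_hom"

lemma linear_mapI: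
  assumes "vectorspace k V" and "vectorspace k W" and "T \<in> linear_hom k V W"
  shows "linear_map k V W T"
  using assms unfolding linear_map_def mod_hom_def mod_hom_axioms_def vectorspace_def by auto

text \<open>Independent subsets of the subspace stay independent in the whole space, which bounds their size; a
  maximal one is a basis.\<close>

lemma (in vectorspace) subspace_fin_dim:
  assumes fd: "fin_dim" and W: "VectorSpace.subspace K W V"
  shows "vectorspace.fin_dim K (vs W)"
proof -
  interpret W: vectorspace K "vs W" by (rule subspace_is_vs[OF W])
  have sub: "submodule K W V" using W by simp
  have WV: "W \<subseteq> carrier V" using sub by (simp add: submodule.subset)
  have "\<exists>A. finite A \<and> maximal A (\<lambda>S. S \<subseteq> carrier (vs W) \<and> W.lin_indpt S)"
  proof (rule maximal_exists)
    fix A assume A: "A \<subseteq> carrier (vs W) \<and> W.lin_indpt A"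
    then have "lin_indpt A" using span_li_not_depend(2)[OF _ sub] by auto
    then show "finite A \<and> card A \<le> dim" using li_le_dim[OF fd] A WV by auto
  next
    show "{} \<subseteq> carrier (vs W) \<and> W.lin_indpt {}" by (auto simp: W.lin_dep_def)
  qed
  then obtain A where "finite A" "W.basis A" using W.max_li_is_basis by blast
  then show ?thesis unfolding W.basis_def W.fin_dim_def by blast
qed

text \<open>For a finite-dimensional source this is rank-nullity. Otherwise kernel and target are not both
  finite-dimensional, because generators of the kernel together with preimages of generators of the
  target generate the source; so both sides are infinite.\<close>

lemma (in linear_map) vdim_surjective:
  assumes surj: "T ` carrier V = carrier W"
  shows "vdim K V = vdim K (V.vs kerT) + vdim K W"
proof (cases "V.fin_dim")
  case True
  have 1: "W.fin_dim" using surj_fin_dim[OF True surj] .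
  have 2: "vectorspace.fin_dim K (V.vs kerT)"
    by (rule V.subspace_fin_dim[OF True kerT_is_subspace])
  have "W.vs imT = W" using surj_imp_imT_carrier[OF surj] by simp
  then have "vectorspace.dim K W + vectorspace.dim K (V.vs kerT) = V.dim"
    using rank_nullity[OF True] by simp
  then show ?thesis using True 1 2 by (simp add: vdim_def flip: of_nat_add)
next
  case False
  interpret N: vectorspace K "V.vs kerT" by (rule V.subspace_is_vs[OF kerT_is_subspace])
  have sub: "submodule K kerT V" using kerT_is_subspace by simp
  have "\<not> (N.fin_dim \<and> W.fin_dim)"
  proof
    assume "N.fin_dim \<and> W.fin_dim"
    then obtain A B where A: "finite A" "A \<subseteq> kerT" "N.span A = kerT"
      and B: "finite B" "B \<subseteq> carrier W" "W.module.span B = carrier W"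
      unfolding N.fin_dim_def W.fin_dim_def by auto
    have spanA: "V.module.span A = kerT" using V.module.span_li_not_depend(1)[OF A(2) sub] A(3) by simp
    have kerV: "kerT \<subseteq> carrier V" using sub by (simp add: submodule.subset)
    obtain C where C: "finite C" "C \<subseteq> carrier V" "T ` C = B"
      using B(1,2) surj finite_subset_image[of B T "carrier V"] by metis
    have AC: "A \<union> C \<subseteq> carrier V" using A C kerV by auto
    have Cspan: "VectorSpace.subspace K (V.module.span C) V" by (rule V.span_is_subspace[OF C(2)])
    then have Csub: "submodule K (V.module.span C) V" by simp
    have CV: "V.module.span C \<subseteq> carrier V" using Csub by (simp add: submodule.subset)
    have TC: "submodule K (T ` V.module.span C) W"
    proof (rule submodule.intro)
      show "Module.module K W" by unfold_locales
      show "T ` V.module.span C \<subseteq> carrier W" using CV by auto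
      show "\<zero>\<^bsub>W\<^esub> \<in> T ` V.module.span C"
        using submodule.zero_closed[OF Csub] T0_is_0 by (metis image_eqI)
      show "v \<oplus>\<^bsub>W\<^esub> w \<in> T ` V.module.span C" if vw: "v \<in> T ` V.module.span C" "w \<in> T ` V.module.span C" for v w
      proof -
        obtain v' w' where "v' \<in> V.module.span C" "w' \<in> V.module.span C" "v = T v'" "w = T w'" using vw by auto
        moreover from this have "T (v' \<oplus>\<^bsub>V\<^esub> w') = T v' \<oplus>\<^bsub>W\<^esub> T w'"
          using CV by (intro T_add) auto
        ultimately show ?thesis using submodule.m_closed[OF Csub, of v' w'] by (metis image_eqI)
      qed
      show "c \<odot>\<^bsub>W\<^esub> v \<in> T ` V.module.span C" if c: "c \<in> carrier K" and v: "v \<in> T ` V.module.span C" for c v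
      proof -
        obtain v' where "v' \<in> V.module.span C" "v = T v'" using v by auto
        moreover from this have "T (c \<odot>\<^bsub>V\<^esub> v') = c \<odot>\<^bsub>W\<^esub> T v'"
          using CV c by (intro T_smult) auto
        ultimately show ?thesis using submodule.smult_closed[OF Csub c, of v'] by (metis image_eqI)
      qed
    qed
    have "B \<subseteq> T ` V.module.span C" using C V.module.in_own_span[OF C(2)] by auto
    then have WTC: "carrier W \<subseteq> T ` V.module.span C" using W.module.span_is_subset[OF _ TC, of B] B(3) by simp
    have ACspan: "VectorSpace.subspace K (V.module.span (A \<union> C)) V" by (rule V.span_is_subspace[OF AC])
    then have ACsub: "submodule K (V.module.span (A \<union> C)) V" by simp
    have "carrier V \<subseteq> V.module.span (A \<union> C)"
    proof
      fix v assume v: "v \<in> carrier V"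
      then have "T v \<in> T ` V.module.span C" using WTC by auto
      then obtain c where c: "c \<in> V.module.span C" "T v = T c" by auto
      have cV: "c \<in> carrier V" using c CV by auto
      have "T (v \<ominus>\<^bsub>V\<^esub> c) = \<zero>\<^bsub>W\<^esub>" using v cV c by (simp add: W.module.M.r_neg a_minus_def)
      then have "v \<ominus>\<^bsub>V\<^esub> c \<in> kerT" using v cV by (simp add: ker_def)
      then have 1: "v \<ominus>\<^bsub>V\<^esub> c \<in> V.module.span (A \<union> C)"
        using spanA V.module.span_is_monotone[of A "A \<union> C"] by auto
      have 2: "c \<in> V.module.span (A \<union> C)" using c V.module.span_is_monotone[of C "A \<union> C"] by auto
      have "(v \<ominus>\<^bsub>V\<^esub> c) \<oplus>\<^bsub>V\<^esub> c = v"
        using v cV by (simp add: a_minus_def V.module.M.a_assoc V.module.M.l_neg)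
      then show "v \<in> V.module.span (A \<union> C)" using submodule.m_closed[OF ACsub 1 2] by simp
    qed
    then have "V.module.gen_set (A \<union> C)" using ACsub by (simp add: submodule.subset subset_antisym)
    then have "V.fin_dim" unfolding V.fin_dim_def using A(1) C(1) AC by blast
    then show False using False by simp
  qed
  moreover have "vdim K X \<noteq> - \<infinity>" for X :: "('a, 'c, 'd) module_scheme" by (simp add: vdim_def)
  ultimately show ?thesis using False by (auto simp: vdim_def)
qed

lemma vdim_kernel_plus_target:
  assumes "linear_map k V W T" and "T ` carrier V = carrier W"
  shows "vdim k V = vdim k (V\<lparr>carrier := {x \<in> carrier V. T x = \<zero>\<^bsub>W\<^esub>}\<rparr>) + vdim k W"
proof -
  interpret linear_map k V W T by fact
  show ?thesis using vdim_surjective[OF assms(2)] unfolding ker_def .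
qed

lemma (in linear_map) vdim_bijective:
  assumes bij: "bij_betw T (carrier V) (carrier W)"
  shows "vdim K V = vdim K W"
proof -
  have inj: "inj_on T (carrier V)" and surj: "T ` carrier V = carrier W"
    using bij by (auto simp: bij_betw_def)
  interpret N: vectorspace K "V.vs kerT" by (rule V.subspace_is_vs[OF kerT_is_subspace])
  have ker0: "kerT = {\<zero>\<^bsub>V\<^esub>}" using inj_imp_Ker0[OF inj] by simp
  have "N.gen_set {}" using N.span_empty ker0 by simp
  then have "N.fin_dim" unfolding N.fin_dim_def by blast
  then have "vdim K (V.vs kerT) = 0" using inj_imp_dim_ker0[OF inj] by (simp add: vdim_def)
  then show ?thesis using vdim_surjective[OF surj] by simp
qed

lemma vdim_nonneg: "0 \<le> vdim k V"
  by (simp add: vdim_def)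

text \<open>Every axiom is an equation, a closure property or the existence of an inverse, so it passes to the
  image. Here \<open>W\<close> is only a structure with operations, and this is how cosets with representative-wise
  operations are recognised as a vector space.\<close>

lemma vectorspace_surjective_image:
  assumes "vectorspace k V" and q: "q \<in> linear_hom k V W" and surj: "q ` carrier V = carrier W"
    and zero: "q \<zero>\<^bsub>V\<^esub> = \<zero>\<^bsub>W\<^esub>"
  shows "vectorspace k W"
proof -
  interpret V: vectorspace k V by fact
  have add: "q x \<oplus>\<^bsub>W\<^esub> q y = q (x \<oplus>\<^bsub>V\<^esub> y)" if "x \<in> carrier V" "y \<in> carrier V" for x y
    using LinearCombinations.module_hom_add[OF q] that by simp
  have smult: "c \<odot>\<^bsub>W\<^esub> q x = q (c \<odot>\<^bsub>V\<^esub> x)" if "c \<in> carrier k" "x \<in> carrier V" for c x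
    using LinearCombinations.module_hom_smult[OF q] that by simp
  have el: "\<exists>x\<in>carrier V. w = q x" if "w \<in> carrier W" for w
    using that unfolding surj[symmetric] by auto
  have qW: "q x \<in> carrier W" if "x \<in> carrier V" for x
    using that unfolding surj[symmetric] by auto
  show ?thesis
  proof (rule vs_criteria, safe)
    show "field k" by unfold_locales
    show "\<zero>\<^bsub>W\<^esub> \<in> carrier W" unfolding zero[symmetric] by (rule qW) simp
  next
    fix u assume "u \<in> carrier W"
    then obtain x where x: "x \<in> carrier V" and u: "u = q x" using el by auto
    have "u \<oplus>\<^bsub>W\<^esub> q (\<ominus>\<^bsub>V\<^esub> x) = \<zero>\<^bsub>W\<^esub>"
      unfolding u using x by (simp add: add V.M.r_neg zero)
    then show "\<exists>neg_u\<in>carrier W. u \<oplus>\<^bsub>W\<^esub> neg_u = \<zero>\<^bsub>W\<^esub>"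
      using qW[of "\<ominus>\<^bsub>V\<^esub> x"] x by auto
    show "u \<oplus>\<^bsub>W\<^esub> \<zero>\<^bsub>W\<^esub> = u"
      unfolding u zero[symmetric] using x by (simp add: add)
    show "\<one>\<^bsub>k\<^esub> \<odot>\<^bsub>W\<^esub> u = u" unfolding u using x by (simp add: smult)
    fix c assume c: "c \<in> carrier k"
    show "c \<odot>\<^bsub>W\<^esub> u \<in> carrier W" unfolding u using x c by (simp add: smult qW)
    fix d assume d: "d \<in> carrier k"
    show "(c \<oplus>\<^bsub>k\<^esub> d) \<odot>\<^bsub>W\<^esub> u = c \<odot>\<^bsub>W\<^esub> u \<oplus>\<^bsub>W\<^esub> d \<odot>\<^bsub>W\<^esub> u"
      unfolding u using x c d by (simp add: smult add V.smult_l_distr)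
    show "(c \<otimes>\<^bsub>k\<^esub> d) \<odot>\<^bsub>W\<^esub> u = c \<odot>\<^bsub>W\<^esub> (d \<odot>\<^bsub>W\<^esub> u)"
      unfolding u using x c d by (simp add: smult V.smult_assoc1)
  next
    fix u v assume "u \<in> carrier W" "v \<in> carrier W"
    then obtain x y where x: "x \<in> carrier V" "y \<in> carrier V" and u: "u = q x" "v = q y"
      using el by metis
    show "u \<oplus>\<^bsub>W\<^esub> v \<in> carrier W" unfolding u using x by (simp add: add qW)
    show "u \<oplus>\<^bsub>W\<^esub> v = v \<oplus>\<^bsub>W\<^esub> u" unfolding u using x by (simp add: add V.M.a_comm)
    show "c \<odot>\<^bsub>W\<^esub> (u \<oplus>\<^bsub>W\<^esub> v) = c \<odot>\<^bsub>W\<^esub> u \<oplus>\<^bsub>W\<^esub> c \<odot>\<^bsub>W\<^esub> v"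
      if "c \<in> carrier k" for c
      unfolding u using x that by (simp add: smult add V.smult_r_distr)
    fix w assume "w \<in> carrier W"
    then obtain z where z: "z \<in> carrier V" and w: "w = q z" using el by metis
    show "u \<oplus>\<^bsub>W\<^esub> v \<oplus>\<^bsub>W\<^esub> w = u \<oplus>\<^bsub>W\<^esub> (v \<oplus>\<^bsub>W\<^esub> w)"
      unfolding u w using x z by (simp add: add V.M.a_assoc)
  qed
qed

context vectorspace
begin

context
  fixes S
  assumes S: "VectorSpace.subspace K S V"
begin

interpretation S: submodule K S V
  using S by simp

lemma subspace_abelian_subgroup: "abelian_subgroup S V"
proof (rule abelian_subgroupI3)
  show "abelian_group V" by unfold_locales
  have "\<ominus>\<^bsub>V\<^esub> a \<in> S" if "a \<in> S" for a
  proof -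
    have "(\<ominus>\<^bsub>K\<^esub> \<one>\<^bsub>K\<^esub>) \<odot>\<^bsub>V\<^esub> a \<in> S" using that by simp
    then show ?thesis using that S.subset by (simp add: smult_l_minus subsetD[OF S.subset])
  qed
  then show "additive_subgroup S V"
    using S.subset S.zero_closed S.m_closed
    by (intro additive_subgroupI add.subgroupI) (auto simp: a_inv_def simp del: S.zero_closed)
qed

interpretation S: abelian_subgroup S V
  by (rule subspace_abelian_subgroup)

lemma coset_eq_iff:
  assumes "x \<in> carrier V" and "y \<in> carrier V"
  shows "S +>\<^bsub>V\<^esub> x = S +>\<^bsub>V\<^esub> y \<longleftrightarrow> x \<ominus>\<^bsub>V\<^esub> y \<in> S"
proof -
  have "x \<in> S +>\<^bsub>V\<^esub> y \<longleftrightarrow> x \<ominus>\<^bsub>V\<^esub> y \<in> S"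
    using S.a_rcos_module[OF assms(2,1)] by (simp add: a_minus_def)
  then show ?thesis
    using S.a_rcos_self[OF assms(1)] S.a_repr_independence'[OF _ assms(2)] by auto
qed

lemma coset_map_linear: "(\<lambda>x. S +>\<^bsub>V\<^esub> x) \<in> linear_hom K V (quotient_module V S)"
proof -
  have "(\<Union>x'\<in>S +>\<^bsub>V\<^esub> x. S +>\<^bsub>V\<^esub> (c \<odot>\<^bsub>V\<^esub> x')) = S +>\<^bsub>V\<^esub> (c \<odot>\<^bsub>V\<^esub> x)"
    if c: "c \<in> carrier K" and x: "x \<in> carrier V" for c x
  proof -
    have "S +>\<^bsub>V\<^esub> (c \<odot>\<^bsub>V\<^esub> x') = S +>\<^bsub>V\<^esub> (c \<odot>\<^bsub>V\<^esub> x)" if x': "x' \<in> S +>\<^bsub>V\<^esub> x" for x'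
    proof -
      obtain s where s: "s \<in> S" "x' = s \<oplus>\<^bsub>V\<^esub> x" using x' unfolding a_r_coset_def' by blast
      have sV: "s \<in> carrier V" using s S.subset by auto
      have cV: "c \<odot>\<^bsub>V\<^esub> x \<in> carrier V" "c \<odot>\<^bsub>V\<^esub> s \<in> carrier V" using c x sV by simp_all
      have eq: "c \<odot>\<^bsub>V\<^esub> x' = c \<odot>\<^bsub>V\<^esub> s \<oplus>\<^bsub>V\<^esub> c \<odot>\<^bsub>V\<^esub> x"
        unfolding s(2) by (rule smult_r_distr[OF c sV x])
      have "c \<odot>\<^bsub>V\<^esub> s \<in> S" using c s(1) by (rule S.smult_closed)
      then have "c \<odot>\<^bsub>V\<^esub> x' \<in> S +>\<^bsub>V\<^esub> (c \<odot>\<^bsub>V\<^esub> x)"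
        unfolding eq a_r_coset_def' by blast
      then show ?thesis by (rule S.a_repr_independence'[OF _ cV(1), symmetric])
    qed
    moreover have "S +>\<^bsub>V\<^esub> x \<noteq> {}" using S.a_rcos_self[OF x] by blast
    ultimately show ?thesis by (rule SUP_eq_const[rotated])
  qed
  moreover have "(S +>\<^bsub>V\<^esub> x) <+>\<^bsub>V\<^esub> (S +>\<^bsub>V\<^esub> y) = S +>\<^bsub>V\<^esub> (x \<oplus>\<^bsub>V\<^esub> y)"
    if "x \<in> carrier V" "y \<in> carrier V" for x y
    using that by (rule S.a_rcos_sum)
  moreover have "S +>\<^bsub>V\<^esub> x \<in> a_rcosets\<^bsub>V\<^esub> S" if "x \<in> carrier V" for x
    using M.a_rcosetsI[OF S.subset that] .
  ultimately show ?thesis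
    unfolding LinearCombinations.module_hom_def quotient_module_def by simp
qed

lemma coset_map_surjective: "(\<lambda>x. S +>\<^bsub>V\<^esub> x) ` carrier V = carrier (quotient_module V S)"
  by (auto simp: quotient_module_def A_RCOSETS_def')

lemma coset_zero: "S +>\<^bsub>V\<^esub> \<zero>\<^bsub>V\<^esub> = \<zero>\<^bsub>quotient_module V S\<^esub>"
  using S.subset by (simp add: quotient_module_def)

lemma quotient_vectorspace: "vectorspace K (quotient_module V S)"
  using vectorspace_surjective_image[OF _ coset_map_linear coset_map_surjective coset_zero]
    vectorspace_axioms .

lemma coset_map_linear_map: "linear_map K V (quotient_module V S) (\<lambda>x. S +>\<^bsub>V\<^esub> x)"
  using vectorspace_axioms quotient_vectorspace coset_map_linear by (rule linear_mapI)

lemma coset_eq_zero_iff: "x \<in> carrier V \<Longrightarrow> S +>\<^bsub>V\<^esub> x = \<zero>\<^bsub>quotient_module V S\<^esub> \<longleftrightarrow> x \<in> S"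
  using coset_eq_iff[of x "\<zero>\<^bsub>V\<^esub>"]
  by (simp add: coset_zero[symmetric] a_minus_def M.minus_equality[of "\<zero>\<^bsub>V\<^esub>" "\<zero>\<^bsub>V\<^esub>"])

end

end

text \<open>The assignment \<open>T x \<mapsto> T' x\<close> is a well-defined linear bijection of the targets.\<close>

lemma vdim_eq_if_same_kernel:
  assumes "linear_map k V W T" and "linear_map k V W' T'"
    and surj: "T ` carrier V = carrier W" and surj': "T' ` carrier V = carrier W'"
    and ker: "\<And>x. x \<in> carrier V \<Longrightarrow> T x = \<zero>\<^bsub>W\<^esub> \<longleftrightarrow> T' x = \<zero>\<^bsub>W'\<^esub>"
  shows "vdim k W = vdim k W'"
proof -
  interpret T: linear_map k V W T by fact
  interpret T': linear_map k V W' T' by fact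
  have eq: "T x = T y \<longleftrightarrow> T' x = T' y" if "x \<in> carrier V" "y \<in> carrier V" for x y
  proof -
    have "T x = T y \<longleftrightarrow> T (x \<ominus>\<^bsub>V\<^esub> y) = \<zero>\<^bsub>W\<^esub>"
      using that by (simp add: T.W.module.M.minus_other_side)
    also have "\<dots> \<longleftrightarrow> T' (x \<ominus>\<^bsub>V\<^esub> y) = \<zero>\<^bsub>W'\<^esub>" using that by (intro ker) simp
    also have "\<dots> \<longleftrightarrow> T' x = T' y" using that by (simp add: T'.W.module.M.minus_other_side)
    finally show ?thesis .
  qed
  define h where "h w = T' (inv_into (carrier V) T w)" for w
  have h: "h (T x) = T' x" if "x \<in> carrier V" for x
    using that eq[of "inv_into (carrier V) T (T x)" x]
    by (simp add: h_def inv_into_into f_inv_into_f)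
  have "h \<in> linear_hom k W W'"
    unfolding LinearCombinations.module_hom_def surj[symmetric]
    by (auto simp: h simp flip: T.T_add T.T_smult)
  then have "linear_map k W W' h"
    by (intro linear_mapI T.W.vectorspace_axioms T'.W.vectorspace_axioms)
  moreover have "bij_betw h (carrier W) (carrier W')"
  proof -
    have "inj_on h (carrier W)"
      unfolding surj[symmetric] by (auto simp: inj_on_def h eq)
    moreover have "h ` carrier W = carrier W'"
      unfolding surj[symmetric] surj'[symmetric] image_image by (rule image_cong) (simp_all add: h)
    ultimately show ?thesis by (simp add: bij_betw_def)
  qed
  ultimately show ?thesis by (rule linear_map.vdim_bijective)
qed

text \<open>All isomorphisms between Ext spaces below come from a linear map of representatives. It is
  followed by the projection to the quotient of its target; the result is onto and has the kernel
  \<open>S\<close>.\<close>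

lemma vdim_quotient_eq:
  assumes "vectorspace k V" and "vectorspace k V'"
    and S: "VectorSpace.subspace k S V" and S': "VectorSpace.subspace k S' V'"
    and \<phi>: "\<phi> \<in> linear_hom k V V'"
    and reflect: "\<And>x. x \<in> carrier V \<Longrightarrow> \<phi> x \<in> S' \<longleftrightarrow> x \<in> S"
    and onto: "\<And>y. y \<in> carrier V' \<Longrightarrow> \<exists>x\<in>carrier V. \<exists>s\<in>S'. \<phi> x = y \<oplus>\<^bsub>V'\<^esub> s"
  shows "vdim k (quotient_module V S) = vdim k (quotient_module V' S')"
proof -
  interpret V: vectorspace k V by fact
  interpret V': vectorspace k V' by fact
  let ?Q' = "quotient_module V' S'"
  let ?T' = "\<lambda>x. S' +>\<^bsub>V'\<^esub> \<phi> x"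
  have \<phi>V: "\<phi> x \<in> carrier V'" if "x \<in> carrier V" for x
    using LinearCombinations.module_hom_closed[OF \<phi>] that by auto
  show ?thesis
  proof (rule vdim_eq_if_same_kernel)
    show "linear_map k V (quotient_module V S) (\<lambda>x. S +>\<^bsub>V\<^esub> x)"
      by (rule V.coset_map_linear_map[OF S])
    show "linear_map k V ?Q' ?T'"
    proof (rule linear_mapI)
      show "?T' \<in> linear_hom k V ?Q'"
        using \<phi> V'.coset_map_linear[OF S'] unfolding LinearCombinations.module_hom_def by (auto simp: Pi_iff)
    qed (simp_all add: assms V'.quotient_vectorspace[OF S'])
    show "(\<lambda>x. S +>\<^bsub>V\<^esub> x) ` carrier V = carrier (quotient_module V S)"
      by (rule V.coset_map_surjective[OF S])
    show "?T' ` carrier V = carrier ?Q'"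
    proof -
      have "\<exists>x\<in>carrier V. S' +>\<^bsub>V'\<^esub> y = ?T' x" if y: "y \<in> carrier V'" for y
      proof -
        obtain x s where x: "x \<in> carrier V" and s: "s \<in> S'" and eq: "\<phi> x = y \<oplus>\<^bsub>V'\<^esub> s"
          using onto[OF y] by blast
        have sV: "s \<in> carrier V'" using s submodule.subset[of k S' V'] S' by auto
        have "\<phi> x \<ominus>\<^bsub>V'\<^esub> y = s"
          unfolding eq a_minus_def using y sV
          by (metis V'.M.a_comm V'.M.a_inv_closed V'.M.r_neg1 V'.M.a_closed)
        then have "?T' x = S' +>\<^bsub>V'\<^esub> y" using V'.coset_eq_iff[OF S' \<phi>V[OF x] y] s by simp
        then show ?thesis using x by metis
      qed
      then show ?thesis
        unfolding V'.coset_map_surjective[OF S', symmetric] using \<phi>V by (auto simp: image_iff)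
    qed
    show "S +>\<^bsub>V\<^esub> x = \<zero>\<^bsub>quotient_module V S\<^esub> \<longleftrightarrow> ?T' x = \<zero>\<^bsub>?Q'\<^esub>" if "x \<in> carrier V" for x
      using that by (simp add: V.coset_eq_zero_iff[OF S] V'.coset_eq_zero_iff[OF S'] reflect \<phi>V)
  qed
qed

text \<open>Rank-nullity for \<open>T\<close> onto its image and for the projection of \<open>W\<close> modulo that image, with the
  dimension of the image eliminated. The equation is additive so that it also holds with infinite
  terms.\<close>

lemma vdim_cokernel:
  assumes T: "linear_map k V W T"
  shows "vdim k (quotient_module W (T ` carrier V)) + vdim k V =
    vdim k W + vdim k (V\<lparr>carrier := {x \<in> carrier V. T x = \<zero>\<^bsub>W\<^esub>}\<rparr>)"
proof -
  interpret linear_map k V W T by fact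
  let ?I = "T ` carrier V"
  let ?q = "\<lambda>x. ?I +>\<^bsub>W\<^esub> x"
  have I: "VectorSpace.subspace k ?I W" using imT_is_subspace by (simp add: im_def)
  have vsI: "vectorspace k (W.vs ?I)" by (rule W.subspace_is_vs[OF I])
  have q: "linear_map k W (quotient_module W ?I) ?q"
    by (rule W.coset_map_linear_map[OF I])
  have "{x \<in> carrier W. ?q x = \<zero>\<^bsub>quotient_module W ?I\<^esub>} = ?I"
    using W.coset_eq_zero_iff[OF I] T_im by blast
  then have "vdim k W = vdim k (W.vs ?I) + vdim k (quotient_module W ?I)"
    using vdim_kernel_plus_target[OF q W.coset_map_surjective[OF I]] by simp
  moreover have "vdim k V = vdim k (V.vs kerT) + vdim k (W.vs ?I)"
  proof -
    have "T \<in> linear_hom k V (W.vs ?I)"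
      using T_hom unfolding LinearCombinations.module_hom_def by simp
    then have T: "linear_map k V (W.vs ?I) T"
      by (rule linear_mapI[OF V.vectorspace_axioms vsI])
    then show ?thesis
      using vdim_kernel_plus_target[OF T] by (simp add: ker_def)
  qed
  ultimately show ?thesis by (simp add: add_ac ker_def)
qed

section \<open>Calculus in linear and abelian categories\<close>

text \<open>Membership in a Hom-set says nothing about source and target being objects; bundling the three
  conditions lets the typing of a composite follow from the typing of its factors.\<close>

definition arr :: "('k, 'o, 'm, 'z) lin_cat_scheme \<Rightarrow> 'o \<Rightarrow> 'o \<Rightarrow> 'm \<Rightarrow> bool" where
  "arr C X Y f \<longleftrightarrow> X \<in> Obj C \<and> Y \<in> Obj C \<and> f \<in> hom_set C X Y"

lemma arrD:
  assumes "arr C X Y f"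
  shows "X \<in> Obj C" and "Y \<in> Obj C" and "f \<in> hom_set C X Y"
  using assms by (simp_all add: arr_def)

lemma mono_cancel:
  assumes "is_mono C X Y m" and "arr C T X g" and "arr C T X h" and "m \<cdot>\<^bsub>C\<^esub> g = m \<cdot>\<^bsub>C\<^esub> h"
  shows "g = h"
  using assms unfolding is_mono_def arr_def by blast

lemma epi_cancel:
  assumes "is_epi C X Y q" and "arr C Y T g" and "arr C Y T h" and "g \<cdot>\<^bsub>C\<^esub> q = h \<cdot>\<^bsub>C\<^esub> q"
  shows "g = h"
  using assms unfolding is_epi_def arr_def by blast

context linear_category
begin

lemma arr_Comp: "\<lbrakk>arr C X Y f; arr C Y Z g\<rbrakk> \<Longrightarrow> arr C X Z (g \<cdot> f)"
  using LinearCombinations.module_hom_closed[OF Comp_linear_right[of X Y Z g]]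
  by (auto simp: arr_def)

lemma arr_Id: "X \<in> Obj C \<Longrightarrow> arr C X X (Id C X)"
  by (simp add: arr_def Id_in_hom)

lemma Comp_Id_left: "arr C X Y f \<Longrightarrow> Id C Y \<cdot> f = f"
  and Comp_Id_right: "arr C X Y f \<Longrightarrow> f \<cdot> Id C X = f"
  by (auto simp: arr_def Id_left Id_right)

lemma assoc: "\<lbrakk>arr C X Y f; arr C Y Z g; arr C Z T h\<rbrakk> \<Longrightarrow> (h \<cdot> g) \<cdot> f = h \<cdot> (g \<cdot> f)"
  by (auto simp: arr_def intro: Comp_assoc)

lemma Hom_abelian_group: "\<lbrakk>X \<in> Obj C; Y \<in> Obj C\<rbrakk> \<Longrightarrow> abelian_group (Hom C X Y)"
  using Hom_vectorspace[of X Y] by (simp add: vectorspace_def Module.module_def)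

lemma arr_zero: "\<lbrakk>X \<in> Obj C; Y \<in> Obj C\<rbrakk> \<Longrightarrow> arr C X Y (zero_mor C X Y)"
  using abelian_group.axioms(1)[OF Hom_abelian_group] abelian_monoid.zero_closed
  by (auto simp: arr_def)

lemma arr_add: "\<lbrakk>arr C X Y f; arr C X Y g\<rbrakk> \<Longrightarrow> arr C X Y (f \<oplus>\<^bsub>Hom C X Y\<^esub> g)"
  using abelian_group.axioms(1)[OF Hom_abelian_group[of X Y]] abelian_monoid.a_closed
  by (fastforce simp: arr_def)

lemma arr_minus: "\<lbrakk>arr C X Y f; arr C X Y g\<rbrakk> \<Longrightarrow> arr C X Y (f \<ominus>\<^bsub>Hom C X Y\<^esub> g)"
  using abelian_group.minus_closed[OF Hom_abelian_group[of X Y]] by (auto simp: arr_def)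

lemma minus_eq_zero_iff:
  "\<lbrakk>arr C X Y f; arr C X Y g\<rbrakk> \<Longrightarrow> f \<ominus>\<^bsub>Hom C X Y\<^esub> g = zero_mor C X Y \<longleftrightarrow> f = g"
  using abelian_group.minus_other_side[OF Hom_abelian_group[of X Y]] by (auto simp: arr_def)

lemma add_minus_cancel:
  assumes "arr C X Y f" and "arr C X Y g"
  shows "g \<oplus>\<^bsub>Hom C X Y\<^esub> (f \<ominus>\<^bsub>Hom C X Y\<^esub> g) = f"
proof -
  interpret abelian_group "Hom C X Y" using assms Hom_abelian_group by (auto simp: arr_def)
  show ?thesis using assms by (simp add: arr_def a_minus_def a_lcomm r_neg)
qed

lemma linear_map_precomp:
  assumes "arr C X Y f" and "T \<in> Obj C"
  shows "linear_map k (Hom C Y T) (Hom C X T) (\<lambda>g. g \<cdot> f)"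
  using assms by (intro linear_mapI Hom_vectorspace Comp_linear_left) (auto simp: arr_def)

lemma linear_map_postcomp:
  assumes "arr C X Y f" and "T \<in> Obj C"
  shows "linear_map k (Hom C T X) (Hom C T Y) (\<lambda>g. f \<cdot> g)"
  using assms by (intro linear_mapI Hom_vectorspace Comp_linear_right) (auto simp: arr_def)

lemma precomp_image_subspace:
  assumes "arr C L Q i" and "W \<in> Obj C"
  shows "VectorSpace.subspace k ((\<lambda>g. g \<cdot> i) ` hom_set C Q W) (Hom C L W)"
proof -
  interpret linear_map k "Hom C Q W" "Hom C L W" "\<lambda>g. g \<cdot> i" by (rule linear_map_precomp[OF assms])
  show ?thesis using imT_is_subspace by (simp add: im_def)
qed

lemma Comp_add_left:
  assumes "arr C X Y f" and "arr C Y Z g" and "arr C Y Z h"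
  shows "(g \<oplus>\<^bsub>Hom C Y Z\<^esub> h) \<cdot> f = g \<cdot> f \<oplus>\<^bsub>Hom C X Z\<^esub> h \<cdot> f"
  using linear_map.T_add[OF linear_map_precomp[of X Y f Z]] assms by (simp add: arr_def)

lemma Comp_add_right:
  assumes "arr C X Y f" and "arr C T X g" and "arr C T X h"
  shows "f \<cdot> (g \<oplus>\<^bsub>Hom C T X\<^esub> h) = f \<cdot> g \<oplus>\<^bsub>Hom C T Y\<^esub> f \<cdot> h"
  using linear_map.T_add[OF linear_map_postcomp[of X Y f T]] assms by (simp add: arr_def)

lemma Comp_minus_left:
  assumes "arr C X Y f" and "arr C Y Z g" and "arr C Y Z h"
  shows "(g \<ominus>\<^bsub>Hom C Y Z\<^esub> h) \<cdot> f = g \<cdot> f \<ominus>\<^bsub>Hom C X Z\<^esub> h \<cdot> f"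
  using linear_map.T_minus[OF linear_map_precomp[of X Y f Z]] assms by (simp add: arr_def)

lemma Comp_minus_right:
  assumes "arr C X Y f" and "arr C T X g" and "arr C T X h"
  shows "f \<cdot> (g \<ominus>\<^bsub>Hom C T X\<^esub> h) = f \<cdot> g \<ominus>\<^bsub>Hom C T Y\<^esub> f \<cdot> h"
  using linear_map.T_minus[OF linear_map_postcomp[of X Y f T]] assms by (simp add: arr_def)

lemma zero_Comp: "\<lbrakk>arr C X Y f; Z \<in> Obj C\<rbrakk> \<Longrightarrow> zero_mor C Y Z \<cdot> f = zero_mor C X Z"
  using linear_map.T0_is_0[OF linear_map_precomp[of X Y f Z]] by (simp add: arr_def)

lemma Comp_zero: "\<lbrakk>arr C X Y f; T \<in> Obj C\<rbrakk> \<Longrightarrow> f \<cdot> zero_mor C T X = zero_mor C T Y"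
  using linear_map.T0_is_0[OF linear_map_postcomp[of X Y f T]] by (simp add: arr_def)

lemma kernel_arr: "\<lbrakk>is_kernel C X Y f N m; X \<in> Obj C\<rbrakk> \<Longrightarrow> arr C N X m"
  and kernel_zero: "is_kernel C X Y f N m \<Longrightarrow> f \<cdot> m = zero_mor C N Y"
  by (auto simp: is_kernel_def arr_def)

lemma kernel_factor:
  assumes "is_kernel C X Y f N m" and "arr C T X t" and "f \<cdot> t = zero_mor C T Y"
  obtains u where "arr C T N u" and "t = m \<cdot> u"
  using assms unfolding is_kernel_def arr_def by blast

lemma kernel_is_mono:
  assumes N: "is_kernel C X Y f N m" and f: "arr C X Y f"
  shows "is_mono C N X m"
  unfolding is_mono_def
proof (intro conjI ballI impI)
  show "m \<in> hom_set C N X" using N by (simp add: is_kernel_def)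
  fix T g h assume T: "T \<in> Obj C" and gh: "g \<in> hom_set C T N" "h \<in> hom_set C T N"
    and eq: "m \<cdot> g = m \<cdot> h"
  have m: "arr C N X m" using kernel_arr[OF N] f by (simp add: arr_def)
  have h: "arr C T N h" using T gh m by (simp add: arr_def)
  have "arr C T X (m \<cdot> h)" using h m by (rule arr_Comp)
  moreover have "f \<cdot> (m \<cdot> h) = zero_mor C T Y"
    using assoc[OF h m f] kernel_zero[OF N] zero_Comp[OF h] f by (simp add: arr_def)
  ultimately have "\<exists>!u. u \<in> hom_set C T N \<and> m \<cdot> u = m \<cdot> h"
    using N by (simp add: is_kernel_def arr_def)
  then show "g = h" using gh eq by auto
qed

lemma kernelI:
  assumes f: "arr C X Y f" and m: "arr C N X m" "is_mono C N X m" and "f \<cdot> m = zero_mor C N Y"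
    and "\<And>T t. \<lbrakk>arr C T X t; f \<cdot> t = zero_mor C T Y\<rbrakk> \<Longrightarrow> \<exists>u. arr C T N u \<and> t = m \<cdot> u"
  shows "is_kernel C X Y f N m"
  unfolding is_kernel_def
proof (intro conjI ballI impI)
  fix T t assume T: "T \<in> Obj C" "t \<in> hom_set C T X" "f \<cdot> t = zero_mor C T Y"
  then obtain u where "arr C T N u" "t = m \<cdot> u" using assms(5)[of T t] f by (auto simp: arr_def)
  then show "\<exists>!u. u \<in> hom_set C T N \<and> m \<cdot> u = t"
    using mono_cancel[OF m(2)] by (auto simp: arr_def)
qed (use assms in \<open>auto simp: arr_def\<close>)

text \<open>Lifts are unique up to the kernel; every correction term below arises in this way.\<close>

lemma kernel_difference:
  assumes N: "is_kernel C X Y f N m" and f: "arr C X Y f" and a: "arr C T X a" and b: "arr C T X b"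
    and "f \<cdot> a = f \<cdot> b"
  obtains u where "arr C T N u" and "a = b \<oplus>\<^bsub>Hom C T X\<^esub> m \<cdot> u"
proof -
  have "f \<cdot> (a \<ominus>\<^bsub>Hom C T X\<^esub> b) = zero_mor C T Y"
    using Comp_minus_right[OF f a b] assms(5) minus_eq_zero_iff[OF arr_Comp[OF b f] arr_Comp[OF b f]]
    by simp
  then obtain u where "arr C T N u" "a \<ominus>\<^bsub>Hom C T X\<^esub> b = m \<cdot> u"
    using kernel_factor[OF N arr_minus[OF a b]] by metis
  then show thesis using that add_minus_cancel[OF a b] by metis
qed

text \<open>Used in both directions: to split a differential \<open>t \<cdot> q\<close> of a resolution at its image, and to
  put it together again.\<close>

lemma kernel_comp_mono_iff:
  assumes q: "arr C X Y q" and t: "arr C Y Z t" "is_mono C Y Z t"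
  shows "is_kernel C X Z (t \<cdot> q) N m \<longleftrightarrow> is_kernel C X Y q N m"
proof -
  have "(t \<cdot> q) \<cdot> s = zero_mor C T Z \<longleftrightarrow> q \<cdot> s = zero_mor C T Y" if s: "arr C T X s" for T s
  proof
    assume "(t \<cdot> q) \<cdot> s = zero_mor C T Z"
    then have "t \<cdot> (q \<cdot> s) = t \<cdot> zero_mor C T Y"
      using assoc[OF s q t(1)] Comp_zero[OF t(1)] s by (simp add: arr_def)
    then show "q \<cdot> s = zero_mor C T Y"
      using mono_cancel[OF t(2) arr_Comp[OF s q]] arr_zero s t by (auto simp: arr_def)
  next
    assume "q \<cdot> s = zero_mor C T Y"
    then show "(t \<cdot> q) \<cdot> s = zero_mor C T Z"
      using assoc[OF s q t(1)] Comp_zero[OF t(1)] s by (simp add: arr_def)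
  qed
  then show ?thesis using q unfolding is_kernel_def arr_def by blast
qed

lemma cokernel_factor:
  assumes "is_cokernel C X Y f Q c" and "arr C Y T t" and "t \<cdot> f = zero_mor C X T"
  obtains u where "arr C Q T u" and "t = u \<cdot> c"
  using assms unfolding is_cokernel_def arr_def by blast

lemma cokernel_arr: "\<lbrakk>is_cokernel C X Y f Q c; Y \<in> Obj C\<rbrakk> \<Longrightarrow> arr C Y Q c"
  and cokernel_zero: "is_cokernel C X Y f Q c \<Longrightarrow> c \<cdot> f = zero_mor C X Q"
  by (auto simp: is_cokernel_def arr_def)

lemma cokernel_is_epi:
  assumes Q: "is_cokernel C X Y f Q c" and f: "arr C X Y f"
  shows "is_epi C Y Q c"
  unfolding is_epi_def
proof (intro conjI ballI impI)
  show "c \<in> hom_set C Y Q" using Q by (simp add: is_cokernel_def)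
  fix T g h assume T: "T \<in> Obj C" and gh: "g \<in> hom_set C Q T" "h \<in> hom_set C Q T"
    and eq: "g \<cdot> c = h \<cdot> c"
  have c: "arr C Y Q c" using cokernel_arr[OF Q] f by (simp add: arr_def)
  have h: "arr C Q T h" using T gh c by (simp add: arr_def)
  have "arr C Y T (h \<cdot> c)" using c h by (rule arr_Comp)
  moreover have "(h \<cdot> c) \<cdot> f = zero_mor C X T"
    using assoc[OF f c h] cokernel_zero[OF Q] Comp_zero[OF h] f by (simp add: arr_def)
  ultimately have "\<exists>!u. u \<in> hom_set C Q T \<and> u \<cdot> c = h \<cdot> c"
    using Q by (simp add: is_cokernel_def arr_def)
  then show "g = h" using gh eq by auto
qed

end

context abelian_category
begin

text \<open>An epimorphism is the cokernel of some \<open>g\<close>. Since \<open>g\<close> factors through the kernel, what vanishes on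
  the kernel vanishes on \<open>g\<close>, hence factors through the epimorphism.\<close>

lemma epi_is_cokernel_of_kernel:
  assumes p: "arr C X Y p" "is_epi C X Y p" and N: "is_kernel C X Y p N m"
  shows "is_cokernel C N X m Y p"
  unfolding is_cokernel_def
proof (intro conjI ballI impI)
  show "Y \<in> Obj C" "p \<in> hom_set C X Y" using p by (auto simp: arr_def)
  show "p \<cdot> m = zero_mor C N Y" by (rule kernel_zero[OF N])
  fix T t assume "T \<in> Obj C" "t \<in> hom_set C X T" and tm: "t \<cdot> m = zero_mor C N T"
  then have t: "arr C X T t" using p by (simp add: arr_def)
  have m: "arr C N X m" using kernel_arr[OF N] p by (simp add: arr_def)
  obtain Z g where g: "arr C Z X g" and coker: "is_cokernel C Z X g Y p"
    using epi_is_cokernel[of X Y p] p unfolding arr_def by blast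
  obtain u where u: "arr C Z N u" "g = m \<cdot> u"
    using kernel_factor[OF N g cokernel_zero[OF coker]] .
  have "t \<cdot> g = zero_mor C Z T"
    unfolding u(2) using assoc[OF u(1) m t] tm zero_Comp[OF u(1)] t by (simp add: arr_def)
  then show "\<exists>!u. u \<in> hom_set C Y T \<and> u \<cdot> p = t"
    using coker t unfolding is_cokernel_def arr_def by blast
qed

text \<open>Exactness only provides some image \<open>m\<close> of \<open>f\<close>. As \<open>f\<close> is the kernel of some \<open>g'\<close>, which factors
  through the cokernel of \<open>f\<close>, also \<open>m\<close> is killed by \<open>g'\<close>; thus \<open>f\<close> and \<open>m\<close> factor through each
  other.\<close>

lemma short_exact_is_kernel:
  assumes "short_exact C X Y Z f g"
  shows "is_kernel C Y Z g X f"
proof -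
  have f: "arr C X Y f" "is_mono C X Y f" and g: "arr C Y Z g"
    and ex: "exact_at C X Y Z f g"
    using assms by (auto simp: short_exact_def arr_def exact_at_def)
  obtain I m Q c where c: "is_cokernel C X Y f Q c" and cm: "is_kernel C Y Q c I m"
    and gm: "is_kernel C Y Z g I m"
    using ex unfolding exact_at_def is_image_def by blast
  have carr: "arr C Y Q c" and m: "arr C I Y m"
    using cokernel_arr[OF c] kernel_arr[OF cm] f by (auto simp: arr_def)
  obtain Z' g' where g': "arr C Y Z' g'" "is_kernel C Y Z' g' X f"
    using mono_is_kernel[of X Y f] f unfolding arr_def by blast
  obtain g'' where g'': "arr C Q Z' g''" "g' = g'' \<cdot> c"
    using cokernel_factor[OF c g'(1) kernel_zero[OF g'(2)]] .
  have "g' \<cdot> m = zero_mor C I Z'"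
    unfolding g''(2) using assoc[OF m carr g''(1)] kernel_zero[OF cm] Comp_zero[OF g''(1)] m
    by (simp add: arr_def)
  then obtain u where u: "arr C I X u" "m = f \<cdot> u" using kernel_factor[OF g'(2) m] by metis
  obtain v where v: "arr C X I v" "f = m \<cdot> v"
    using kernel_factor[OF cm f(1) cokernel_zero[OF c]] .
  show ?thesis
  proof (rule kernelI[OF g f])
    show "g \<cdot> f = zero_mor C X Z"
      unfolding v(2) using assoc[OF v(1) m g] kernel_zero[OF gm] zero_Comp[OF v(1)] g
      by (simp add: arr_def)
    fix T t assume t: "arr C T Y t" "g \<cdot> t = zero_mor C T Z"
    obtain w where w: "arr C T I w" "t = m \<cdot> w" using kernel_factor[OF gm t] .
    have "t = f \<cdot> (u \<cdot> w)" unfolding w(2) by (subst u(2)) (rule assoc[OF w(1) u(1) f(1)])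
    then show "\<exists>u. arr C T X u \<and> t = f \<cdot> u" using arr_Comp[OF w(1) u(1)] by blast
  qed
qed

text \<open>The criterion that makes spliced sequences exact: composing a kernel with an epimorphism does not
  change its image, because both have the same cokernel.\<close>

lemma exact_at_epi_kernel:
  assumes g: "arr C Y Z g" and N: "is_kernel C Y Z g N m" and q: "arr C X N q" "is_epi C X N q"
  shows "exact_at C X Y Z (m \<cdot> q) g"
proof -
  have m: "arr C N Y m" using kernel_arr[OF N] g by (simp add: arr_def)
  have mq: "arr C X Y (m \<cdot> q)" using q(1) m by (rule arr_Comp)
  obtain Q c where c: "is_cokernel C X Y (m \<cdot> q) Q c"
    using cokernel_exists[of X Y "m \<cdot> q"] mq by (auto simp: arr_def)
  have carr: "arr C Y Q c" using cokernel_arr[OF c] m by (simp add: arr_def)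
  have gm0: "g \<cdot> (m \<cdot> q) = zero_mor C X Z"
    using assoc[OF q(1) m g] kernel_zero[OF N] zero_Comp[OF q(1)] g by (simp add: arr_def)
  obtain g' where g': "arr C Q Z g'" "g = g' \<cdot> c" using cokernel_factor[OF c g gm0] .
  have "is_kernel C Y Q c N m"
  proof (rule kernelI[OF carr m kernel_is_mono[OF N g]])
    have "(c \<cdot> m) \<cdot> q = zero_mor C N Q \<cdot> q"
      using assoc[OF q(1) m carr] cokernel_zero[OF c] zero_Comp[OF q(1)] carr by (simp add: arr_def)
    then show "c \<cdot> m = zero_mor C N Q"
      using epi_cancel[OF q(2) arr_Comp[OF m carr]] arr_zero m carr by (auto simp: arr_def)
    fix T t assume t: "arr C T Y t" "c \<cdot> t = zero_mor C T Q"
    have "g \<cdot> t = zero_mor C T Z"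
      unfolding g'(2) using assoc[OF t(1) carr g'(1)] t Comp_zero[OF g'(1)] by (simp add: arr_def)
    then show "\<exists>u. arr C T N u \<and> t = m \<cdot> u" using kernel_factor[OF N t(1)] by metis
  qed
  then show ?thesis
    using c N mq g unfolding exact_at_def is_image_def arr_def by blast
qed

text \<open>Suppose \<open>g \<cdot> q = h \<cdot> q\<close>. Then \<open>q\<close> factors through the kernel \<open>N\<close> of \<open>g - h\<close>, a subobject of the
  image \<open>I\<close>. Being a subobject of \<open>Y\<close>, it is the kernel of some \<open>s\<close>, and \<open>s\<close> kills \<open>f\<close>, hence also
  \<open>m\<close>. So \<open>I\<close> is contained in \<open>N\<close>, that is, \<open>g = h\<close>.\<close>

lemma image_factorisation:
  assumes f: "arr C X Y f" and I: "is_image C X Y f I m"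
  obtains q where "arr C X I q" and "is_epi C X I q" and "f = m \<cdot> q"
proof -
  obtain Q c where c: "is_cokernel C X Y f Q c" and cm: "is_kernel C Y Q c I m"
    using I by (auto simp: is_image_def)
  have carr: "arr C Y Q c" and m: "arr C I Y m"
    using cokernel_arr[OF c] kernel_arr[OF cm] f by (auto simp: arr_def)
  have m_mono: "is_mono C I Y m" by (rule kernel_is_mono[OF cm carr])
  obtain q where q: "arr C X I q" "f = m \<cdot> q"
    using kernel_factor[OF cm f cokernel_zero[OF c]] .
  have "is_epi C X I q"
    unfolding is_epi_def
  proof (intro conjI ballI impI)
    show "q \<in> hom_set C X I" using q by (simp add: arr_def)
    fix T g h assume T: "T \<in> Obj C" and "g \<in> hom_set C I T" "h \<in> hom_set C I T"
      and eq: "g \<cdot> q = h \<cdot> q"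
    then have g: "arr C I T g" and h: "arr C I T h" using m by (auto simp: arr_def)
    let ?d = "g \<ominus>\<^bsub>Hom C I T\<^esub> h"
    have d: "arr C I T ?d" using g h by (rule arr_minus)
    obtain N u where N: "is_kernel C I T ?d N u"
      using kernel_exists[of I T ?d] d by (auto simp: arr_def)
    have u: "arr C N I u" using kernel_arr[OF N] d by (simp add: arr_def)
    have "?d \<cdot> q = zero_mor C X T"
      using Comp_minus_left[OF q(1) g h] eq minus_eq_zero_iff[OF arr_Comp[OF q(1) h] arr_Comp[OF q(1) h]]
      by simp
    then obtain q' where q': "arr C X N q'" "q = u \<cdot> q'" using kernel_factor[OF N q(1)] by metis
    have mu: "arr C N Y (m \<cdot> u)" using u m by (rule arr_Comp)
    have mu_mono: "is_mono C N Y (m \<cdot> u)"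
      unfolding is_mono_def
    proof (intro conjI ballI impI)
      show "m \<cdot> u \<in> hom_set C N Y" using mu by (simp add: arr_def)
      fix S a b assume "S \<in> Obj C" "a \<in> hom_set C S N" "b \<in> hom_set C S N"
        and ab: "(m \<cdot> u) \<cdot> a = (m \<cdot> u) \<cdot> b"
      then have a: "arr C S N a" and b: "arr C S N b" using u by (auto simp: arr_def)
      have "u \<cdot> a = u \<cdot> b"
        using mono_cancel[OF m_mono arr_Comp[OF a u] arr_Comp[OF b u]] ab
          assoc[OF a u m] assoc[OF b u m] by simp
      then show "a = b" using mono_cancel[OF kernel_is_mono[OF N d] a b] by simp
    qed
    obtain Z s where s: "arr C Y Z s" and Ns: "is_kernel C Y Z s N (m \<cdot> u)"
      using mono_is_kernel[OF _ _ mu_mono] mu unfolding arr_def by blast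
    have "f = (m \<cdot> u) \<cdot> q'" unfolding q(2) by (subst q'(2)) (rule assoc[OF q'(1) u m, symmetric])
    then have "s \<cdot> f = zero_mor C X Z"
      using assoc[OF q'(1) mu s] kernel_zero[OF Ns] zero_Comp[OF q'(1)] s by (simp add: arr_def)
    then obtain s' where s': "arr C Q Z s'" "s = s' \<cdot> c" using cokernel_factor[OF c s] by metis
    have "s \<cdot> m = zero_mor C I Z"
      unfolding s'(2) using assoc[OF m carr s'(1)] kernel_zero[OF cm] Comp_zero[OF s'(1)] m
      by (simp add: arr_def)
    then obtain v where v: "arr C I N v" "m = (m \<cdot> u) \<cdot> v" using kernel_factor[OF Ns m] by metis
    have "m \<cdot> (u \<cdot> v) = m \<cdot> Id C I"
      using v assoc[OF v(1) u m] Comp_Id_right[OF m] by simp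
    then have uv: "u \<cdot> v = Id C I"
      using mono_cancel[OF m_mono arr_Comp[OF v(1) u] arr_Id] m by (simp add: arr_def)
    have "?d = ?d \<cdot> (u \<cdot> v)" using uv Comp_Id_right[OF d] by simp
    also have "\<dots> = zero_mor C I T"
      using assoc[OF v(1) u d] kernel_zero[OF N] zero_Comp[OF v(1)] d by (simp add: arr_def)
    finally show "g = h" using minus_eq_zero_iff[OF g h] by simp
  qed
  then show thesis using that q by blast
qed

text \<open>An exact functor is only known to act well on short exact sequences; this completes a kernel to
  one, so that the functor can be seen to preserve the monomorphism.\<close>

lemma kernel_short_exact:
  assumes f: "arr C X Y f" and N: "is_kernel C X Y f N m"
  obtains Z c where "short_exact C N X Z m c"
proof -
  have m: "arr C N X m" using kernel_arr[OF N] f by (simp add: arr_def)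
  obtain Z c where c: "is_cokernel C N X m Z c"
    using cokernel_exists[of N X m] m by (auto simp: arr_def)
  have carr: "arr C X Z c" using cokernel_arr[OF c] m by (simp add: arr_def)
  obtain f' where f': "arr C Z Y f'" "f = f' \<cdot> c"
    using cokernel_factor[OF c f kernel_zero[OF N]] .
  have "is_kernel C X Z c N m"
  proof (rule kernelI[OF carr m kernel_is_mono[OF N f] cokernel_zero[OF c]])
    fix T t assume t: "arr C T X t" "c \<cdot> t = zero_mor C T Z"
    have "f \<cdot> t = zero_mor C T Y"
      unfolding f'(2) using assoc[OF t(1) carr f'(1)] t Comp_zero[OF f'(1)] by (simp add: arr_def)
    then show "\<exists>u. arr C T N u \<and> t = m \<cdot> u" using kernel_factor[OF N t(1)] by metis
  qed
  then have "exact_at C N X Z m c"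
    using c m carr unfolding exact_at_def is_image_def arr_def by blast
  then have "short_exact C N X Z m c"
    using m carr kernel_is_mono[OF N f] cokernel_is_epi[OF c m] by (simp add: short_exact_def arr_def)
  then show thesis by (rule that)
qed

end

section \<open>Relatively projective presentations and syzygies\<close>

definition rel_presentation ::
  "('k, 'o, 'm, 'z) lin_cat_scheme \<Rightarrow> ('l, 'p, 'q, 'y) lin_cat_scheme \<Rightarrow>
   ('o, 'm, 'p, 'q, 'x) cat_functor_scheme \<Rightarrow> 'o \<Rightarrow> 'o \<Rightarrow> 'o \<Rightarrow> 'm \<Rightarrow> 'm \<Rightarrow> bool" where
  "rel_presentation A B U X L Q i p \<longleftrightarrow> X \<in> Obj A \<and> relatively_projective A B U Q \<and>
     is_epi A Q X p \<and> allowable A B U Q X p \<and> is_kernel A Q X p L i"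

text \<open>If \<open>X\<close> has a relatively projective presentation, these are the endomorphisms that factor through a
  relatively projective object, expressed by the lifting property that such a factorisation provides.
  They are the zero endomorphisms of the stable category.\<close>

definition rel_null ::
  "('k, 'o, 'm, 'z) lin_cat_scheme \<Rightarrow> ('l, 'p, 'q, 'y) lin_cat_scheme \<Rightarrow>
   ('o, 'm, 'p, 'q, 'x) cat_functor_scheme \<Rightarrow> 'o \<Rightarrow> 'm \<Rightarrow> bool" where
  "rel_null A B U X s \<longleftrightarrow> arr A X X s \<and>
     (\<forall>T p. T \<in> Obj A \<and> is_epi A T X p \<and> allowable A B U T X p \<longrightarrow>
        (\<exists>w. arr A X T w \<and> s = p \<cdot>\<^bsub>A\<^esub> w))"

text \<open>Isomorphism in the stable category, in which morphisms that factor through relatively projective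
  objects are set to zero.\<close>

definition stably_equivalent ::
  "('k, 'o, 'm, 'z) lin_cat_scheme \<Rightarrow> ('l, 'p, 'q, 'y) lin_cat_scheme \<Rightarrow>
   ('o, 'm, 'p, 'q, 'x) cat_functor_scheme \<Rightarrow> 'o \<Rightarrow> 'o \<Rightarrow> bool" where
  "stably_equivalent A B U X Y \<longleftrightarrow>
     (\<exists>a b s t. arr A X Y a \<and> arr A Y X b \<and> rel_null A B U X s \<and> rel_null A B U Y t \<and>
        b \<cdot>\<^bsub>A\<^esub> a = Id A X \<oplus>\<^bsub>Hom A X X\<^esub> s \<and> a \<cdot>\<^bsub>A\<^esub> b = Id A Y \<oplus>\<^bsub>Hom A Y Y\<^esub> t)"

text \<open>For a relatively projective presentation \<open>0 \<rightarrow> L \<rightarrow> Q \<rightarrow> X \<rightarrow> 0\<close> this is the first relative Ext of \<open>X\<close>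
  and \<open>W\<close>.\<close>

definition restriction_cokernel ::
  "('k, 'o, 'm, 'z) lin_cat_scheme \<Rightarrow> 'o \<Rightarrow> 'o \<Rightarrow> 'm \<Rightarrow> 'o \<Rightarrow> ('k, 'm set) module" where
  "restriction_cokernel A L Q i W =
     quotient_module (Hom A L W) ((\<lambda>g. g \<cdot>\<^bsub>A\<^esub> i) ` hom_set A Q W)"

context abelian_category
begin

text \<open>The four-term exact sequence \<open>0 \<rightarrow> Hom Z M \<rightarrow> Hom P M \<rightarrow> Hom K M\<close> followed by the cokernel. As
  \<open>Hom Z M\<close> is a subspace of \<open>Hom P M\<close>, it contributes a finite term whenever \<open>vdim (Hom P M)\<close> is
  finite and can be subtracted.\<close>

lemma vdim_restriction_cokernel:
  assumes j: "arr C K P j" and \<pi>: "arr C P Z \<pi>" and coker: "is_cokernel C K P j Z \<pi>" and M: "M \<in> Obj C"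
  shows "vdim k (restriction_cokernel C K P j M) + vdim k (Hom C P M) =
      vdim k (Hom C K M) + vdim k (Hom C Z M)"
    and "vdim k (Hom C P M) \<noteq> \<infinity> \<Longrightarrow> vdim k (Hom C Z M) \<noteq> \<infinity>"
proof -
  let ?N = "{f \<in> hom_set C P M. f \<cdot> j = zero_mor C K M}"
  interpret j: linear_map k "Hom C P M" "Hom C K M" "\<lambda>f. f \<cdot> j" by (rule linear_map_precomp[OF j M])
  have Z: "Z \<in> Obj C" using \<pi> by (simp add: arr_def)
  have sub: "VectorSpace.subspace k ?N (Hom C P M)" using j.kerT_is_subspace by (simp add: j.ker_def)
  have N: "vectorspace k (Hom C P M\<lparr>carrier := ?N\<rparr>)" by (rule j.V.subspace_is_vs[OF sub])
  have maps: "f \<cdot> \<pi> \<in> ?N" if f: "f \<in> hom_set C Z M" for f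
  proof -
    have f: "arr C Z M f" using f Z M by (simp add: arr_def)
    show ?thesis
      using arr_Comp[OF \<pi> f] assoc[OF j \<pi> f] cokernel_zero[OF coker] Comp_zero[OF f] j
      by (simp add: arr_def)
  qed
  have "(\<lambda>f. f \<cdot> \<pi>) \<in> linear_hom k (Hom C Z M) (Hom C P M\<lparr>carrier := ?N\<rparr>)"
    using linear_map.T_hom[OF linear_map_precomp[OF \<pi> M]] maps
    unfolding LinearCombinations.module_hom_def by simp
  then have "linear_map k (Hom C Z M) (Hom C P M\<lparr>carrier := ?N\<rparr>) (\<lambda>f. f \<cdot> \<pi>)"
    by (intro linear_mapI N Hom_vectorspace Z M)
  moreover have "bij_betw (\<lambda>f. f \<cdot> \<pi>) (hom_set C Z M) ?N"
    unfolding bij_betw_def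
  proof
    show "inj_on (\<lambda>f. f \<cdot> \<pi>) (hom_set C Z M)"
      using cokernel_is_epi[OF coker j] M unfolding is_epi_def inj_on_def by blast
    have "\<exists>g\<in>hom_set C Z M. f = g \<cdot> \<pi>" if "f \<in> ?N" for f
      using cokernel_factor[OF coker, of M f] that j M by (auto simp: arr_def)
    then show "(\<lambda>f. f \<cdot> \<pi>) ` hom_set C Z M = ?N" using maps by blast
  qed
  ultimately have eq: "vdim k (Hom C P M\<lparr>carrier := ?N\<rparr>) = vdim k (Hom C Z M)"
    using linear_map.vdim_bijective by fastforce
  show "vdim k (restriction_cokernel C K P j M) + vdim k (Hom C P M) =
      vdim k (Hom C K M) + vdim k (Hom C Z M)"
    unfolding restriction_cokernel_def eq[symmetric] by (rule vdim_cokernel[OF linear_map_precomp[OF j M]])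
  show "vdim k (Hom C Z M) \<noteq> \<infinity>" if "vdim k (Hom C P M) \<noteq> \<infinity>"
    using that j.V.subspace_fin_dim[OF _ sub] unfolding eq[symmetric] by (simp add: vdim_def split: if_splits)
qed

end

locale relative_abelian = A?: abelian_category k A + B: linear_category k B
  for k :: "('k, 'r) ring_scheme"
    and A :: "('k, 'o, 'm, 'z) lin_cat_scheme" (structure)
    and B :: "('k, 'p, 'q, 'y) lin_cat_scheme" +
  fixes U :: "('o, 'm, 'p, 'q, 'x) cat_functor_scheme"
  assumes U_exact: "exact_functor A B U"
begin

lemma U_functor: "is_functor A B U"
  using U_exact by (simp add: exact_functor_def)

lemma U_arr: "arr A X Y f \<Longrightarrow> arr B (FObj U X) (FObj U Y) (FMor U f)"
  using U_functor by (auto simp: is_functor_def arr_def)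

lemma U_Comp: "\<lbrakk>arr A X Y f; arr A Y Z g\<rbrakk> \<Longrightarrow> FMor U (g \<cdot> f) = FMor U g \<cdot>\<^bsub>B\<^esub> FMor U f"
  using U_functor unfolding is_functor_def arr_def by blast

lemma U_kernel_mono:
  assumes "arr A X Y f" and "is_kernel A X Y f N m"
  shows "is_mono B (FObj U N) (FObj U X) (FMor U m)"
proof -
  obtain Z c where "short_exact A N X Z m c" using kernel_short_exact[OF assms] .
  then have "short_exact B (FObj U N) (FObj U X) (FObj U Z) (FMor U m) (FMor U c)"
    using U_exact by (simp add: exact_functor_def)
  then show ?thesis by (simp add: short_exact_def)
qed

lemma allowable_section:
  assumes "allowable A B U X Y f" and "X \<in> Obj A" and "Y \<in> Obj A"
  obtains s where "arr B (FObj U Y) (FObj U X) s"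
    and "FMor U f \<cdot>\<^bsub>B\<^esub> (s \<cdot>\<^bsub>B\<^esub> FMor U f) = FMor U f"
proof -
  have f: "arr A X Y f" using assms by (simp add: allowable_def arr_def)
  obtain s where s: "s \<in> hom_set B (FObj U Y) (FObj U X)"
    "FMor U f \<cdot>\<^bsub>B\<^esub> s \<cdot>\<^bsub>B\<^esub> FMor U f = FMor U f"
    using assms(1) by (auto simp: allowable_def)
  have "arr B (FObj U Y) (FObj U X) s" using s(1) U_arr[OF f] by (simp add: arr_def)
  then show thesis using that s(2) B.assoc[OF U_arr[OF f] _ U_arr[OF f]] by simp
qed

lemma allowableI:
  assumes f: "arr A X Y f" and s: "arr B (FObj U Y) (FObj U X) s"
    and eq: "FMor U f \<cdot>\<^bsub>B\<^esub> (s \<cdot>\<^bsub>B\<^esub> FMor U f) = FMor U f"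
  shows "allowable A B U X Y f"
  using f s eq B.assoc[OF U_arr[OF f] s U_arr[OF f]] by (auto simp: allowable_def arr_def)

text \<open>The monomorphism \<open>U m\<close> can be cancelled from the equation for \<open>m \<cdot> q\<close>; the new section is the
  old one restricted along \<open>U m\<close>.\<close>

lemma allowable_cancel_kernel:
  assumes "allowable A B U X Y (m \<cdot> q)" and q: "arr A X N q"
    and g: "arr A Y Z g" and N: "is_kernel A Y Z g N m"
  shows "allowable A B U X N q"
proof -
  have m: "arr A N Y m" using kernel_arr[OF N] g by (simp add: arr_def)
  have mq: "arr A X Y (m \<cdot> q)" using q m by (rule arr_Comp)
  note Uq = U_arr[OF q] and Um = U_arr[OF m]
  obtain s where s: "arr B (FObj U Y) (FObj U X) s"
    and eq: "FMor U (m \<cdot> q) \<cdot>\<^bsub>B\<^esub> (s \<cdot>\<^bsub>B\<^esub> FMor U (m \<cdot> q)) = FMor U (m \<cdot> q)"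
    using allowable_section[OF assms(1)] mq by (auto simp: arr_def)
  note sm = B.arr_Comp[OF Um s]
  show ?thesis
  proof (rule allowableI[OF q sm])
    have "FMor U m \<cdot>\<^bsub>B\<^esub> (FMor U q \<cdot>\<^bsub>B\<^esub> ((s \<cdot>\<^bsub>B\<^esub> FMor U m) \<cdot>\<^bsub>B\<^esub> FMor U q)) =
        FMor U m \<cdot>\<^bsub>B\<^esub> FMor U q"
      using eq unfolding U_Comp[OF q m]
      by (simp add: B.assoc[OF Uq Um s] B.assoc[OF B.arr_Comp[OF B.arr_Comp[OF Uq Um] s] Uq Um])
    then show "FMor U q \<cdot>\<^bsub>B\<^esub> ((s \<cdot>\<^bsub>B\<^esub> FMor U m) \<cdot>\<^bsub>B\<^esub> FMor U q) = FMor U q"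
      using mono_cancel[OF U_kernel_mono[OF g N]] B.arr_Comp[OF B.arr_Comp[OF Uq sm] Uq] Uq by blast
  qed
qed

text \<open>As \<open>U m\<close> is a monomorphism, its pseudo-inverse is a retraction, and composing it with the
  pseudo-inverse of \<open>U q\<close> gives one for the composite.\<close>

lemma allowable_kernel_Comp:
  assumes g: "arr A Y Z g" and N: "is_kernel A Y Z g N m" and "allowable A B U N Y m"
    and q: "arr A X N q" and "allowable A B U X N q"
  shows "allowable A B U X Y (m \<cdot> q)"
proof -
  have m: "arr A N Y m" using kernel_arr[OF N] g by (simp add: arr_def)
  note Uq = U_arr[OF q] and Um = U_arr[OF m]
  obtain t where t: "arr B (FObj U Y) (FObj U N) t"
    and mtm: "FMor U m \<cdot>\<^bsub>B\<^esub> (t \<cdot>\<^bsub>B\<^esub> FMor U m) = FMor U m"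
    using allowable_section[OF assms(3)] m by (auto simp: arr_def)
  obtain s where s: "arr B (FObj U N) (FObj U X) s"
    and qsq: "FMor U q \<cdot>\<^bsub>B\<^esub> (s \<cdot>\<^bsub>B\<^esub> FMor U q) = FMor U q"
    using allowable_section[OF assms(5)] q by (auto simp: arr_def)
  have tm: "t \<cdot>\<^bsub>B\<^esub> FMor U m = Id B (FObj U N)"
    using mono_cancel[OF U_kernel_mono[OF g N] B.arr_Comp[OF Um t] B.arr_Id]
      mtm B.Comp_Id_right[OF Um] Um by (simp add: arr_def)
  note Uqm = B.arr_Comp[OF Uq Um]
  show ?thesis
  proof (rule allowableI[OF arr_Comp[OF q m] B.arr_Comp[OF t s]])
    have 1: "(s \<cdot>\<^bsub>B\<^esub> t) \<cdot>\<^bsub>B\<^esub> (FMor U m \<cdot>\<^bsub>B\<^esub> FMor U q) = s \<cdot>\<^bsub>B\<^esub> FMor U q"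
      using B.assoc[OF Uqm t s] B.assoc[OF Uq Um t] tm B.Comp_Id_left[OF Uq] by simp
    show "FMor U (m \<cdot> q) \<cdot>\<^bsub>B\<^esub> ((s \<cdot>\<^bsub>B\<^esub> t) \<cdot>\<^bsub>B\<^esub> FMor U (m \<cdot> q)) = FMor U (m \<cdot> q)"
      unfolding U_Comp[OF q m] 1 using B.assoc[OF B.arr_Comp[OF Uq s] Uq Um] qsq by simp
  qed
qed

lemma rel_presentation_arr:
  assumes "rel_presentation A B U X L Q i p"
  shows "arr A Q X p" and "arr A L Q i" and "is_mono A L Q i"
    and "is_kernel A Q X p L i" and "p \<cdot> i = zero_mor A L X" and "is_epi A Q X p"
proof -
  show p: "arr A Q X p"
    using assms by (auto simp: rel_presentation_def relatively_projective_def is_epi_def arr_def)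
  show k: "is_kernel A Q X p L i" and "is_epi A Q X p"
    using assms by (auto simp: rel_presentation_def)
  show "arr A L Q i" using kernel_arr[OF k] p by (simp add: arr_def)
  show "is_mono A L Q i" by (rule kernel_is_mono[OF k p])
  show "p \<cdot> i = zero_mor A L X" by (rule kernel_zero[OF k])
qed

lemma short_exact_rel_presentation:
  assumes "allowable_short_exact A B U L Q X i p" and "relatively_projective A B U Q"
  shows "rel_presentation A B U X L Q i p"
  using assms short_exact_is_kernel
  by (auto simp: allowable_short_exact_def rel_presentation_def short_exact_def)

lemma relatively_projective_lift:
  assumes "relatively_projective A B U P" and "arr A X Y f" and "is_epi A X Y f"
    and "allowable A B U X Y f" and "arr A P Y g"
  obtains h where "arr A P X h" and "g = f \<cdot> h"
  using assms unfolding relatively_projective_def arr_def by blast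

lemma presentation_lift:
  assumes X: "rel_presentation A B U X L Q i p" and X': "rel_presentation A B U X' L' Q' i' p'"
    and a: "arr A X X' a"
  obtains aQ aL where "arr A Q Q' aQ" and "arr A L L' aL" and "p' \<cdot> aQ = a \<cdot> p"
    and "i' \<cdot> aL = aQ \<cdot> i"
proof -
  note p = rel_presentation_arr(1)[OF X] and i = rel_presentation_arr(2)[OF X]
    and p' = rel_presentation_arr(1)[OF X']
  obtain aQ where aQ: "arr A Q Q' aQ" "a \<cdot> p = p' \<cdot> aQ"
    using relatively_projective_lift[of Q Q' X' p' "a \<cdot> p"] X X' p' arr_Comp[OF p a]
    by (auto simp: rel_presentation_def)
  have "p' \<cdot> (aQ \<cdot> i) = zero_mor A L X'"
    using assoc[OF i aQ(1) p'] assoc[OF i p a] aQ(2) rel_presentation_arr(5)[OF X] Comp_zero[OF a] i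
    by (simp add: arr_def)
  then obtain aL where "arr A L L' aL" "aQ \<cdot> i = i' \<cdot> aL"
    using kernel_factor[OF rel_presentation_arr(4)[OF X'] arr_Comp[OF i aQ(1)]] by metis
  then show thesis using that aQ by metis
qed

text \<open>The computation behind Schanuel's lemma. Write \<open>s = p \<cdot> w\<close>. Both \<open>c\<close> and \<open>1 + w \<cdot> p\<close> cover the
  endomorphism \<open>1 + s\<close> of \<open>X\<close>, so they differ by some \<open>i \<cdot> h\<close>. Restricted along \<open>i\<close> the term
  \<open>w \<cdot> p\<close> vanishes, and cancelling \<open>i\<close> leaves \<open>1 + h \<cdot> i\<close> on the kernel.\<close>

lemma presentation_endomorphism:
  assumes X: "rel_presentation A B U X L Q i p" and s: "rel_null A B U X s"
    and c: "arr A Q Q c" and l: "arr A L L l"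
    and pc: "p \<cdot> c = (Id A X \<oplus>\<^bsub>Hom A X X\<^esub> s) \<cdot> p" and il: "i \<cdot> l = c \<cdot> i"
  obtains h where "arr A Q L h" and "l = Id A L \<oplus>\<^bsub>Hom A L L\<^esub> h \<cdot> i"
proof -
  note p = rel_presentation_arr(1)[OF X] and i = rel_presentation_arr(2)[OF X]
  have objs: "X \<in> Obj A" "Q \<in> Obj A" "L \<in> Obj A" using p i by (auto simp: arr_def)
  obtain w where w: "arr A X Q w" "s = p \<cdot> w"
    using s X objs by (auto simp: rel_null_def rel_presentation_def)
  note idX = arr_Id[OF objs(1)] and idQ = arr_Id[OF objs(2)] and idL = arr_Id[OF objs(3)]
  have wp: "arr A Q Q (w \<cdot> p)" by (rule arr_Comp[OF p w(1)])
  have pw: "arr A X X (p \<cdot> w)" by (rule arr_Comp[OF w(1) p])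
  let ?e = "Id A Q \<oplus>\<^bsub>Hom A Q Q\<^esub> w \<cdot> p"
  have e: "arr A Q Q ?e" by (rule arr_add[OF idQ wp])
  have "p \<cdot> c = p \<cdot> ?e"
    using pc Comp_add_left[OF p idX pw] Comp_add_right[OF p idQ wp] w(2)
      Comp_Id_left[OF p] Comp_Id_right[OF p] assoc[OF p w(1) p] by simp
  then obtain h where h: "arr A Q L h" "c = ?e \<oplus>\<^bsub>Hom A Q Q\<^esub> i \<cdot> h"
    using kernel_difference[OF rel_presentation_arr(4)[OF X] p c e] by metis
  have ih: "arr A Q Q (i \<cdot> h)" and hi: "arr A L L (h \<cdot> i)"
    using arr_Comp[OF h(1) i] arr_Comp[OF i h(1)] by auto
  have "?e \<cdot> i = i \<oplus>\<^bsub>Hom A L Q\<^esub> zero_mor A L Q"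
    using Comp_add_left[OF i idQ wp] Comp_Id_left[OF i] assoc[OF i p w(1)]
      rel_presentation_arr(5)[OF X] Comp_zero[OF w(1) objs(3)] by simp
  also have "\<dots> = i"
    using abelian_monoid.r_zero[OF abelian_group.axioms(1)[OF Hom_abelian_group[OF objs(3,2)]]] i
    by (simp add: arr_def)
  finally have ei: "?e \<cdot> i = i" .
  have "i \<cdot> l = i \<oplus>\<^bsub>Hom A L Q\<^esub> i \<cdot> (h \<cdot> i)"
    unfolding il h(2) using Comp_add_left[OF i e ih] ei assoc[OF i h(1) i] by simp
  also have "\<dots> = i \<cdot> (Id A L \<oplus>\<^bsub>Hom A L L\<^esub> h \<cdot> i)"
    using Comp_add_right[OF i idL hi] Comp_Id_right[OF i] by simp
  finally have "l = Id A L \<oplus>\<^bsub>Hom A L L\<^esub> h \<cdot> i"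
    using mono_cancel[OF rel_presentation_arr(3)[OF X] l arr_add[OF idL hi]] by simp
  then show thesis using that h(1) by blast
qed

text \<open>Mutually inverse stable equivalences lift to the presentations and restrict to the kernels; the
  composites of the restrictions are the identity up to terms that extend to the projectives. The
  lifts \<open>aQ\<close> and \<open>bQ\<close> are part of the result because they show that restriction along \<open>a\<close> and \<open>b\<close>
  respects the morphisms that extend to \<open>Q'\<close> and \<open>Q\<close>.\<close>

lemma syzygy_comparison:
  assumes X: "rel_presentation A B U X L Q i p" and X': "rel_presentation A B U X' L' Q' i' p'"
    and "stably_equivalent A B U X X'"
  obtains a b aQ bQ h h' where "arr A L L' a" and "arr A L' L b" and "arr A Q Q' aQ" and "arr A Q' Q bQ"
    and "arr A Q L h" and "arr A Q' L' h'"
    and "b \<cdot> a = Id A L \<oplus>\<^bsub>Hom A L L\<^esub> h \<cdot> i" and "a \<cdot> b = Id A L' \<oplus>\<^bsub>Hom A L' L'\<^esub> h' \<cdot> i'"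
    and "i' \<cdot> a = aQ \<cdot> i" and "i \<cdot> b = bQ \<cdot> i'"
proof -
  have endo: "\<exists>h. arr A Q1 L1 h \<and> b \<cdot> a = Id A L1 \<oplus>\<^bsub>Hom A L1 L1\<^esub> h \<cdot> i1"
    if X1: "rel_presentation A B U X1 L1 Q1 i1 p1" and X2: "rel_presentation A B U X2 L2 Q2 i2 p2"
      and u: "arr A X1 X2 u" and v: "arr A X2 X1 v" and s: "rel_null A B U X1 s"
      and vu: "v \<cdot> u = Id A X1 \<oplus>\<^bsub>Hom A X1 X1\<^esub> s"
      and a: "arr A L1 L2 a" and aQ: "arr A Q1 Q2 aQ" and pa: "p2 \<cdot> aQ = u \<cdot> p1" and ia: "i2 \<cdot> a = aQ \<cdot> i1"
      and b: "arr A L2 L1 b" and bQ: "arr A Q2 Q1 bQ" and pb: "p1 \<cdot> bQ = v \<cdot> p2" and ib: "i1 \<cdot> b = bQ \<cdot> i2"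
    for X1 L1 Q1 i1 p1 X2 L2 Q2 i2 p2 u v s a aQ b bQ
  proof -
    note p1 = rel_presentation_arr(1)[OF X1] and i1 = rel_presentation_arr(2)[OF X1]
      and p2 = rel_presentation_arr(1)[OF X2] and i2 = rel_presentation_arr(2)[OF X2]
    have "p1 \<cdot> (bQ \<cdot> aQ) = (Id A X1 \<oplus>\<^bsub>Hom A X1 X1\<^esub> s) \<cdot> p1"
      using assoc[OF aQ bQ p1] assoc[OF aQ p2 v] assoc[OF p1 u v] pa pb vu by simp
    moreover have "i1 \<cdot> (b \<cdot> a) = (bQ \<cdot> aQ) \<cdot> i1"
      using assoc[OF a b i1] assoc[OF a i2 bQ] assoc[OF i1 aQ bQ] ia ib by simp
    ultimately show ?thesis
      using presentation_endomorphism[OF X1 s arr_Comp[OF aQ bQ] arr_Comp[OF a b]] by metis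
  qed
  obtain u v s t where uv: "arr A X X' u" "arr A X' X v" "rel_null A B U X s" "rel_null A B U X' t"
    "v \<cdot> u = Id A X \<oplus>\<^bsub>Hom A X X\<^esub> s" "u \<cdot> v = Id A X' \<oplus>\<^bsub>Hom A X' X'\<^esub> t"
    using assms(3) by (auto simp: stably_equivalent_def)
  obtain aQ a where a: "arr A Q Q' aQ" "arr A L L' a" "p' \<cdot> aQ = u \<cdot> p" "i' \<cdot> a = aQ \<cdot> i"
    using presentation_lift[OF X X' uv(1)] .
  obtain bQ b where b: "arr A Q' Q bQ" "arr A L' L b" "p \<cdot> bQ = v \<cdot> p'" "i \<cdot> b = bQ \<cdot> i'"
    using presentation_lift[OF X' X uv(2)] .
  show thesis
    using endo[OF X X' uv(1,2,3,5) a(2,1,3,4) b(2,1,3,4)]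
      endo[OF X' X uv(2,1,4,6) b(2,1,3,4) a(2,1,3,4)] that a b by metis
qed

text \<open>The start of the comparison of two resolutions of the same object.\<close>

lemma stably_equivalent_refl:
  assumes X: "X \<in> Obj A"
  shows "stably_equivalent A B U X X"
proof -
  let ?z = "zero_mor A X X"
  have "rel_null A B U X ?z"
    using X arr_zero Comp_zero unfolding rel_null_def is_epi_def arr_def by metis
  moreover have "Id A X \<cdot> Id A X = Id A X \<oplus>\<^bsub>Hom A X X\<^esub> ?z"
    using Comp_Id_left[OF arr_Id[OF X]] Id_in_hom[OF X]
      abelian_monoid.r_zero[OF abelian_group.axioms(1)[OF Hom_abelian_group[OF X X]]] by simp
  ultimately show ?thesis using arr_Id[OF X] unfolding stably_equivalent_def by blast
qed

lemma rel_null_through_projective: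
  assumes Q: "relatively_projective A B U Q" and i: "arr A X Q i" and h: "arr A Q X h"
  shows "rel_null A B U X (h \<cdot> i)"
  unfolding rel_null_def
proof (intro conjI allI impI)
  show "arr A X X (h \<cdot> i)" using i h by (rule arr_Comp)
  fix T p assume T: "T \<in> Obj A \<and> is_epi A T X p \<and> allowable A B U T X p"
  then have p: "arr A T X p" using i by (simp add: arr_def is_epi_def)
  then obtain w where w: "arr A Q T w" "h = p \<cdot> w"
    using relatively_projective_lift[OF Q p _ _ h] T by blast
  then have "h \<cdot> i = p \<cdot> (w \<cdot> i)" using assoc[OF i w(1) p] by simp
  then show "\<exists>w. arr A X T w \<and> h \<cdot> i = p \<cdot> w" using arr_Comp[OF i w(1)] by blast
qed

lemma stably_equivalent_syzygies:
  assumes X: "rel_presentation A B U X L Q i p" and X': "rel_presentation A B U X' L' Q' i' p'"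
    and "stably_equivalent A B U X X'"
  shows "stably_equivalent A B U L L'"
proof -
  obtain a b aQ bQ h h' where *: "arr A L L' a" "arr A L' L b" "arr A Q L h" "arr A Q' L' h'"
    "b \<cdot> a = Id A L \<oplus>\<^bsub>Hom A L L\<^esub> h \<cdot> i" "a \<cdot> b = Id A L' \<oplus>\<^bsub>Hom A L' L'\<^esub> h' \<cdot> i'"
    using syzygy_comparison[OF assms] by metis
  have "rel_null A B U L (h \<cdot> i)" "rel_null A B U L' (h' \<cdot> i')"
    using rel_null_through_projective * X X' rel_presentation_arr(2)[OF X] rel_presentation_arr(2)[OF X']
    unfolding rel_presentation_def by blast+
  then show ?thesis using * unfolding stably_equivalent_def by blast
qed

text \<open>The isomorphism is precomposition with \<open>b\<close>. Modulo morphisms that extend to \<open>Q\<close> it is inverted by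
  precomposition with \<open>a\<close>, since \<open>f \<cdot> b \<cdot> a = f + (f \<cdot> h) \<cdot> i\<close>.\<close>

lemma restriction_cokernel_invariant:
  assumes X: "rel_presentation A B U X L Q i p" and X': "rel_presentation A B U X' L' Q' i' p'"
    and "stably_equivalent A B U X X'" and W: "W \<in> Obj A"
  shows "vdim k (restriction_cokernel A L Q i W) = vdim k (restriction_cokernel A L' Q' i' W)"
proof -
  obtain a b aQ bQ h h' where a: "arr A L L' a" and b: "arr A L' L b"
    and aQ: "arr A Q Q' aQ" and bQ: "arr A Q' Q bQ" and h: "arr A Q L h" and h': "arr A Q' L' h'"
    and ba: "b \<cdot> a = Id A L \<oplus>\<^bsub>Hom A L L\<^esub> h \<cdot> i" and ab: "a \<cdot> b = Id A L' \<oplus>\<^bsub>Hom A L' L'\<^esub> h' \<cdot> i'"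
    and ia: "i' \<cdot> a = aQ \<cdot> i" and ib: "i \<cdot> b = bQ \<cdot> i'"
    using syzygy_comparison[OF assms(1-3)] .
  note i = rel_presentation_arr(2)[OF X] and i' = rel_presentation_arr(2)[OF X']
  have objs: "L \<in> Obj A" "L' \<in> Obj A" "Q \<in> Obj A" "Q' \<in> Obj A" using i i' by (auto simp: arr_def)
  have expand: "f \<cdot> (Id A M \<oplus>\<^bsub>Hom A M M\<^esub> g \<cdot> j) = f \<oplus>\<^bsub>Hom A M W\<^esub> (f \<cdot> g) \<cdot> j"
    if f: "arr A M W f" and j: "arr A M P j" and g: "arr A P M g" for f g j M P
    using Comp_add_right[OF f arr_Id arr_Comp[OF j g]] Comp_Id_right[OF f] assoc[OF j g f] f
    by (simp add: arr_def)
  show ?thesis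
    unfolding restriction_cokernel_def
  proof (rule vdim_quotient_eq)
    show "(\<lambda>f. f \<cdot> b) \<in> linear_hom k (Hom A L W) (Hom A L' W)"
      using b W by (intro Comp_linear_left) (auto simp: arr_def)
    fix f assume "f \<in> hom_set A L W"
    then have f: "arr A L W f" using W objs by (simp add: arr_def)
    show "f \<cdot> b \<in> (\<lambda>g. g \<cdot> i') ` hom_set A Q' W \<longleftrightarrow> f \<in> (\<lambda>g. g \<cdot> i) ` hom_set A Q W"
    proof
      assume "f \<in> (\<lambda>g. g \<cdot> i) ` hom_set A Q W"
      then obtain g where g: "arr A Q W g" "f = g \<cdot> i" using objs W by (auto simp: arr_def)
      have "f \<cdot> b = (g \<cdot> bQ) \<cdot> i'"
        unfolding g(2) using assoc[OF b i g(1)] assoc[OF i' bQ g(1)] ib by simp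
      moreover have "g \<cdot> bQ \<in> hom_set A Q' W" using arr_Comp[OF bQ g(1)] by (simp add: arr_def)
      ultimately show "f \<cdot> b \<in> (\<lambda>g. g \<cdot> i') ` hom_set A Q' W" by (rule image_eqI)
    next
      assume "f \<cdot> b \<in> (\<lambda>g. g \<cdot> i') ` hom_set A Q' W"
      then obtain g where g: "arr A Q' W g" "f \<cdot> b = g \<cdot> i'" using objs W by (auto simp: arr_def)
      note gQ = arr_Comp[OF aQ g(1)] and fh = arr_Comp[OF h f]
      have fhi: "arr A L W ((f \<cdot> h) \<cdot> i)" by (rule arr_Comp[OF i fh])
      have "f \<oplus>\<^bsub>Hom A L W\<^esub> (f \<cdot> h) \<cdot> i = (g \<cdot> aQ) \<cdot> i"
        using expand[OF f i h] ba assoc[OF a b f] g(2) assoc[OF a i' g(1)] assoc[OF i aQ g(1)] ia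
        by simp
      moreover have "f = (f \<oplus>\<^bsub>Hom A L W\<^esub> (f \<cdot> h) \<cdot> i) \<ominus>\<^bsub>Hom A L W\<^esub> (f \<cdot> h) \<cdot> i"
      proof -
        interpret abelian_group "Hom A L W" using Hom_abelian_group objs W by auto
        show ?thesis using f fhi by (simp add: arr_def a_minus_def a_assoc r_neg)
      qed
      ultimately have "f = (g \<cdot> aQ \<ominus>\<^bsub>Hom A Q W\<^esub> f \<cdot> h) \<cdot> i"
        using Comp_minus_left[OF i gQ fh] by simp
      moreover have "g \<cdot> aQ \<ominus>\<^bsub>Hom A Q W\<^esub> f \<cdot> h \<in> hom_set A Q W"
        using arr_minus[OF gQ fh] by (simp add: arr_def)
      ultimately show "f \<in> (\<lambda>g. g \<cdot> i) ` hom_set A Q W" by (rule image_eqI)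
    qed
  next
    fix f assume "f \<in> hom_set A L' W"
    then have f: "arr A L' W f" using W objs by (simp add: arr_def)
    have "(f \<cdot> a) \<cdot> b = f \<oplus>\<^bsub>Hom A L' W\<^esub> (f \<cdot> h') \<cdot> i'"
      using expand[OF f i' h'] ab assoc[OF b a f] by simp
    moreover have "f \<cdot> a \<in> hom_set A L W" "f \<cdot> h' \<in> hom_set A Q' W"
      using arr_Comp[OF a f] arr_Comp[OF h' f] by (auto simp: arr_def)
    ultimately show "\<exists>g\<in>hom_set A L W. \<exists>s\<in>(\<lambda>g. g \<cdot> i') ` hom_set A Q' W.
        g \<cdot> b = f \<oplus>\<^bsub>Hom A L' W\<^esub> s" by blast
  qed (use Hom_vectorspace precomp_image_subspace i i' W objs in auto)
qed

end

section \<open>Resolutions as spliced presentations\<close>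

context relative_abelian
begin

text \<open>The epimorphism in \<open>i n \<cdot> p (n + 1)\<close> does not affect its image and the monomorphism does not affect
  its kernel, so exactness is that of the single presentations.\<close>

lemma rel_proj_resolution_splice:
  assumes pres: "\<And>n. rel_presentation A B U (X n) (X (Suc n)) (Q n) (i n) (p n)"
    and allow: "\<And>n. allowable A B U (X (Suc n)) (Q n) (i n)"
  shows "rel_proj_resolution A B U (X 0) (Q, \<lambda>n. i n \<cdot> p (Suc n), p 0)"
proof -
  note p = rel_presentation_arr(1)[OF pres] and i = rel_presentation_arr(2)[OF pres]
    and ker = rel_presentation_arr(4)[OF pres] and epi = rel_presentation_arr(6)[OF pres]
  have pallow: "allowable A B U (Q n) (X n) (p n)" for n
    using pres by (simp add: rel_presentation_def)
  have "relatively_projective A B U (Q n)" for n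
    using pres by (simp add: rel_presentation_def)
  moreover have "allowable A B U (Q (Suc n)) (Q n) (i n \<cdot> p (Suc n))" for n
    by (rule allowable_kernel_Comp[OF p ker allow p pallow])
  moreover have "exact_at A (Q 1) (Q 0) (X 0) (i 0 \<cdot> p (Suc 0)) (p 0)"
    using exact_at_epi_kernel[OF p ker p epi, of 0] by simp
  moreover have "exact_at A (Q (Suc (Suc n))) (Q (Suc n)) (Q n)
      (i (Suc n) \<cdot> p (Suc (Suc n))) (i n \<cdot> p (Suc n))" for n
  proof (rule exact_at_epi_kernel[OF _ _ p epi])
    show "arr A (Q (Suc n)) (Q n) (i n \<cdot> p (Suc n))" using p i by (rule arr_Comp)
    show "is_kernel A (Q (Suc n)) (Q n) (i n \<cdot> p (Suc n)) (X (Suc (Suc n))) (i (Suc n))"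
      using kernel_comp_mono_iff[OF p i] ker rel_presentation_arr(3)[OF pres] by blast
  qed
  ultimately show ?thesis
    using pallow epi by (simp add: rel_proj_resolution_def)
qed

text \<open>Cutting an exact sequence at the image \<open>I\<close> of \<open>d\<close>: it is the kernel of the epimorphic part \<open>q\<close> of
  the next differential, and \<open>d\<close> itself has an allowable epimorphic part with which the cutting can
  be continued.\<close>

lemma image_presentation:
  assumes d: "exact_at A R' R T d D" and D: "D = t \<cdot> q" and q: "arr A R Y q" "is_epi A R Y q"
    and "allowable A B U R Y q" and t: "arr A Y T t" "is_mono A Y T t"
    and R: "relatively_projective A B U R" and R': "R' \<in> Obj A" and "allowable A B U R' R d"
  obtains I m q' where "rel_presentation A B U Y I R m q" and "d = m \<cdot> q'"
    and "arr A R' I q'" and "is_epi A R' I q'" and "allowable A B U R' I q'"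
proof -
  have darr: "arr A R' R d" using d R' q by (simp add: exact_at_def arr_def)
  have Darr: "arr A R T D" unfolding D using q(1) t(1) by (rule arr_Comp)
  obtain I m where I: "is_image A R' R d I m" and DI: "is_kernel A R T D I m"
    using d by (auto simp: exact_at_def)
  have "is_kernel A R Y q I m" using DI kernel_comp_mono_iff[OF q(1) t] D by simp
  then have pres: "rel_presentation A B U Y I R m q"
    using assms by (simp add: rel_presentation_def arr_def)
  obtain q' where q': "arr A R' I q'" "is_epi A R' I q'" "d = m \<cdot> q'"
    using image_factorisation[OF darr I] .
  have "allowable A B U R' I q'"
    using allowable_cancel_kernel[OF _ q'(1) Darr DI] assms(10) q'(3) by simp
  then show thesis using that pres q' by blast
qed

text \<open>The images of the differentials of a resolution are syzygies, so they are stably equivalent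
  to the syzygies taken from any other chain of presentations.\<close>

lemma resolution_syzygy:
  assumes res: "rel_proj_resolution A B U (X 0) (R, d, e)"
    and pres: "\<And>n. rel_presentation A B U (X n) (X (Suc n)) (Q n) (i n) (p n)"
  shows "\<exists>Y I m q q'. rel_presentation A B U Y I (R n) m q \<and> stably_equivalent A B U (X n) Y \<and>
    d n = m \<cdot> q' \<and> arr A (R (Suc n)) I q' \<and> is_epi A (R (Suc n)) I q' \<and>
    allowable A B U (R (Suc n)) I q'"
proof (induction n)
  case 0
  have ex: "exact_at A (R (Suc 0)) (R 0) (X 0) (d 0) e" and epi: "is_epi A (R 0) (X 0) e"
    and RP: "relatively_projective A B U (R n)" and al: "allowable A B U (R 0) (X 0) e"
    and al': "allowable A B U (R (Suc n)) (R n) (d n)" for n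
    using res by (auto simp: rel_proj_resolution_def)
  have X0: "X 0 \<in> Obj A" using pres[of 0] by (simp add: rel_presentation_def)
  have RO: "R n \<in> Obj A" for n using RP[of n] by (simp add: relatively_projective_def)
  have e: "arr A (R 0) (X 0) e" using epi RO X0 by (simp add: is_epi_def arr_def)
  have mono: "is_mono A (X 0) (X 0) (Id A (X 0))"
    using X0 arr_Id[OF X0] Comp_Id_left unfolding is_mono_def arr_def by metis
  show ?case
    using image_presentation[OF ex _ e epi al arr_Id[OF X0] mono RP RO al'] Comp_Id_left[OF e]
      stably_equivalent_refl[OF X0] by metis
next
  case (Suc n)
  then obtain Y I m q q' where Y: "rel_presentation A B U Y I (R n) m q"
    and XY: "stably_equivalent A B U (X n) Y" and d: "d n = m \<cdot> q'"
    and q': "arr A (R (Suc n)) I q'" "is_epi A (R (Suc n)) I q'" "allowable A B U (R (Suc n)) I q'"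
    by blast
  have ex: "exact_at A (R (Suc (Suc n))) (R (Suc n)) (R n) (d (Suc n)) (d n)"
    and RP: "relatively_projective A B U (R n)"
    and al: "allowable A B U (R (Suc n)) (R n) (d n)" for n
    using res by (auto simp: rel_proj_resolution_def)
  have RO: "R n \<in> Obj A" for n using RP[of n] by (simp add: relatively_projective_def)
  have "stably_equivalent A B U (X (Suc n)) I"
    by (rule stably_equivalent_syzygies[OF pres Y XY])
  then show ?case
    using image_presentation[OF ex d q' rel_presentation_arr(2,3)[OF Y] RP RO al] by metis
qed

lemma cocycles_subspace:
  assumes "arr A (R (Suc n)) (R n) (d n)" and "W \<in> Obj A"
  shows "VectorSpace.subspace k (cocycles A R d W n) (Hom A (R n) W)"
proof -
  interpret linear_map k "Hom A (R n) W" "Hom A (R (Suc n)) W" "\<lambda>g. g \<cdot> d n"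
    by (rule linear_map_precomp[OF assms])
  show ?thesis using kerT_is_subspace by (simp add: ker_def cocycles_def)
qed

text \<open>A cocycle on \<open>R (n + 1)\<close> vanishes on the image of \<open>d (n + 1)\<close>, which is the kernel of the
  epimorphism \<open>q\<close>; hence it is \<open>g \<cdot> q\<close> for a unique \<open>g\<close> on the syzygy \<open>I\<close>. It is a coboundary
  exactly if \<open>g\<close> extends along \<open>m\<close> to \<open>R n\<close>.\<close>

lemma cohomology_restriction_cokernel:
  assumes ex: "exact_at A (R (Suc (Suc n))) (R (Suc n)) (R n) (d (Suc n)) (d n)"
    and R: "\<And>n. R n \<in> Obj A" and d: "d n = m \<cdot> q"
    and m: "arr A I (R n) m" "is_mono A I (R n) m"
    and q: "arr A (R (Suc n)) I q" "is_epi A (R (Suc n)) I q" and W: "W \<in> Obj A"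
  shows "vdim k (cohomology A R d W (Suc n)) = vdim k (restriction_cokernel A I (R n) m W)"
proof -
  let ?V = "Hom A (R (Suc n)) W"
  let ?Z = "cocycles A R d W (Suc n)"
  let ?S = "coboundaries A R d W (Suc n)"
  have d1: "arr A (R (Suc (Suc n))) (R (Suc n)) (d (Suc n))" and d0: "arr A (R (Suc n)) (R n) (d n)"
    using ex R by (auto simp: exact_at_def arr_def)
  obtain I' m' Q c where c: "is_cokernel A (R (Suc (Suc n))) (R (Suc n)) (d (Suc n)) Q c"
    and cm: "is_kernel A (R (Suc n)) Q c I' m'" and dm: "is_kernel A (R (Suc n)) (R n) (d n) I' m'"
    using ex by (auto simp: exact_at_def is_image_def)
  have carr: "arr A (R (Suc n)) Q c" by (rule cokernel_arr[OF c R])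
  have m': "arr A I' (R (Suc n)) m'" by (rule kernel_arr[OF cm R])
  have qm: "is_kernel A (R (Suc n)) I q I' m'" using dm kernel_comp_mono_iff[OF q(1) m] d by simp
  have coker: "is_cokernel A I' (R (Suc n)) m' I q" by (rule epi_is_cokernel_of_kernel[OF q qm])
  obtain u where u: "arr A (R (Suc (Suc n))) I' u" "d (Suc n) = m' \<cdot> u"
    using kernel_factor[OF cm d1 cokernel_zero[OF c]] .
  have qd: "q \<cdot> d (Suc n) = zero_mor A (R (Suc (Suc n))) I"
    unfolding u(2) using assoc[OF u(1) m' q(1)] kernel_zero[OF qm] zero_Comp[OF u(1)] q
    by (simp add: arr_def)
  have cocycle: "g \<cdot> q \<in> ?Z" if g: "arr A I W g" for g
    using arr_Comp[OF q(1) g] assoc[OF d1 q(1) g] qd Comp_zero[OF g R]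
    by (simp add: cocycles_def arr_def)
  have factor: "\<exists>g. arr A I W g \<and> f = g \<cdot> q" if f: "f \<in> ?Z" for f
  proof -
    have farr: "arr A (R (Suc n)) W f" and f0: "f \<cdot> d (Suc n) = zero_mor A (R (Suc (Suc n))) W"
      using f R W by (auto simp: cocycles_def arr_def)
    obtain f' where f': "arr A Q W f'" "f = f' \<cdot> c" using cokernel_factor[OF c farr f0] .
    have "f \<cdot> m' = zero_mor A I' W"
      unfolding f'(2) using assoc[OF m' carr f'(1)] kernel_zero[OF cm] Comp_zero[OF f'(1)] m'
      by (simp add: arr_def)
    then show ?thesis using cokernel_factor[OF coker farr] by metis
  qed
  have bound: "g \<cdot> q \<in> ?S \<longleftrightarrow> g \<in> (\<lambda>f. f \<cdot> m) ` hom_set A (R n) W" if g: "arr A I W g" for g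
  proof -
    have "g \<cdot> q = f \<cdot> d n \<longleftrightarrow> g = f \<cdot> m" if f: "f \<in> hom_set A (R n) W" for f
    proof -
      have farr: "arr A (R n) W f" using f R W by (simp add: arr_def)
      show ?thesis
        using epi_cancel[OF q(2) g arr_Comp[OF m(1) farr]] assoc[OF q(1) m(1) farr] d by auto
    qed
    then show ?thesis by auto
  qed
  have Z: "VectorSpace.subspace k ?Z ?V" by (rule cocycles_subspace[where d = d, OF d1 W])
  have S: "VectorSpace.subspace k ?S ?V" using precomp_image_subspace[OF d0 W] by simp
  have SZ: "?S \<subseteq> ?Z"
  proof
    fix f assume "f \<in> ?S"
    then obtain g where "arr A (R n) W g" "f = g \<cdot> d n" using R W by (auto simp: arr_def)
    then show "f \<in> ?Z"
      using cocycle[OF arr_Comp[OF m(1)]] assoc[OF q(1) m(1)] d by metis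
  qed
  have HomV: "vectorspace k ?V" by (rule Hom_vectorspace[OF R W])
  have vsZ: "vectorspace k (?V\<lparr>carrier := ?Z\<rparr>)" by (rule vectorspace.subspace_is_vs[OF HomV Z])
  have subS: "submodule k ?S ?V" using S HomV by (simp add: vectorspace.is_module)
  show ?thesis
    unfolding cohomology_def restriction_cokernel_def
  proof (rule vdim_quotient_eq[symmetric, where \<phi> = "\<lambda>g. g \<cdot> q"])
    show "vectorspace k (Hom A I W)" using m W by (intro Hom_vectorspace) (auto simp: arr_def)
    show "VectorSpace.subspace k ((\<lambda>f. f \<cdot> m) ` hom_set A (R n) W) (Hom A I W)"
      by (rule precomp_image_subspace[OF m(1) W])
    show "VectorSpace.subspace k ?S (?V\<lparr>carrier := ?Z\<rparr>)"
      unfolding VectorSpace.subspace_def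
    proof (intro conjI vsZ submodule.intro)
      show "Module.module k (?V\<lparr>carrier := ?Z\<rparr>)" using vsZ by (simp add: vectorspace_def)
    qed (use SZ submodule.m_closed[OF subS] submodule.zero_closed[OF subS]
        submodule.smult_closed[OF subS] in auto)
    have "(\<lambda>g. g \<cdot> q) \<in> linear_hom k (Hom A I W) ?V"
      using q W by (intro Comp_linear_left) (auto simp: arr_def)
    then show "(\<lambda>g. g \<cdot> q) \<in> linear_hom k (Hom A I W) (?V\<lparr>carrier := ?Z\<rparr>)"
      using cocycle q W unfolding LinearCombinations.module_hom_def arr_def by auto
    show "g \<cdot> q \<in> ?S \<longleftrightarrow> g \<in> (\<lambda>f. f \<cdot> m) ` hom_set A (R n) W" if "g \<in> hom_set A I W" for g
      using bound[of g] that m W by (simp add: arr_def)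
    fix f assume "f \<in> carrier (?V\<lparr>carrier := ?Z\<rparr>)"
    then have fZ: "f \<in> ?Z" by simp
    obtain g where g: "arr A I W g" "f = g \<cdot> q" using factor[OF fZ] by blast
    have "f \<oplus>\<^bsub>?V\<^esub> \<zero>\<^bsub>?V\<^esub> = f"
      using abelian_monoid.r_zero[OF abelian_group.axioms(1)[OF Hom_abelian_group[OF R W]]] fZ
      by (simp add: cocycles_def)
    then show "\<exists>x\<in>hom_set A I W. \<exists>s\<in>?S. x \<cdot> q = f \<oplus>\<^bsub>?V\<lparr>carrier := ?Z\<rparr>\<^esub> s"
      using g submodule.zero_closed[OF subS]
      by (intro bexI[of _ g] bexI[of _ "\<zero>\<^bsub>?V\<^esub>"]) (simp_all add: arr_def)
  qed (use vsZ in auto)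
qed

text \<open>Dimension shifting. The chain of presentations has two uses: spliced, it shows that a resolution
  exists, so that the choice in the definition of Ext yields one; and its objects \<open>X n\<close> are stably
  equivalent to the syzygies of whatever resolution was chosen. The last step may use a presentation
  of \<open>X n\<close> that does not belong to the chain.\<close>

theorem vdim_rel_Ext:
  assumes pres: "\<And>n. rel_presentation A B U (X n) (X (Suc n)) (Q n) (i n) (p n)"
    and allow: "\<And>n. allowable A B U (X (Suc n)) (Q n) (i n)"
    and L: "rel_presentation A B U (X n) L P j \<pi>" and W: "W \<in> Obj A"
  shows "vdim k (rel_Ext A B U (Suc n) (X 0) W) = vdim k (restriction_cokernel A L P j W)"
proof -
  obtain R d e where Rde: "(SOME r. rel_proj_resolution A B U (X 0) r) = (R, d, e)"
    using prod_cases3 by blast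
  have "rel_proj_resolution A B U (X 0) (Q, \<lambda>n. i n \<cdot> p (Suc n), p 0)"
    using pres allow by (rule rel_proj_resolution_splice)
  then have "rel_proj_resolution A B U (X 0) (SOME r. rel_proj_resolution A B U (X 0) r)"
    by (rule someI)
  then have res: "rel_proj_resolution A B U (X 0) (R, d, e)"
    unfolding Rde .
  have R: "R n \<in> Obj A" for n
    using res by (simp add: rel_proj_resolution_def relatively_projective_def)
  have ex: "exact_at A (R (Suc (Suc n))) (R (Suc n)) (R n) (d (Suc n)) (d n)"
    using res by (simp add: rel_proj_resolution_def)
  obtain Y I m q q' where Y: "rel_presentation A B U Y I (R n) m q"
    and XY: "stably_equivalent A B U (X n) Y" and d: "d n = m \<cdot> q'"
    and q': "arr A (R (Suc n)) I q'" "is_epi A (R (Suc n)) I q'"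
    using resolution_syzygy[OF res pres, of n] by blast
  have "vdim k (rel_Ext A B U (Suc n) (X 0) W) = vdim k (cohomology A R d W (Suc n))"
    by (simp add: rel_Ext_def Rde)
  also have "\<dots> = vdim k (restriction_cokernel A I (R n) m W)"
    by (rule cohomology_restriction_cokernel[where d = d, OF ex R d rel_presentation_arr(2,3)[OF Y] q' W])
  also have "\<dots> = vdim k (restriction_cokernel A L P j W)"
    by (rule restriction_cokernel_invariant[OF L Y XY W, symmetric])
  finally show ?thesis .
qed

end

section \<open>Tensoring with an object that has a dual\<close>

text \<open>For \<open>Y'\<close> a left dual of \<open>Y\<close> these are the two directions of the adjunction
  \<open>Hom (T \<otimes> Y) W \<cong> Hom T (W \<otimes> Y')\<close>.\<close>

definition transpose ::
  "('k, 'o, 'm, 'z) tensor_cat_scheme \<Rightarrow> 'o \<Rightarrow> 'm \<Rightarrow> 'o \<Rightarrow> 'm \<Rightarrow> 'm" where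
  "transpose C Y' c T f = (f \<otimes>\<^sub>m\<^bsub>C\<^esub> Id C Y') \<cdot>\<^bsub>C\<^esub> (Id C T \<otimes>\<^sub>m\<^bsub>C\<^esub> c)"

definition untranspose ::
  "('k, 'o, 'm, 'z) tensor_cat_scheme \<Rightarrow> 'o \<Rightarrow> 'm \<Rightarrow> 'o \<Rightarrow> 'm \<Rightarrow> 'm" where
  "untranspose C Y e W g = (Id C W \<otimes>\<^sub>m\<^bsub>C\<^esub> e) \<cdot>\<^bsub>C\<^esub> (g \<otimes>\<^sub>m\<^bsub>C\<^esub> Id C Y)"

context tensor_category
begin

lemma arr_TensM:
  assumes "arr C X X' f" and "arr C Y Y' g"
  shows "arr C (X \<otimes>\<^sub>o Y) (X' \<otimes>\<^sub>o Y') (f \<otimes>\<^sub>m g)"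
  using assms LinearCombinations.module_hom_closed[OF TensM_linear_right[of X X' Y Y' f]]
  by (auto simp: arr_def TensO_obj)

lemma interchange:
  "\<lbrakk>arr C X X' f; arr C X' X'' f'; arr C Y Y' g; arr C Y' Y'' g'\<rbrakk>
    \<Longrightarrow> (f' \<otimes>\<^sub>m g') \<cdot> (f \<otimes>\<^sub>m g) = (f' \<cdot> f) \<otimes>\<^sub>m (g' \<cdot> g)"
  using TensM_Comp[of X X' X'' Y Y' Y'' f f' g g'] by (simp add: arr_def)

lemma arr_TensM_Id:
  "\<lbrakk>arr C X X' f; Z \<in> Obj C\<rbrakk> \<Longrightarrow> arr C (X \<otimes>\<^sub>o Z) (X' \<otimes>\<^sub>o Z) (f \<otimes>\<^sub>m Id C Z)"
  "\<lbrakk>arr C X X' f; Z \<in> Obj C\<rbrakk> \<Longrightarrow> arr C (Z \<otimes>\<^sub>o X) (Z \<otimes>\<^sub>o X') (Id C Z \<otimes>\<^sub>m f)"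
  by (simp_all add: arr_TensM arr_Id)

lemma slide_left:
  assumes f: "arr C X X' f" and g: "arr C Y Y' g"
  shows "(f \<otimes>\<^sub>m Id C Y') \<cdot> (Id C X \<otimes>\<^sub>m g) = f \<otimes>\<^sub>m g"
  using interchange[OF arr_Id f g arr_Id] f g Comp_Id_left[OF g] Comp_Id_right[OF f]
  by (simp add: arr_def)

lemma slide_right:
  assumes f: "arr C X X' f" and g: "arr C Y Y' g"
  shows "(Id C X' \<otimes>\<^sub>m g) \<cdot> (f \<otimes>\<^sub>m Id C Y) = f \<otimes>\<^sub>m g"
  using interchange[OF f arr_Id arr_Id g] f g Comp_Id_left[OF f] Comp_Id_right[OF g]
  by (simp add: arr_def)

lemma TensM_Id_Comp:
  assumes f: "arr C X X' f" and f': "arr C X' X'' f'" and Z: "Z \<in> Obj C"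
  shows "(f' \<cdot> f) \<otimes>\<^sub>m Id C Z = (f' \<otimes>\<^sub>m Id C Z) \<cdot> (f \<otimes>\<^sub>m Id C Z)"
    and "Id C Z \<otimes>\<^sub>m (f' \<cdot> f) = (Id C Z \<otimes>\<^sub>m f') \<cdot> (Id C Z \<otimes>\<^sub>m f)"
  using interchange[OF f f' arr_Id[OF Z] arr_Id[OF Z]] interchange[OF arr_Id[OF Z] arr_Id[OF Z] f f']
    Comp_Id_left[OF arr_Id[OF Z]] by simp_all

lemma TensM_assoc': "\<lbrakk>arr C X X' f; arr C Y Y' g; arr C Z Z' h\<rbrakk>
    \<Longrightarrow> (f \<otimes>\<^sub>m g) \<otimes>\<^sub>m h = f \<otimes>\<^sub>m (g \<otimes>\<^sub>m h)"
  using TensM_assoc[of X X' Y Y' Z Z' f g h] by (simp add: arr_def)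

lemma TensM_Id_assoc:
  assumes f: "arr C X X' f" and Y: "Y \<in> Obj C" and Z: "Z \<in> Obj C"
  shows "(f \<otimes>\<^sub>m Id C Y) \<otimes>\<^sub>m Id C Z = f \<otimes>\<^sub>m Id C (Y \<otimes>\<^sub>o Z)"
    and "(Id C Y \<otimes>\<^sub>m f) \<otimes>\<^sub>m Id C Z = Id C Y \<otimes>\<^sub>m (f \<otimes>\<^sub>m Id C Z)"
    and "Id C (Y \<otimes>\<^sub>o Z) \<otimes>\<^sub>m f = Id C Y \<otimes>\<^sub>m (Id C Z \<otimes>\<^sub>m f)"
  using TensM_assoc'[OF f arr_Id[OF Y] arr_Id[OF Z]] TensM_assoc'[OF arr_Id[OF Y] f arr_Id[OF Z]]
    TensM_assoc'[OF arr_Id[OF Y] arr_Id[OF Z] f] TensM_Id[OF Y Z] by simp_all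

lemma linear_map_TensM_Id:
  assumes "X \<in> Obj C" and "X' \<in> Obj C" and "Z \<in> Obj C"
  shows "linear_map k (Hom C X X') (Hom C (X \<otimes>\<^sub>o Z) (X' \<otimes>\<^sub>o Z)) (\<lambda>f. f \<otimes>\<^sub>m Id C Z)"
proof (rule linear_mapI)
  show "(\<lambda>f. f \<otimes>\<^sub>m Id C Z) \<in> linear_hom k (Hom C X X') (Hom C (X \<otimes>\<^sub>o Z) (X' \<otimes>\<^sub>o Z))"
    by (rule TensM_linear_left) (use assms Id_in_hom in auto)
qed (use assms Hom_vectorspace TensO_obj in auto)

lemma zero_TensM: "\<lbrakk>X \<in> Obj C; X' \<in> Obj C; Z \<in> Obj C\<rbrakk> \<Longrightarrow>
    zero_mor C X X' \<otimes>\<^sub>m Id C Z = zero_mor C (X \<otimes>\<^sub>o Z) (X' \<otimes>\<^sub>o Z)"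
  using linear_map.T0_is_0[OF linear_map_TensM_Id[of X X' Z]] by simp

context
  fixes Y Y' e c
  assumes dual: "is_left_dual C Y Y' e c"
begin

private lemma Y: "Y \<in> Obj C" and Y': "Y' \<in> Obj C"
  using dual by (auto simp: is_left_dual_def)

private lemma e: "arr C (Y' \<otimes>\<^sub>o Y) (Unit C) e" and c: "arr C (Unit C) (Y \<otimes>\<^sub>o Y') c"
  using dual by (auto simp: is_left_dual_def arr_def TensO_obj Unit_obj)

lemma arr_transpose:
  assumes f: "arr C (T \<otimes>\<^sub>o Y) W f" and T: "T \<in> Obj C"
  shows "arr C T (W \<otimes>\<^sub>o Y') (transpose C Y' c T f)"
  unfolding transpose_def
proof (rule arr_Comp)
  show "arr C T (T \<otimes>\<^sub>o (Y \<otimes>\<^sub>o Y')) (Id C T \<otimes>\<^sub>m c)"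
    using arr_TensM_Id(2)[OF c T] TensO_Unit(2)[OF T] by simp
  show "arr C (T \<otimes>\<^sub>o (Y \<otimes>\<^sub>o Y')) (W \<otimes>\<^sub>o Y') (f \<otimes>\<^sub>m Id C Y')"
    using arr_TensM_Id(1)[OF f Y'] TensO_assoc[OF T Y Y'] by simp
qed

lemma arr_untranspose:
  assumes g: "arr C T (W \<otimes>\<^sub>o Y') g" and W: "W \<in> Obj C"
  shows "arr C (T \<otimes>\<^sub>o Y) W (untranspose C Y e W g)"
  unfolding untranspose_def
proof (rule arr_Comp)
  show "arr C (T \<otimes>\<^sub>o Y) (W \<otimes>\<^sub>o (Y' \<otimes>\<^sub>o Y)) (g \<otimes>\<^sub>m Id C Y)"
    using arr_TensM_Id(1)[OF g Y] TensO_assoc[OF W Y' Y] by simp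
  show "arr C (W \<otimes>\<^sub>o (Y' \<otimes>\<^sub>o Y)) W (Id C W \<otimes>\<^sub>m e)"
    using arr_TensM_Id(2)[OF e W] TensO_Unit(2)[OF W] by simp
qed

lemma transpose_natural_left:
  assumes f: "arr C (T \<otimes>\<^sub>o Y) W f" and t: "arr C S T t"
  shows "transpose C Y' c S (f \<cdot> (t \<otimes>\<^sub>m Id C Y)) = transpose C Y' c T f \<cdot> t"
proof -
  have S: "S \<in> Obj C" and T: "T \<in> Obj C" using t by (auto simp: arr_def)
  have Sc: "arr C S (S \<otimes>\<^sub>o (Y \<otimes>\<^sub>o Y')) (Id C S \<otimes>\<^sub>m c)" and Tc: "arr C T (T \<otimes>\<^sub>o (Y \<otimes>\<^sub>o Y')) (Id C T \<otimes>\<^sub>m c)"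
    using arr_TensM_Id(2)[OF c S] arr_TensM_Id(2)[OF c T] TensO_Unit(2)[OF S] TensO_Unit(2)[OF T]
    by simp_all
  have fY: "arr C (T \<otimes>\<^sub>o (Y \<otimes>\<^sub>o Y')) (W \<otimes>\<^sub>o Y') (f \<otimes>\<^sub>m Id C Y')"
    using arr_TensM_Id(1)[OF f Y'] TensO_assoc[OF T Y Y'] by simp
  have tYY: "arr C (S \<otimes>\<^sub>o (Y \<otimes>\<^sub>o Y')) (T \<otimes>\<^sub>o (Y \<otimes>\<^sub>o Y')) (t \<otimes>\<^sub>m Id C (Y \<otimes>\<^sub>o Y'))"
    using arr_TensM_Id(1)[OF t] TensO_obj[OF Y Y'] by simp
  have "transpose C Y' c S (f \<cdot> (t \<otimes>\<^sub>m Id C Y)) =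
      ((f \<otimes>\<^sub>m Id C Y') \<cdot> (t \<otimes>\<^sub>m Id C (Y \<otimes>\<^sub>o Y'))) \<cdot> (Id C S \<otimes>\<^sub>m c)"
    unfolding transpose_def
    using TensM_Id_Comp(1)[OF arr_TensM_Id(1)[OF t Y] f Y'] TensM_Id_assoc(1)[OF t Y Y'] by simp
  also have "\<dots> = (f \<otimes>\<^sub>m Id C Y') \<cdot> (t \<otimes>\<^sub>m c)"
    using assoc[OF Sc tYY fY] slide_left[OF t c] by simp
  also have "t \<otimes>\<^sub>m c = (Id C T \<otimes>\<^sub>m c) \<cdot> t"
    using slide_right[OF t c] TensM_Unit(2)[of S T t] t by (simp add: arr_def)
  also have "(f \<otimes>\<^sub>m Id C Y') \<cdot> ((Id C T \<otimes>\<^sub>m c) \<cdot> t) = transpose C Y' c T f \<cdot> t"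
    unfolding transpose_def by (rule assoc[OF t Tc fY, symmetric])
  finally show ?thesis .
qed

lemma transpose_natural_right:
  assumes f: "arr C (T \<otimes>\<^sub>o Y) W f" and w: "arr C W W' w" and T: "T \<in> Obj C"
  shows "transpose C Y' c T (w \<cdot> f) = (w \<otimes>\<^sub>m Id C Y') \<cdot> transpose C Y' c T f"
proof -
  have Tc: "arr C T (T \<otimes>\<^sub>o (Y \<otimes>\<^sub>o Y')) (Id C T \<otimes>\<^sub>m c)"
    using arr_TensM_Id(2)[OF c T] TensO_Unit(2)[OF T] by simp
  have fY: "arr C (T \<otimes>\<^sub>o (Y \<otimes>\<^sub>o Y')) (W \<otimes>\<^sub>o Y') (f \<otimes>\<^sub>m Id C Y')"
    using arr_TensM_Id(1)[OF f Y'] TensO_assoc[OF T Y Y'] by simp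
  show ?thesis
    unfolding transpose_def TensM_Id_Comp(1)[OF f w Y']
    by (rule assoc[OF Tc fY arr_TensM_Id(1)[OF w Y']])
qed

lemma untranspose_natural_right:
  assumes g: "arr C T (W \<otimes>\<^sub>o Y') g" and w: "arr C W W' w"
  shows "untranspose C Y e W' ((w \<otimes>\<^sub>m Id C Y') \<cdot> g) = w \<cdot> untranspose C Y e W g"
proof -
  have W: "W \<in> Obj C" and W': "W' \<in> Obj C" using w by (auto simp: arr_def)
  have We: "arr C (W \<otimes>\<^sub>o (Y' \<otimes>\<^sub>o Y)) W (Id C W \<otimes>\<^sub>m e)"
    and We': "arr C (W' \<otimes>\<^sub>o (Y' \<otimes>\<^sub>o Y)) W' (Id C W' \<otimes>\<^sub>m e)"
    using arr_TensM_Id(2)[OF e W] arr_TensM_Id(2)[OF e W'] TensO_Unit(2)[OF W] TensO_Unit(2)[OF W']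
    by simp_all
  have gY: "arr C (T \<otimes>\<^sub>o Y) (W \<otimes>\<^sub>o (Y' \<otimes>\<^sub>o Y)) (g \<otimes>\<^sub>m Id C Y)"
    using arr_TensM_Id(1)[OF g Y] TensO_assoc[OF W Y' Y] by simp
  have wYY: "arr C (W \<otimes>\<^sub>o (Y' \<otimes>\<^sub>o Y)) (W' \<otimes>\<^sub>o (Y' \<otimes>\<^sub>o Y)) (w \<otimes>\<^sub>m Id C (Y' \<otimes>\<^sub>o Y))"
    using arr_TensM_Id(1)[OF w] TensO_obj[OF Y' Y] by simp
  have "untranspose C Y e W' ((w \<otimes>\<^sub>m Id C Y') \<cdot> g) =
      (Id C W' \<otimes>\<^sub>m e) \<cdot> ((w \<otimes>\<^sub>m Id C (Y' \<otimes>\<^sub>o Y)) \<cdot> (g \<otimes>\<^sub>m Id C Y))"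
    unfolding untranspose_def
    using TensM_Id_Comp(1)[OF g arr_TensM_Id(1)[OF w Y'] Y] TensM_Id_assoc(1)[OF w Y' Y] by simp
  also have "\<dots> = (w \<otimes>\<^sub>m e) \<cdot> (g \<otimes>\<^sub>m Id C Y)"
    using assoc[OF gY wYY We'] slide_right[OF w e] by simp
  also have "w \<otimes>\<^sub>m e = w \<cdot> (Id C W \<otimes>\<^sub>m e)"
    using slide_left[OF w e] TensM_Unit(2)[of W W' w] w by (simp add: arr_def)
  also have "(w \<cdot> (Id C W \<otimes>\<^sub>m e)) \<cdot> (g \<otimes>\<^sub>m Id C Y) = w \<cdot> untranspose C Y e W g"
    unfolding untranspose_def by (rule assoc[OF gY We w])
  finally show ?thesis .
qed

lemma untranspose_natural_left:
  assumes g: "arr C T (W \<otimes>\<^sub>o Y') g" and t: "arr C S T t" and W: "W \<in> Obj C"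
  shows "untranspose C Y e W (g \<cdot> t) = untranspose C Y e W g \<cdot> (t \<otimes>\<^sub>m Id C Y)"
proof -
  have We: "arr C (W \<otimes>\<^sub>o (Y' \<otimes>\<^sub>o Y)) W (Id C W \<otimes>\<^sub>m e)"
    using arr_TensM_Id(2)[OF e W] TensO_Unit(2)[OF W] by simp
  have gY: "arr C (T \<otimes>\<^sub>o Y) (W \<otimes>\<^sub>o (Y' \<otimes>\<^sub>o Y)) (g \<otimes>\<^sub>m Id C Y)"
    using arr_TensM_Id(1)[OF g Y] TensO_assoc[OF W Y' Y] by simp
  show ?thesis
    unfolding untranspose_def TensM_Id_Comp(1)[OF t g Y]
    by (rule assoc[OF arr_TensM_Id(1)[OF t Y] gY We, symmetric])
qed

text \<open>By naturality in the target it suffices to treat the identity of \<open>T \<otimes> Y\<close>, where the claim is \<open>T\<close>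
  tensored with the first zig-zag identity.\<close>

lemma untranspose_transpose:
  assumes f: "arr C (T \<otimes>\<^sub>o Y) W f" and T: "T \<in> Obj C"
  shows "untranspose C Y e W (transpose C Y' c T f) = f"
proof -
  note TY = TensO_obj[OF T Y]
  have Tc: "arr C T (T \<otimes>\<^sub>o Y \<otimes>\<^sub>o Y') (Id C T \<otimes>\<^sub>m c)"
    using arr_TensM_Id(2)[OF c T] TensO_Unit(2)[OF T] TensO_assoc[OF T Y Y'] by simp
  have Ye: "arr C (Y \<otimes>\<^sub>o (Y' \<otimes>\<^sub>o Y)) Y (Id C Y \<otimes>\<^sub>m e)"
    using arr_TensM_Id(2)[OF e Y] TensO_Unit(2)[OF Y] by simp
  have cY: "arr C Y (Y \<otimes>\<^sub>o (Y' \<otimes>\<^sub>o Y)) (c \<otimes>\<^sub>m Id C Y)"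
    using arr_TensM_Id(1)[OF c Y] TensO_Unit(1)[OF Y] TensO_assoc[OF Y Y' Y] by simp
  have "Id C (T \<otimes>\<^sub>o Y) \<otimes>\<^sub>m Id C Y' = Id C (T \<otimes>\<^sub>o Y \<otimes>\<^sub>o Y')" by (rule TensM_Id[OF TY Y'])
  then have "transpose C Y' c T (Id C (T \<otimes>\<^sub>o Y)) = Id C T \<otimes>\<^sub>m c"
    unfolding transpose_def using Comp_Id_left[OF Tc] by simp
  then have "untranspose C Y e (T \<otimes>\<^sub>o Y) (transpose C Y' c T (Id C (T \<otimes>\<^sub>o Y))) =
      (Id C T \<otimes>\<^sub>m (Id C Y \<otimes>\<^sub>m e)) \<cdot> (Id C T \<otimes>\<^sub>m (c \<otimes>\<^sub>m Id C Y))"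
    unfolding untranspose_def
    using TensM_Id_assoc(2)[OF c T Y] TensM_Id_assoc(3)[OF e T Y] by simp
  also have "\<dots> = Id C T \<otimes>\<^sub>m Id C Y"
    using TensM_Id_Comp(2)[OF cY Ye T] dual by (simp add: is_left_dual_def)
  also have "\<dots> = Id C (T \<otimes>\<^sub>o Y)" by (rule TensM_Id[OF T Y])
  finally have unit: "untranspose C Y e (T \<otimes>\<^sub>o Y) (transpose C Y' c T (Id C (T \<otimes>\<^sub>o Y))) = Id C (T \<otimes>\<^sub>o Y)" .
  have "transpose C Y' c T f = (f \<otimes>\<^sub>m Id C Y') \<cdot> transpose C Y' c T (Id C (T \<otimes>\<^sub>o Y))"
    using transpose_natural_right[OF arr_Id[OF TY] f T] Comp_Id_right[OF f] by simp
  then show ?thesis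
    using untranspose_natural_right[OF arr_transpose[OF arr_Id[OF TY] T] f] unit Comp_Id_right[OF f]
    by simp
qed

text \<open>By naturality in the source it suffices to treat the identity of \<open>W \<otimes> Y'\<close>, where the claim is \<open>W\<close>
  tensored with the second zig-zag identity.\<close>

lemma transpose_untranspose:
  assumes g: "arr C T (W \<otimes>\<^sub>o Y') g" and W: "W \<in> Obj C"
  shows "transpose C Y' c T (untranspose C Y e W g) = g"
proof -
  note WY = TensO_obj[OF W Y']
  have We: "arr C (W \<otimes>\<^sub>o Y' \<otimes>\<^sub>o Y) W (Id C W \<otimes>\<^sub>m e)"
    using arr_TensM_Id(2)[OF e W] TensO_Unit(2)[OF W] TensO_assoc[OF W Y' Y] by simp
  have Yc: "arr C Y' (Y' \<otimes>\<^sub>o (Y \<otimes>\<^sub>o Y')) (Id C Y' \<otimes>\<^sub>m c)"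
    using arr_TensM_Id(2)[OF c Y'] TensO_Unit(2)[OF Y'] by simp
  have eY: "arr C (Y' \<otimes>\<^sub>o (Y \<otimes>\<^sub>o Y')) Y' (e \<otimes>\<^sub>m Id C Y')"
    using arr_TensM_Id(1)[OF e Y'] TensO_Unit(1)[OF Y'] TensO_assoc[OF Y' Y Y'] by simp
  have "Id C (W \<otimes>\<^sub>o Y') \<otimes>\<^sub>m Id C Y = Id C (W \<otimes>\<^sub>o Y' \<otimes>\<^sub>o Y)" by (rule TensM_Id[OF WY Y])
  then have "untranspose C Y e W (Id C (W \<otimes>\<^sub>o Y')) = Id C W \<otimes>\<^sub>m e"
    unfolding untranspose_def using Comp_Id_right[OF We] by simp
  then have "transpose C Y' c (W \<otimes>\<^sub>o Y') (untranspose C Y e W (Id C (W \<otimes>\<^sub>o Y'))) =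
      (Id C W \<otimes>\<^sub>m (e \<otimes>\<^sub>m Id C Y')) \<cdot> (Id C W \<otimes>\<^sub>m (Id C Y' \<otimes>\<^sub>m c))"
    unfolding transpose_def
    using TensM_Id_assoc(2)[OF e W Y'] TensM_Id_assoc(3)[OF c W Y'] by simp
  also have "\<dots> = Id C W \<otimes>\<^sub>m Id C Y'"
    using TensM_Id_Comp(2)[OF Yc eY W] dual by (simp add: is_left_dual_def)
  also have "\<dots> = Id C (W \<otimes>\<^sub>o Y')" by (rule TensM_Id[OF W Y'])
  finally have counit: "transpose C Y' c (W \<otimes>\<^sub>o Y') (untranspose C Y e W (Id C (W \<otimes>\<^sub>o Y'))) =
    Id C (W \<otimes>\<^sub>o Y')" .
  have "untranspose C Y e W g = untranspose C Y e W (Id C (W \<otimes>\<^sub>o Y')) \<cdot> (g \<otimes>\<^sub>m Id C Y)"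
    using untranspose_natural_left[OF arr_Id[OF WY] g W] Comp_Id_left[OF g] by simp
  then show ?thesis
    using transpose_natural_left[OF arr_untranspose[OF arr_Id[OF WY] W] g] counit Comp_Id_left[OF g]
    by simp
qed

lemma transpose_linear:
  assumes T: "T \<in> Obj C" and W: "W \<in> Obj C"
  shows "transpose C Y' c T \<in> linear_hom k (Hom C (T \<otimes>\<^sub>o Y) W) (Hom C T (W \<otimes>\<^sub>o Y'))"
proof -
  have Tc: "arr C T (T \<otimes>\<^sub>o Y \<otimes>\<^sub>o Y') (Id C T \<otimes>\<^sub>m c)"
    using arr_TensM_Id(2)[OF c T] TensO_Unit(2)[OF T] TensO_assoc[OF T Y Y'] by simp
  have "(\<lambda>g. g \<cdot> (Id C T \<otimes>\<^sub>m c)) \<in> linear_hom k (Hom C (T \<otimes>\<^sub>o Y \<otimes>\<^sub>o Y') (W \<otimes>\<^sub>o Y')) (Hom C T (W \<otimes>\<^sub>o Y'))"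
    using Tc TensO_obj[OF W Y'] by (intro Comp_linear_left) (auto simp: arr_def)
  moreover have "(\<lambda>f. f \<otimes>\<^sub>m Id C Y') \<in>
      linear_hom k (Hom C (T \<otimes>\<^sub>o Y) W) (Hom C (T \<otimes>\<^sub>o Y \<otimes>\<^sub>o Y') (W \<otimes>\<^sub>o Y'))"
    using T W TensO_obj[OF T Y] Y' Id_in_hom[OF Y'] by (intro TensM_linear_left)
  ultimately show ?thesis
    unfolding LinearCombinations.module_hom_def transpose_def by (simp add: Pi_iff)
qed

text \<open>Tensoring with \<open>Y\<close> is a left adjoint, so it preserves epimorphisms.\<close>

lemma epi_TensM_left_dual:
  assumes f: "arr C X Z f" and epi: "is_epi C X Z f"
  shows "is_epi C (X \<otimes>\<^sub>o Y) (Z \<otimes>\<^sub>o Y) (f \<otimes>\<^sub>m Id C Y)"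
  unfolding is_epi_def
proof (intro conjI ballI impI)
  show "f \<otimes>\<^sub>m Id C Y \<in> hom_set C (X \<otimes>\<^sub>o Y) (Z \<otimes>\<^sub>o Y)"
    using arr_TensM_Id(1)[OF f Y] by (simp add: arr_def)
  have Z: "Z \<in> Obj C" using f by (simp add: arr_def)
  fix T g h assume "T \<in> Obj C" "g \<in> hom_set C (Z \<otimes>\<^sub>o Y) T" "h \<in> hom_set C (Z \<otimes>\<^sub>o Y) T"
    and eq: "g \<cdot> (f \<otimes>\<^sub>m Id C Y) = h \<cdot> (f \<otimes>\<^sub>m Id C Y)"
  then have g: "arr C (Z \<otimes>\<^sub>o Y) T g" and h: "arr C (Z \<otimes>\<^sub>o Y) T h"
    using TensO_obj[OF Z Y] by (simp_all add: arr_def)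
  have "transpose C Y' c Z g = transpose C Y' c Z h"
    using epi_cancel[OF epi arr_transpose[OF g Z] arr_transpose[OF h Z]]
      transpose_natural_left[OF g f] transpose_natural_left[OF h f] eq by metis
  then show "g = h" using untranspose_transpose[OF g Z] untranspose_transpose[OF h Z] by metis
qed

text \<open>Tensoring with \<open>Y'\<close> is a right adjoint, so it preserves kernels.\<close>

lemma kernel_TensM_right_dual:
  assumes f: "arr C X Z f" and N: "is_kernel C X Z f N m"
  shows "is_kernel C (X \<otimes>\<^sub>o Y') (Z \<otimes>\<^sub>o Y') (f \<otimes>\<^sub>m Id C Y') (N \<otimes>\<^sub>o Y') (m \<otimes>\<^sub>m Id C Y')"
proof (rule kernelI)
  have m: "arr C N X m" using kernel_arr[OF N] f by (simp add: arr_def)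
  have objs: "X \<in> Obj C" "Z \<in> Obj C" "N \<in> Obj C" using m f by (auto simp: arr_def)
  show "arr C (X \<otimes>\<^sub>o Y') (Z \<otimes>\<^sub>o Y') (f \<otimes>\<^sub>m Id C Y')" using f Y' by (rule arr_TensM_Id)
  show mY: "arr C (N \<otimes>\<^sub>o Y') (X \<otimes>\<^sub>o Y') (m \<otimes>\<^sub>m Id C Y')" using m Y' by (rule arr_TensM_Id)
  show "(f \<otimes>\<^sub>m Id C Y') \<cdot> (m \<otimes>\<^sub>m Id C Y') = zero_mor C (N \<otimes>\<^sub>o Y') (Z \<otimes>\<^sub>o Y')"
    using TensM_Id_Comp(1)[OF m f Y'] kernel_zero[OF N] zero_TensM[OF objs(3,2) Y'] by simp
  show "is_mono C (N \<otimes>\<^sub>o Y') (X \<otimes>\<^sub>o Y') (m \<otimes>\<^sub>m Id C Y')"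
    unfolding is_mono_def
  proof (intro conjI ballI impI)
    show "m \<otimes>\<^sub>m Id C Y' \<in> hom_set C (N \<otimes>\<^sub>o Y') (X \<otimes>\<^sub>o Y')" using mY by (simp add: arr_def)
    fix T g h assume "T \<in> Obj C" "g \<in> hom_set C T (N \<otimes>\<^sub>o Y')" "h \<in> hom_set C T (N \<otimes>\<^sub>o Y')"
      and eq: "(m \<otimes>\<^sub>m Id C Y') \<cdot> g = (m \<otimes>\<^sub>m Id C Y') \<cdot> h"
    then have g: "arr C T (N \<otimes>\<^sub>o Y') g" and h: "arr C T (N \<otimes>\<^sub>o Y') h"
      using TensO_obj[OF objs(3) Y'] by (simp_all add: arr_def)
    have "untranspose C Y e N g = untranspose C Y e N h"
      using mono_cancel[OF kernel_is_mono[OF N f] arr_untranspose[OF g objs(3)]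
          arr_untranspose[OF h objs(3)]]
        untranspose_natural_right[OF g m] untranspose_natural_right[OF h m] eq by metis
    then show "g = h" using transpose_untranspose[OF g objs(3)] transpose_untranspose[OF h objs(3)]
      by metis
  qed
  fix T t assume t: "arr C T (X \<otimes>\<^sub>o Y') t" "(f \<otimes>\<^sub>m Id C Y') \<cdot> t = zero_mor C T (Z \<otimes>\<^sub>o Y')"
  have T: "T \<in> Obj C" using t by (simp add: arr_def)
  note ut = arr_untranspose[OF t(1) objs(1)]
  have z: "untranspose C Y e Z (zero_mor C T (Z \<otimes>\<^sub>o Y')) = zero_mor C (T \<otimes>\<^sub>o Y) Z"
  proof -
    have "zero_mor C T (Z \<otimes>\<^sub>o Y') \<otimes>\<^sub>m Id C Y = zero_mor C (T \<otimes>\<^sub>o Y) (Z \<otimes>\<^sub>o (Y' \<otimes>\<^sub>o Y))"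
      using zero_TensM[OF T TensO_obj[OF objs(2) Y'] Y] TensO_assoc[OF objs(2) Y' Y] by simp
    moreover have Ze: "arr C (Z \<otimes>\<^sub>o (Y' \<otimes>\<^sub>o Y)) Z (Id C Z \<otimes>\<^sub>m e)"
      using arr_TensM_Id(2)[OF e objs(2)] TensO_Unit(2)[OF objs(2)] by simp
    ultimately show ?thesis unfolding untranspose_def using Comp_zero[OF Ze TensO_obj[OF T Y]] by simp
  qed
  have "f \<cdot> untranspose C Y e X t = zero_mor C (T \<otimes>\<^sub>o Y) Z"
    using untranspose_natural_right[OF t(1) f] t(2) z by simp
  then obtain u where u: "arr C (T \<otimes>\<^sub>o Y) N u" "untranspose C Y e X t = m \<cdot> u"
    using kernel_factor[OF N ut] by metis
  have "t = (m \<otimes>\<^sub>m Id C Y') \<cdot> transpose C Y' c T u"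
    using transpose_untranspose[OF t(1) objs(1)] u(2) transpose_natural_right[OF u(1) m T] by simp
  then show "\<exists>u. arr C T (N \<otimes>\<^sub>o Y') u \<and> t = (m \<otimes>\<^sub>m Id C Y') \<cdot> u"
    using arr_transpose[OF u(1) T] by blast
qed

text \<open>Transposition is natural in the source, so it identifies the morphisms that extend along
  \<open>f \<otimes> Y\<close> with those that extend along \<open>f\<close>.\<close>

lemma restriction_cokernel_transpose:
  assumes f: "arr C S T f" and W: "W \<in> Obj C"
  shows "vdim k (restriction_cokernel C (S \<otimes>\<^sub>o Y) (T \<otimes>\<^sub>o Y) (f \<otimes>\<^sub>m Id C Y) W) =
    vdim k (restriction_cokernel C S T f (W \<otimes>\<^sub>o Y'))"
proof -
  have S: "S \<in> Obj C" and T: "T \<in> Obj C" using f by (auto simp: arr_def)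
  note WY = TensO_obj[OF W Y']
  show ?thesis
    unfolding restriction_cokernel_def
  proof (rule vdim_quotient_eq)
    show "transpose C Y' c S \<in> linear_hom k (Hom C (S \<otimes>\<^sub>o Y) W) (Hom C S (W \<otimes>\<^sub>o Y'))"
      by (rule transpose_linear[OF S W])
    fix x assume "x \<in> hom_set C (S \<otimes>\<^sub>o Y) W"
    then have x: "arr C (S \<otimes>\<^sub>o Y) W x" using TensO_obj[OF S Y] W by (simp add: arr_def)
    show "transpose C Y' c S x \<in> (\<lambda>g. g \<cdot> f) ` hom_set C T (W \<otimes>\<^sub>o Y') \<longleftrightarrow>
      x \<in> (\<lambda>g. g \<cdot> (f \<otimes>\<^sub>m Id C Y)) ` hom_set C (T \<otimes>\<^sub>o Y) W"
    proof
      assume "transpose C Y' c S x \<in> (\<lambda>g. g \<cdot> f) ` hom_set C T (W \<otimes>\<^sub>o Y')"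
      then obtain g where g: "arr C T (W \<otimes>\<^sub>o Y') g" "transpose C Y' c S x = g \<cdot> f"
        using T WY by (auto simp: arr_def)
      have "x = untranspose C Y e W g \<cdot> (f \<otimes>\<^sub>m Id C Y)"
        using untranspose_transpose[OF x S] g(2) untranspose_natural_left[OF g(1) f W] by simp
      then show "x \<in> (\<lambda>g. g \<cdot> (f \<otimes>\<^sub>m Id C Y)) ` hom_set C (T \<otimes>\<^sub>o Y) W"
        using arrD(3)[OF arr_untranspose[OF g(1) W]] by (rule image_eqI)
    next
      assume "x \<in> (\<lambda>g. g \<cdot> (f \<otimes>\<^sub>m Id C Y)) ` hom_set C (T \<otimes>\<^sub>o Y) W"
      then obtain g where g: "arr C (T \<otimes>\<^sub>o Y) W g" "x = g \<cdot> (f \<otimes>\<^sub>m Id C Y)"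
        using TensO_obj[OF T Y] W by (auto simp: arr_def)
      have "transpose C Y' c S x = transpose C Y' c T g \<cdot> f"
        unfolding g(2) by (rule transpose_natural_left[OF g(1) f])
      then show "transpose C Y' c S x \<in> (\<lambda>g. g \<cdot> f) ` hom_set C T (W \<otimes>\<^sub>o Y')"
        using arrD(3)[OF arr_transpose[OF g(1) T]] by (rule image_eqI)
    qed
  next
    fix y assume "y \<in> hom_set C S (W \<otimes>\<^sub>o Y')"
    then have y: "arr C S (W \<otimes>\<^sub>o Y') y" using S WY by (simp add: arr_def)
    have "y \<oplus>\<^bsub>Hom C S (W \<otimes>\<^sub>o Y')\<^esub> zero_mor C S (W \<otimes>\<^sub>o Y') = y"
      using abelian_monoid.r_zero[OF abelian_group.axioms(1)[OF Hom_abelian_group[OF S WY]]] y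
      by (simp add: arr_def)
    moreover have "zero_mor C S (W \<otimes>\<^sub>o Y') \<in> (\<lambda>g. g \<cdot> f) ` hom_set C T (W \<otimes>\<^sub>o Y')"
      using zero_Comp[OF f WY, symmetric] arrD(3)[OF arr_zero[OF T WY]] by (rule image_eqI)
    ultimately show "\<exists>x\<in>hom_set C (S \<otimes>\<^sub>o Y) W. \<exists>s\<in>(\<lambda>g. g \<cdot> f) ` hom_set C T (W \<otimes>\<^sub>o Y').
        transpose C Y' c S x = y \<oplus>\<^bsub>Hom C S (W \<otimes>\<^sub>o Y')\<^esub> s"
      using transpose_untranspose[OF y W] arrD(3)[OF arr_untranspose[OF y W]] by metis
  qed (rule Hom_vectorspace[OF TensO_obj[OF S Y] W] Hom_vectorspace[OF S WY]
      precomp_image_subspace[OF arr_TensM_Id(1)[OF f Y] W] precomp_image_subspace[OF f WY])+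
qed

end

lemma tensor_power_obj: "X \<in> Obj C \<Longrightarrow> tensor_power C X n \<in> Obj C"
  by (induction n) (simp_all add: Unit_obj TensO_obj)

lemma tensor_power_commute: "X \<in> Obj C \<Longrightarrow> X \<otimes>\<^sub>o tensor_power C X n = tensor_power C X (Suc n)"
proof (induction n)
  case (Suc n)
  then show ?case using TensO_assoc[of X "tensor_power C X n" X] tensor_power_obj by simp
qed (simp add: TensO_Unit)

text \<open>The chosen dual of the unit object is only isomorphic to the unit object; the comparison with tensor
  powers needs this one.\<close>

lemma Unit_left_dual: "is_left_dual C (Unit C) (Unit C) (Id C (Unit C)) (Id C (Unit C))"
  using Unit_obj Id_in_hom[OF Unit_obj] TensO_Unit(1)[OF Unit_obj] TensM_Id[OF Unit_obj Unit_obj]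
    Id_left[OF Unit_obj Unit_obj Id_in_hom[OF Unit_obj]]
  by (simp add: is_left_dual_def)

text \<open>The factors \<open>Y\<close> are moved to the other side one at a time, from the right; each new factor \<open>Y'\<close> is
  appended to \<open>W\<close>. So the dual of a tensor power never has to be identified.\<close>

lemma restriction_cokernel_tensor_power:
  assumes f: "arr C S T f" and dual: "is_left_dual C Y Y' e c" and W: "W \<in> Obj C"
  shows "vdim k (restriction_cokernel C (S \<otimes>\<^sub>o tensor_power C Y n) (T \<otimes>\<^sub>o tensor_power C Y n)
      (f \<otimes>\<^sub>m Id C (tensor_power C Y n)) W) =
    vdim k (restriction_cokernel C S T f (W \<otimes>\<^sub>o tensor_power C Y' n))"
  using W
proof (induction n arbitrary: W)
  case 0
  then show ?case using f TensM_Unit(2)[of S T f] by (simp add: TensO_Unit arr_def)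
next
  case (Suc n)
  have Y: "Y \<in> Obj C" and Y': "Y' \<in> Obj C" using dual by (auto simp: is_left_dual_def)
  have S: "S \<in> Obj C" and T: "T \<in> Obj C" using f by (auto simp: arr_def)
  note Yn = tensor_power_obj[OF Y, of n] and Y'n = tensor_power_obj[OF Y', of n]
  have "vdim k (restriction_cokernel C (S \<otimes>\<^sub>o tensor_power C Y (Suc n)) (T \<otimes>\<^sub>o tensor_power C Y (Suc n))
      (f \<otimes>\<^sub>m Id C (tensor_power C Y (Suc n))) W) =
    vdim k (restriction_cokernel C (S \<otimes>\<^sub>o tensor_power C Y n \<otimes>\<^sub>o Y) (T \<otimes>\<^sub>o tensor_power C Y n \<otimes>\<^sub>o Y)
      (f \<otimes>\<^sub>m Id C (tensor_power C Y n) \<otimes>\<^sub>m Id C Y) W)"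
    using TensO_assoc[OF S Yn Y] TensO_assoc[OF T Yn Y] TensM_Id_assoc(1)[OF f Yn Y] by simp
  also have "\<dots> = vdim k (restriction_cokernel C (S \<otimes>\<^sub>o tensor_power C Y n) (T \<otimes>\<^sub>o tensor_power C Y n)
      (f \<otimes>\<^sub>m Id C (tensor_power C Y n)) (W \<otimes>\<^sub>o Y'))"
    by (rule restriction_cokernel_transpose[OF dual arr_TensM_Id(1)[OF f Yn] Suc.prems])
  also have "\<dots> = vdim k (restriction_cokernel C S T f (W \<otimes>\<^sub>o Y' \<otimes>\<^sub>o tensor_power C Y' n))"
    by (rule Suc.IH[OF TensO_obj[OF Suc.prems Y']])
  also have "W \<otimes>\<^sub>o Y' \<otimes>\<^sub>o tensor_power C Y' n = W \<otimes>\<^sub>o tensor_power C Y' (Suc n)"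
    using TensO_assoc[OF Suc.prems Y' Y'n] tensor_power_commute[OF Y', of n] by simp
  finally show ?case .
qed

end

section \<open>Relative Ext over a tensor category\<close>

locale relative_tensor = A?: tensor_category k A + B: tensor_category k B
  for k :: "('k, 'r) ring_scheme"
    and A :: "('k, 'o, 'm, 'z) tensor_cat_scheme" (structure)
    and B :: "('k, 'p, 'q, 'y) tensor_cat_scheme" +
  fixes U :: "('o, 'm, 'p, 'q, 'x) mon_functor_scheme"
  assumes exact: "exact_functor A B U" and monoidal: "monoidal_functor A B U"

sublocale relative_tensor \<subseteq> relative_abelian k A B U
  by unfold_locales (rule exact)

context relative_tensor
begin

text \<open>Up to the structure isomorphisms of \<open>U\<close> the morphism \<open>U (f \<otimes> Z)\<close> is \<open>U f \<otimes> U Z\<close>, for which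
  \<open>s \<otimes> U Z\<close> is a pseudo-inverse if \<open>s\<close> is one for \<open>U f\<close>.\<close>

lemma allowable_TensM:
  assumes f: "arr A X Y f" and allow: "allowable A B U X Y f" and Z: "Z \<in> Obj A"
  shows "allowable A B U (X \<otimes>\<^sub>o Z) (Y \<otimes>\<^sub>o Z) (f \<otimes>\<^sub>m Id A Z)"
proof -
  have X: "X \<in> Obj A" and Y: "Y \<in> Obj A" using f by (auto simp: arr_def)
  have UO: "FObj U T \<in> Obj B" if "T \<in> Obj A" for T
    using U_functor that by (simp add: is_functor_def)
  have fZ: "arr A (X \<otimes>\<^sub>o Z) (Y \<otimes>\<^sub>o Z) (f \<otimes>\<^sub>m Id A Z)" using f Z by (rule arr_TensM_Id)
  let ?J = "FTens U X Z" and ?Jy = "FTens U Y Z" and ?G = "FMor U (f \<otimes>\<^sub>m Id A Z)"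
  let ?\<phi> = "FMor U f \<otimes>\<^sub>m\<^bsub>B\<^esub> Id B (FObj U Z)"
  have iso: "is_iso B (FObj U T \<otimes>\<^sub>o\<^bsub>B\<^esub> FObj U Z) (FObj U (T \<otimes>\<^sub>o Z)) (FTens U T Z)" if "T \<in> Obj A" for T
    using monoidal that Z by (simp add: monoidal_functor_def)
  have J_arr: "arr B (FObj U T \<otimes>\<^sub>o\<^bsub>B\<^esub> FObj U Z) (FObj U (T \<otimes>\<^sub>o Z)) (FTens U T Z)" if "T \<in> Obj A" for T
    using iso[OF that] B.TensO_obj[OF UO[OF that] UO[OF Z]] UO[OF TensO_obj[OF that Z]]
    by (simp add: is_iso_def arr_def)
  note J = J_arr[OF X] and Jy = J_arr[OF Y]
  obtain J' where J': "arr B (FObj U (X \<otimes>\<^sub>o Z)) (FObj U X \<otimes>\<^sub>o\<^bsub>B\<^esub> FObj U Z) J'"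
    and JJ': "?J \<cdot>\<^bsub>B\<^esub> J' = Id B (FObj U (X \<otimes>\<^sub>o Z))"
    using iso[OF X] J by (auto simp: is_iso_def arr_def)
  obtain Jy' where Jy': "arr B (FObj U (Y \<otimes>\<^sub>o Z)) (FObj U Y \<otimes>\<^sub>o\<^bsub>B\<^esub> FObj U Z) Jy'"
    and JyJy: "Jy' \<cdot>\<^bsub>B\<^esub> ?Jy = Id B (FObj U Y \<otimes>\<^sub>o\<^bsub>B\<^esub> FObj U Z)"
    using iso[OF Y] Jy by (auto simp: is_iso_def arr_def)
  obtain s where s: "arr B (FObj U Y) (FObj U X) s"
    and fsf: "FMor U f \<cdot>\<^bsub>B\<^esub> (s \<cdot>\<^bsub>B\<^esub> FMor U f) = FMor U f"
    using allowable_section[OF allow X Y] .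
  let ?\<sigma> = "s \<otimes>\<^sub>m\<^bsub>B\<^esub> Id B (FObj U Z)"
  note Uf = U_arr[OF f] and G = U_arr[OF fZ]
  note \<phi> = B.arr_TensM_Id(1)[OF Uf UO[OF Z]] and \<sigma> = B.arr_TensM_Id(1)[OF s UO[OF Z]]
  have \<phi>\<sigma>\<phi>: "?\<phi> \<cdot>\<^bsub>B\<^esub> (?\<sigma> \<cdot>\<^bsub>B\<^esub> ?\<phi>) = ?\<phi>"
    using B.TensM_Id_Comp(1)[OF Uf s UO[OF Z]] B.TensM_Id_Comp(1)[OF B.arr_Comp[OF Uf s] Uf UO[OF Z]] fsf
    by simp
  have "?G \<cdot>\<^bsub>B\<^esub> ?J = ?Jy \<cdot>\<^bsub>B\<^esub> (FMor U f \<otimes>\<^sub>m\<^bsub>B\<^esub> FMor U (Id A Z))"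
    using monoidal f Z Id_in_hom[OF Z] by (simp add: monoidal_functor_def arr_def)
  moreover have "FMor U (Id A Z) = Id B (FObj U Z)"
    using U_functor Z by (simp add: is_functor_def)
  ultimately have GJ: "?G \<cdot>\<^bsub>B\<^esub> ?J = ?Jy \<cdot>\<^bsub>B\<^esub> ?\<phi>" by simp
  note \<phi>J' = B.arr_Comp[OF J' \<phi>]
  have G_eq: "?G = ?Jy \<cdot>\<^bsub>B\<^esub> (?\<phi> \<cdot>\<^bsub>B\<^esub> J')"
    using B.assoc[OF J' J G] B.assoc[OF J' \<phi> Jy] JJ' GJ B.Comp_Id_right[OF G] by simp
  have "Jy' \<cdot>\<^bsub>B\<^esub> ?G = ?\<phi> \<cdot>\<^bsub>B\<^esub> J'"
    unfolding G_eq using B.assoc[OF \<phi>J' Jy Jy'] JyJy B.Comp_Id_left[OF \<phi>J'] by simp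
  then have "(?J \<cdot>\<^bsub>B\<^esub> (?\<sigma> \<cdot>\<^bsub>B\<^esub> Jy')) \<cdot>\<^bsub>B\<^esub> ?G = ?J \<cdot>\<^bsub>B\<^esub> (?\<sigma> \<cdot>\<^bsub>B\<^esub> (?\<phi> \<cdot>\<^bsub>B\<^esub> J'))"
    using B.assoc[OF G B.arr_Comp[OF Jy' \<sigma>] J] B.assoc[OF G Jy' \<sigma>] by simp
  then have "?G \<cdot>\<^bsub>B\<^esub> ((?J \<cdot>\<^bsub>B\<^esub> (?\<sigma> \<cdot>\<^bsub>B\<^esub> Jy')) \<cdot>\<^bsub>B\<^esub> ?G) =
      (?Jy \<cdot>\<^bsub>B\<^esub> ?\<phi>) \<cdot>\<^bsub>B\<^esub> (?\<sigma> \<cdot>\<^bsub>B\<^esub> (?\<phi> \<cdot>\<^bsub>B\<^esub> J'))"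
    using B.assoc[OF B.arr_Comp[OF \<phi>J' \<sigma>] J G] GJ by simp
  also have "\<dots> = ?Jy \<cdot>\<^bsub>B\<^esub> ((?\<phi> \<cdot>\<^bsub>B\<^esub> (?\<sigma> \<cdot>\<^bsub>B\<^esub> ?\<phi>)) \<cdot>\<^bsub>B\<^esub> J')"
    using B.assoc[OF B.arr_Comp[OF \<phi>J' \<sigma>] \<phi> Jy] B.assoc[OF J' B.arr_Comp[OF \<phi> \<sigma>] \<phi>] B.assoc[OF J' \<phi> \<sigma>]
    by simp
  also have "\<dots> = ?G" unfolding \<phi>\<sigma>\<phi> using G_eq by simp
  finally show ?thesis
    by (rule allowableI[OF fZ B.arr_Comp[OF B.arr_Comp[OF Jy' \<sigma>] J]])
qed

text \<open>Lifting a morphism on \<open>P \<otimes> X\<close> along \<open>f\<close> amounts to lifting its transpose on \<open>P\<close> along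
  \<open>f \<otimes> Dual X\<close>, which is again an allowable epimorphism.\<close>

lemma relatively_projective_TensM:
  assumes P: "relatively_projective A B U P" and X: "X \<in> Obj A"
  shows "relatively_projective A B U (P \<otimes>\<^sub>o X)"
  unfolding relatively_projective_def
proof (intro conjI ballI allI impI)
  have PO: "P \<in> Obj A" using P by (simp add: relatively_projective_def)
  show PX: "P \<otimes>\<^sub>o X \<in> Obj A" using PO X by (rule TensO_obj)
  note dual = Dual_left_dual[OF X]
  have X': "Dual A X \<in> Obj A" using dual by (simp add: is_left_dual_def)
  fix S T f g assume S: "S \<in> Obj A" and T: "T \<in> Obj A"
    and asm: "is_epi A S T f \<and> allowable A B U S T f \<and> g \<in> hom_set A (P \<otimes>\<^sub>o X) T"
  have f: "arr A S T f" and g: "arr A (P \<otimes>\<^sub>o X) T g"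
    using asm S T PX by (auto simp: arr_def is_epi_def)
  note g' = arr_transpose[OF dual g PO]
  have "is_epi A (S \<otimes>\<^sub>o Dual A X) (T \<otimes>\<^sub>o Dual A X) (f \<otimes>\<^sub>m Id A (Dual A X))"
    using epi_TensM_left_dual[OF Dual_left_dual[OF X'] f] asm by blast
  moreover have "allowable A B U (S \<otimes>\<^sub>o Dual A X) (T \<otimes>\<^sub>o Dual A X) (f \<otimes>\<^sub>m Id A (Dual A X))"
    using allowable_TensM[OF f _ X'] asm by blast
  ultimately obtain h where h: "arr A P (S \<otimes>\<^sub>o Dual A X) h"
    and gh: "transpose A (Dual A X) (Coev A X) P g = (f \<otimes>\<^sub>m Id A (Dual A X)) \<cdot> h"
    using relatively_projective_lift[OF P arr_TensM_Id(1)[OF f X'] _ _ g'] by blast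
  have "f \<cdot> untranspose A X (Ev A X) S h = g"
    using untranspose_natural_right[OF dual h f] untranspose_transpose[OF dual g PO] gh by simp
  then show "\<exists>h\<in>hom_set A (P \<otimes>\<^sub>o X) S. f \<cdot> h = g"
    using arrD(3)[OF arr_untranspose[OF dual h S]] by blast
qed

text \<open>A single presentation of the unit object presents every object \<open>X = 1 \<otimes> X\<close>, and its syzygy is
  \<open>K \<otimes> X\<close>.\<close>

lemma rel_presentation_TensM:
  assumes pres: "rel_presentation A B U (Unit A) K P j \<pi>" and X: "X \<in> Obj A"
  shows "rel_presentation A B U X (K \<otimes>\<^sub>o X) (P \<otimes>\<^sub>o X) (j \<otimes>\<^sub>m Id A X) (\<pi> \<otimes>\<^sub>m Id A X)"
proof -
  note \<pi> = rel_presentation_arr(1)[OF pres]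
  have "relatively_projective A B U (P \<otimes>\<^sub>o X)"
    using relatively_projective_TensM[OF _ X] pres by (simp add: rel_presentation_def)
  moreover have "is_epi A (P \<otimes>\<^sub>o X) X (\<pi> \<otimes>\<^sub>m Id A X)"
    using epi_TensM_left_dual[OF Dual_left_dual[OF X] \<pi> rel_presentation_arr(6)[OF pres]]
      TensO_Unit(1)[OF X] by simp
  moreover have "allowable A B U (P \<otimes>\<^sub>o X) X (\<pi> \<otimes>\<^sub>m Id A X)"
    using allowable_TensM[OF \<pi> _ X] pres TensO_Unit(1)[OF X] by (simp add: rel_presentation_def)
  moreover have "is_kernel A (P \<otimes>\<^sub>o X) X (\<pi> \<otimes>\<^sub>m Id A X) (K \<otimes>\<^sub>o X) (j \<otimes>\<^sub>m Id A X)"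
  proof -
    obtain Y e c where "is_left_dual A Y X e c" using right_dual_exists[OF X] by blast
    then show ?thesis
      using kernel_TensM_right_dual[OF _ \<pi> rel_presentation_arr(4)[OF pres]] TensO_Unit(1)[OF X]
      by metis
  qed
  ultimately show ?thesis using X by (simp add: rel_presentation_def)
qed

text \<open>The syzygies of \<open>V\<close> are taken to be \<open>L\<close>, \<open>K \<otimes> L\<close>, \<open>K \<otimes> K \<otimes> L\<close> and so on: after the given
  presentation of \<open>V\<close> the presentation of the unit object is tensored with the previous syzygy. The
  Ext space is computed from the presentation of the last one by \<open>K \<otimes> X \<rightarrow> P \<otimes> X\<close>, and \<open>X\<close> is moved to
  the other argument by duality. Arbitrary left duals are admitted so that the unit object can serve
  as its own dual.\<close>

theorem vdim_rel_Ext_restriction_cokernel: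
  assumes unit: "rel_presentation A B U (Unit A) K P j \<pi>" and j: "allowable A B U K P j"
    and V: "rel_presentation A B U V L Q i p" and i: "allowable A B U L Q i" and W: "W \<in> Obj A"
    and dualV: "is_left_dual A V V' eV cV" and dualL: "is_left_dual A L L' eL cL"
    and dualK: "is_left_dual A K K' eK cK"
  shows "vdim k (rel_Ext A B U 1 V W) = vdim k (restriction_cokernel A K P j (W \<otimes>\<^sub>o V'))"
    and "vdim k (rel_Ext A B U (Suc (Suc n)) V W) =
      vdim k (restriction_cokernel A K P j (W \<otimes>\<^sub>o L' \<otimes>\<^sub>o tensor_power A K' n))"
proof -
  have K: "K \<in> Obj A" and L: "L \<in> Obj A" and L': "L' \<in> Obj A" and VO: "V \<in> Obj A"
    using dualK dualL dualV by (auto simp: is_left_dual_def)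
  note jarr = rel_presentation_arr(2)[OF unit]
  have P: "P \<in> Obj A" using jarr by (simp add: arr_def)
  let ?X = "\<lambda>n. case n of 0 \<Rightarrow> V | Suc m \<Rightarrow> tensor_power A K m \<otimes>\<^sub>o L"
  let ?Q = "\<lambda>n. case n of 0 \<Rightarrow> Q | Suc m \<Rightarrow> P \<otimes>\<^sub>o ?X n"
  let ?i = "\<lambda>n. case n of 0 \<Rightarrow> i | Suc m \<Rightarrow> j \<otimes>\<^sub>m Id A (?X n)"
  let ?p = "\<lambda>n. case n of 0 \<Rightarrow> p | Suc m \<Rightarrow> \<pi> \<otimes>\<^sub>m Id A (?X n)"
  have Kn: "tensor_power A K n \<in> Obj A" for n by (rule tensor_power_obj[OF K])
  have XO: "?X n \<in> Obj A" for n using VO TensO_obj[OF Kn L] by (cases n) auto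
  have KX: "K \<otimes>\<^sub>o ?X (Suc n) = ?X (Suc (Suc n))" for n
    using TensO_assoc[OF K Kn L] tensor_power_commute[OF K] by simp
  \<comment> \<open>Step \<open>0\<close> is the given presentation of \<open>V\<close>, since the zeroth tensor power of \<open>K\<close> is the unit
    object and the first syzygy is therefore \<open>L\<close>.\<close>
  have pres: "rel_presentation A B U (?X n) (?X (Suc n)) (?Q n) (?i n) (?p n)" for n
  proof (cases n)
    case 0
    then show ?thesis using V TensO_Unit(1)[OF L] by simp
  next
    case (Suc m)
    then show ?thesis using rel_presentation_TensM[OF unit XO[of "Suc m"]] KX[of m] by simp
  qed
  have allow: "allowable A B U (?X (Suc n)) (?Q n) (?i n)" for n
  proof (cases n)
    case 0
    then show ?thesis using i TensO_Unit(1)[OF L] by simp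
  next
    case (Suc m)
    then show ?thesis using allowable_TensM[OF jarr j XO[of "Suc m"]] KX[of m] by simp
  qed
  have ext: "vdim k (rel_Ext A B U (Suc n) V W) =
      vdim k (restriction_cokernel A (K \<otimes>\<^sub>o ?X n) (P \<otimes>\<^sub>o ?X n) (j \<otimes>\<^sub>m Id A (?X n)) W)" for n
    using vdim_rel_Ext[where X = ?X and Q = ?Q and i = ?i and p = ?p and n = n,
      OF pres allow rel_presentation_TensM[OF unit XO] W] by simp
  show "vdim k (rel_Ext A B U 1 V W) = vdim k (restriction_cokernel A K P j (W \<otimes>\<^sub>o V'))"
    using ext[of 0] restriction_cokernel_transpose[OF dualV jarr W] by simp
  have "vdim k (rel_Ext A B U (Suc (Suc n)) V W) =
      vdim k (restriction_cokernel A (K \<otimes>\<^sub>o tensor_power A K n \<otimes>\<^sub>o L) (P \<otimes>\<^sub>o tensor_power A K n \<otimes>\<^sub>o L)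
        (j \<otimes>\<^sub>m Id A (tensor_power A K n) \<otimes>\<^sub>m Id A L) W)"
    using ext[of "Suc n"] TensO_assoc[OF K Kn L] TensO_assoc[OF P Kn L]
      TensM_Id_assoc(1)[OF jarr Kn L] by simp
  also have "\<dots> = vdim k (restriction_cokernel A (K \<otimes>\<^sub>o tensor_power A K n) (P \<otimes>\<^sub>o tensor_power A K n)
        (j \<otimes>\<^sub>m Id A (tensor_power A K n)) (W \<otimes>\<^sub>o L'))"
    by (rule restriction_cokernel_transpose[OF dualL arr_TensM_Id(1)[OF jarr Kn] W])
  also have "\<dots> = vdim k (restriction_cokernel A K P j (W \<otimes>\<^sub>o L' \<otimes>\<^sub>o tensor_power A K' n))"
    by (rule restriction_cokernel_tensor_power[OF jarr dualK TensO_obj[OF W L']])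
  finally show "vdim k (rel_Ext A B U (Suc (Suc n)) V W) =
      vdim k (restriction_cokernel A K P j (W \<otimes>\<^sub>o L' \<otimes>\<^sub>o tensor_power A K' n))" .
qed

text \<open>Passing from the additive form to the one with a difference is arithmetic in the extended reals,
  where a finite term can be subtracted.\<close>

lemma vdim_restriction_cokernel_presentation:
  assumes unit: "rel_presentation A B U (Unit A) K P j \<pi>" and M: "M \<in> Obj A"
  shows "(vdim k (Hom A P M) \<noteq> \<infinity> \<longrightarrow> vdim k (restriction_cokernel A K P j M) =
      vdim k (Hom A K M) - vdim k (Hom A P M) + vdim k (Hom A (Unit A) M)) \<and>
    vdim k (restriction_cokernel A K P j M) + vdim k (Hom A P M) =
      vdim k (Hom A K M) + vdim k (Hom A (Unit A) M)"
proof -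
  note \<pi> = rel_presentation_arr(1)[OF unit] and j = rel_presentation_arr(2)[OF unit]
  have "is_cokernel A K P j (Unit A) \<pi>"
    using epi_is_cokernel_of_kernel[OF \<pi> rel_presentation_arr(6,4)[OF unit]] .
  note dims = vdim_restriction_cokernel[OF j \<pi> this M]
  have "0 \<le> vdim k (restriction_cokernel A K P j M)" "0 \<le> vdim k (Hom A P M)"
    "0 \<le> vdim k (Hom A K M)" "0 \<le> vdim k (Hom A (Unit A) M)"
    by (simp_all add: vdim_nonneg)
  then show ?thesis
    using dims
    by (cases "vdim k (restriction_cokernel A K P j M)"; cases "vdim k (Hom A P M)";
        cases "vdim k (Hom A K M)"; cases "vdim k (Hom A (Unit A) M)") auto
qed

end

theorem corollary3p5:
  fixes k :: "('k, 'r) ring_scheme"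
    and A :: "('k, 'o, 'm, 'z) tensor_cat_scheme"
    and B :: "('k, 'p, 'q, 'y) tensor_cat_scheme"
    and U :: "('o, 'm, 'p, 'q, 'x) mon_functor_scheme"
    and V W K P L Q :: 'o and j \<pi> i p :: 'm and M :: "nat \<Rightarrow> 'o"
  assumes "tensor_category k A" and "tensor_category k B"
    and "linear_functor k A B U" and "exact_functor A B U" and "faithful_functor A B U"
    and "monoidal_functor A B U" and "has_left_adjoint A B U"
    and "V \<in> Obj A" and "W \<in> Obj A"
    and "allowable_short_exact A B U K P (Unit A) j \<pi>"
    and "allowable_short_exact A B U L Q V i p"
    and "relatively_projective A B U P" and "relatively_projective A B U Q"
    and "M 1 = W \<otimes>\<^sub>o\<^bsub>A\<^esub> Dual A V"
    and "\<And>n. n \<ge> 2 \<Longrightarrow>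
           M n = W \<otimes>\<^sub>o\<^bsub>A\<^esub> Dual A L \<otimes>\<^sub>o\<^bsub>A\<^esub> tensor_power A (Dual A K) (n - 2)"
  shows "(\<forall>n\<ge>1.
      (vdim k (Hom A P (M n)) \<noteq> \<infinity> \<longrightarrow>
        vdim k (rel_Ext A B U n V W) =
          vdim k (Hom A K (M n)) - vdim k (Hom A P (M n)) + vdim k (Hom A (Unit A) (M n))) \<and>
      vdim k (rel_Ext A B U n V W) + vdim k (Hom A P (M n)) =
        vdim k (Hom A K (M n)) + vdim k (Hom A (Unit A) (M n))) \<and>
    (\<forall>n\<ge>1. let N = tensor_power A (Dual A K) (n - 1) in
      (vdim k (Hom A P N) \<noteq> \<infinity> \<longrightarrow>
        vdim k (rel_Ext A B U n (Unit A) (Unit A)) =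
          vdim k (Hom A K N) - vdim k (Hom A P N) + vdim k (Hom A (Unit A) N)) \<and>
      vdim k (rel_Ext A B U n (Unit A) (Unit A)) + vdim k (Hom A P N) =
        vdim k (Hom A K N) + vdim k (Hom A (Unit A) N))"
proof -
  interpret relative_tensor k A B U
    by (intro relative_tensor.intro relative_tensor_axioms.intro assms)
  have unit: "rel_presentation A B U (Unit A) K P j \<pi>" and V: "rel_presentation A B U V L Q i p"
    using short_exact_rel_presentation assms(10-13) by auto
  have j: "allowable A B U K P j" and i: "allowable A B U L Q i"
    using assms(10,11) by (auto simp: allowable_short_exact_def)
  have K: "K \<in> Obj A" and L: "L \<in> Obj A"
    using assms(10,11) by (auto simp: allowable_short_exact_def short_exact_def)
  note dual = Dual_left_dual
  have DO: "Dual A X \<in> Obj A" if "X \<in> Obj A" for X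
    using dual[OF that] by (simp add: is_left_dual_def)
  note DK = DO[OF K] and DL = DO[OF L] and DV = DO[OF assms(8)]
  have general: "vdim k (rel_Ext A B U n V W) = vdim k (restriction_cokernel A K P j (M n)) \<and> M n \<in> Obj A"
    if "n \<ge> 1" for n
  proof -
    note ext = vdim_rel_Ext_restriction_cokernel[OF unit j V i assms(9) dual[OF assms(8)] dual[OF L] dual[OF K]]
    consider "n = 1" | m where "n = Suc (Suc m)"
      using \<open>n \<ge> 1\<close> by (cases n; cases "n - 1") auto
    then show ?thesis
    proof cases
      case 1
      then show ?thesis using ext(1) assms(14) TensO_obj[OF assms(9) DV] by simp
    next
      case 2
      then show ?thesis
        using ext(2)[of m] assms(15)[of n] TensO_obj[OF TensO_obj[OF assms(9) DL] tensor_power_obj[OF DK]]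
        by simp
    qed
  qed
  \<comment> \<open>Here \<open>V\<close> is the unit object, with \<open>L = K\<close> and \<open>Q = P\<close>, so one factor of the tensor power stems
    from the dual of \<open>L\<close>.\<close>
  have trivial: "vdim k (rel_Ext A B U n (Unit A) (Unit A)) =
      vdim k (restriction_cokernel A K P j (tensor_power A (Dual A K) (n - 1)))"
    if "n \<ge> 1" for n
  proof -
    note ext = vdim_rel_Ext_restriction_cokernel[OF unit j unit j Unit_obj Unit_left_dual dual[OF K] dual[OF K]]
    consider "n = 1" | m where "n = Suc (Suc m)"
      using \<open>n \<ge> 1\<close> by (cases n; cases "n - 1") auto
    then show ?thesis
    proof cases
      case 1
      then show ?thesis using ext(1) TensO_Unit(1)[OF Unit_obj] by simp
    next
      case 2
      then show ?thesis
        using ext(2)[of m] TensO_Unit(1)[OF DK] tensor_power_commute[OF DK, of m] by simp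
    qed
  qed
  show ?thesis
    unfolding Let_def
    using vdim_restriction_cokernel_presentation[OF unit] general trivial tensor_power_obj[OF DK]
    by simp
qed

end
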